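(* Assume $\Omega_1$ and $\Omega_2$ are bounded, connected open sets with Lipschitz boundary in $\mathbb{R}^d$ if $d\geq 2$, or bounded open intervals if $d=1$. Let $U:C(\overline{\Omega}_1)\to C(\overline{\Omega}_2)$ be a bounded linear operator satisfying the assumptions (a) $f\cdot g=0$ implies $(Uf)\cdot(Ug)=0$ for all $f,g\in C(\overline{\Omega}_1)$; and (b) $U(C_c^\infty(\Omega_1))\subset D(\Delta^\beta_{\Omega_2})$ for some $\beta\in C(\partial\Omega_2)$, and $U(\Delta f)=\Delta(Uf)$ for all $f\in C_c^\infty(\Omega_1)$; and (c) if $\omega\subset\Omega_2$ is open and $(Uf)|_\omega=0$ for all $f\in C_c^\infty(\Omega_1)$, then $\omega=\emptyset$. Then there exist a constant $c\in\mathbb{C}\setminus\{0\}$ and, for some $n\geq 1$, pairwise disjoint, connected open sets $\omega_1,\dots,\omega_n\subset\Omega_2$ and isometries $\bar\tau_1,\dots,\bar\tau_n:\mathbb{R}^d\to\mathbb{R}^d$ such that $\bar\tau_i(\omega_i)=\Omega_1$ for all $i=1,\dots,n$, the set $\bigcup_{i=1}^n\omega_i$ is dense in $\Omega_2$, and for all $f\in C(\overline\Omega_1)$ $$Uf(y)=c\,f(\bar\tau_i(y))\qquad\text{for all } y\in\overline{\omega}_i,\ \text{for all } i=1,\dots,n.$$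
   Context: Functions are complex-valued (the Robin coefficient $\beta$ is real-valued) and open sets are non-empty unless the contrary is concluded. $C(\overline\Omega)$ carries the supremum norm. For a bounded open set $\Omega\subset\mathbb{R}^d$ with Lipschitz boundary (a bounded interval if $d=1$), let $\sigma$ be surface measure on $\partial\Omega$ (counting measure if $d=1$). For $u\in H^1(\Omega)$ with distributional Laplacian $\Delta u\in L^2(\Omega)$, the distributional outer normal derivative $\frac{\partial u}{\partial\nu}$ is the unique $h\in L^2(\partial\Omega)$, if it exists, with $\int_\Omega(\nabla u\cdot\overline{\nabla v}+\Delta u\,\overline v)\,dx=\int_{\partial\Omega}h\overline v\,d\sigma$ for all $v\in H^1(\Omega)$. For $\beta\in C(\partial\Omega)$ the Robin Laplacian on $C(\overline\Omega)$ is given by $D(\Delta^\beta_\Omega)=\{u\in H^1(\Omega)\cap C(\overline\Omega):\Delta u\in C(\overline\Omega),\ \frac{\partial u}{\partial\nu}\text{ exists in }L^2(\partial\Omega)\text{ and equals }-\beta u\}$, $\Delta^\beta_\Omega u=\Delta u$; $\beta\equiv0$ gives the Neumann Laplacian. *)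

theory Defs
  imports "HOL-Analysis.Analysis"
begin

section \<open>Domains in Euclidean space\<close>

text \<open>Around each boundary point the set is, in suitable orthogonal coordinates with last axis
  \<open>e\<close>, the strict epigraph of a Lipschitz function \<open>\<phi>\<close> on the hyperplane orthogonal to \<open>e\<close>.
  Hence the boundary is locally the graph of \<open>\<phi>\<close>.\<close>

definition lipschitz_boundary :: "'a::euclidean_space set \<Rightarrow> bool" where
  "lipschitz_boundary \<Omega> \<longleftrightarrow>
    (\<forall>z\<in>frontier \<Omega>. \<exists>V e \<phi> L. open V \<and> z \<in> V \<and> norm e = 1 \<and>
        L-lipschitz_on {x. x \<bullet> e = 0} \<phi> \<and>
        \<Omega> \<inter> V = {x \<in> V. (\<phi> (x - (x \<bullet> e) *\<^sub>R e) :: real) < x \<bullet> e})"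

text \<open>For \<open>d = 1\<close>, \<open>box a b\<close> is a bounded open interval.\<close>

definition admissible_domain :: "'a::euclidean_space set \<Rightarrow> bool" where
  "admissible_domain \<Omega> \<longleftrightarrow> \<Omega> \<noteq> {} \<and>
    (if DIM('a) = 1 then \<exists>a b. \<Omega> = box a b
     else open \<Omega> \<and> bounded \<Omega> \<and> connected \<Omega> \<and> lipschitz_boundary \<Omega>)"


section \<open>Continuous functions on a compact set\<close>

text \<open>\<open>C(K)\<close>, each element being represented by its extension by zero to the whole space, so that
  equality in \<open>C(K)\<close> is equality of functions.\<close>

definition cont_funs :: "'a::euclidean_space set \<Rightarrow> ('a \<Rightarrow> complex) set" where
  "cont_funs K = {f. continuous_on K f \<and> (\<forall>x. x \<notin> K \<longrightarrow> f x = 0)}"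

definition sup_norm :: "'a::euclidean_space set \<Rightarrow> ('a \<Rightarrow> complex) \<Rightarrow> real" where
  "sup_norm K f = (SUP x\<in>K. norm (f x))"

definition bounded_linear_operator ::
    "'a::euclidean_space set \<Rightarrow> 'a set \<Rightarrow> (('a \<Rightarrow> complex) \<Rightarrow> ('a \<Rightarrow> complex)) \<Rightarrow> bool" where
  "bounded_linear_operator K L U \<longleftrightarrow>
    (\<forall>f\<in>cont_funs K. U f \<in> cont_funs L) \<and>
    (\<forall>f\<in>cont_funs K. \<forall>g\<in>cont_funs K. U (\<lambda>x. f x + g x) = (\<lambda>y. U f y + U g y)) \<and>
    (\<forall>f\<in>cont_funs K. \<forall>a. U (\<lambda>x. a * f x) = (\<lambda>y. a * U f y)) \<and>
    (\<exists>B. \<forall>f\<in>cont_funs K. sup_norm L (U f) \<le> B * sup_norm K f)"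


section \<open>Test functions\<close>

definition pderiv_at :: "'a::euclidean_space \<Rightarrow> ('a \<Rightarrow> complex) \<Rightarrow> 'a \<Rightarrow> complex" where
  "pderiv_at b f x = frechet_derivative f (at x) b"

fun C_k :: "nat \<Rightarrow> ('a::euclidean_space \<Rightarrow> complex) \<Rightarrow> bool" where
  "C_k 0 f \<longleftrightarrow> continuous_on UNIV f"
| "C_k (Suc k) f \<longleftrightarrow> (\<forall>x. f differentiable (at x)) \<and> (\<forall>b\<in>Basis. C_k k (pderiv_at b f))"

definition test_funs :: "'a::euclidean_space set \<Rightarrow> ('a \<Rightarrow> complex) set" where
  "test_funs \<Omega> = {f. (\<forall>k. C_k k f) \<and> compact (closure {x. f x \<noteq> 0}) \<and> closure {x. f x \<noteq> 0} \<subseteq> \<Omega>}"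

definition laplacian :: "('a::euclidean_space \<Rightarrow> complex) \<Rightarrow> 'a \<Rightarrow> complex" where
  "laplacian f x = (\<Sum>b\<in>Basis. pderiv_at b (pderiv_at b f) x)"


section \<open>Sobolev space and distributional Laplacian\<close>

definition L2 :: "'a measure \<Rightarrow> ('a \<Rightarrow> complex) set" where
  "L2 M = {f \<in> borel_measurable M. integrable M (\<lambda>x. (norm (f x))\<^sup>2)}"

text \<open>A gradient is given by its components \<open>Du b\<close> in the directions \<open>b \<in> Basis\<close>.\<close>

definition has_weak_gradient ::
    "'a::euclidean_space set \<Rightarrow> ('a \<Rightarrow> complex) \<Rightarrow> ('a \<Rightarrow> 'a \<Rightarrow> complex) \<Rightarrow> bool" where
  "has_weak_gradient \<Omega> u Du \<longleftrightarrow>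
    (\<forall>b\<in>Basis. Du b \<in> L2 (lebesgue_on \<Omega>) \<and>
      (\<forall>\<phi>\<in>test_funs \<Omega>. (LINT x|lebesgue_on \<Omega>. u x * pderiv_at b \<phi> x)
                        = - (LINT x|lebesgue_on \<Omega>. Du b x * \<phi> x)))"

definition H1 :: "'a::euclidean_space set \<Rightarrow> ('a \<Rightarrow> complex) set" where
  "H1 \<Omega> = {u \<in> L2 (lebesgue_on \<Omega>). \<exists>Du. has_weak_gradient \<Omega> u Du}"

text \<open>Used only for \<open>u\<close> and \<open>w\<close> in \<open>L2 (lebesgue_on \<Omega>)\<close>; then \<open>w\<close> is unique almost everywhere
  in \<open>\<Omega>\<close>, and unique altogether within \<open>cont_funs (closure \<Omega>)\<close>.\<close>

definition has_distr_laplacian ::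
    "'a::euclidean_space set \<Rightarrow> ('a \<Rightarrow> complex) \<Rightarrow> ('a \<Rightarrow> complex) \<Rightarrow> bool" where
  "has_distr_laplacian \<Omega> u w \<longleftrightarrow>
    (\<forall>\<phi>\<in>test_funs \<Omega>. (LINT x|lebesgue_on \<Omega>. u x * laplacian \<phi> x)
                     = (LINT x|lebesgue_on \<Omega>. w x * \<phi> x))"


section \<open>Surface measure, traces and the normal derivative\<close>

text \<open>The \<open>k\<close>-dimensional Hausdorff outer measure, normalised so that it agrees with
  \<open>k\<close>-dimensional Lebesgue measure on \<open>k\<close>-dimensional subspaces.\<close>

definition hausdorff_content :: "nat \<Rightarrow> real \<Rightarrow> 'a::euclidean_space set \<Rightarrow> ennreal" where
  "hausdorff_content k \<delta> A =
    (INF E\<in>{E :: nat \<Rightarrow> 'a set. A \<subseteq> (\<Union>i. E i) \<and> (\<forall>i. bounded (E i) \<and> diameter (E i) \<le> \<delta>)}.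
      \<Sum>i. if E i = {} then 0 else ennreal (unit_ball_vol (real k) * (diameter (E i) / 2) ^ k))"

definition hausdorff_outer :: "nat \<Rightarrow> 'a::euclidean_space set \<Rightarrow> ennreal" where
  "hausdorff_outer k A = (SUP \<delta>\<in>{0<..}. hausdorff_content k \<delta> A)"

text \<open>On a Lipschitz boundary, surface measure is the \<open>(d-1)\<close>-dimensional Hausdorff measure on the
  Borel sets.\<close>

definition surface_measure :: "'a::euclidean_space set \<Rightarrow> 'a measure" where
  "surface_measure \<Omega> =
    (if DIM('a) = 1 then count_space (frontier \<Omega>)
     else restrict_space (measure_of UNIV (sets borel) (hausdorff_outer (DIM('a) - 1))) (frontier \<Omega>))"

text \<open>The trace operator from \<open>H1 \<Omega>\<close> to \<open>L2 (surface_measure \<Omega>)\<close>: the continuous extension of the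
  restriction map \<open>v \<mapsto> v|\<^bsub>\<partial>\<Omega>\<^esub>\<close> from the dense subspace of functions in \<open>H1 \<Omega>\<close> that are continuous on
  \<open>closure \<Omega>\<close>. As a relation: \<open>g\<close> is a trace of \<open>v\<close> if \<open>(v, g)\<close> is a limit of pairs
  \<open>(V n, V n|\<^bsub>\<partial>\<Omega>\<^esub>)\<close> in \<open>H1 \<times> L2\<close>.\<close>

definition has_trace ::
    "'a::euclidean_space set \<Rightarrow> ('a \<Rightarrow> complex) \<Rightarrow> ('a \<Rightarrow> complex) \<Rightarrow> bool" where
  "has_trace \<Omega> v g \<longleftrightarrow> v \<in> H1 \<Omega> \<and> g \<in> L2 (surface_measure \<Omega>) \<and>
    (\<exists>V DV Dv.
      (\<forall>n::nat. V n \<in> H1 \<Omega> \<and> continuous_on (closure \<Omega>) (V n) \<and> V n \<in> L2 (surface_measure \<Omega>) \<and>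
                has_weak_gradient \<Omega> (V n) (DV n)) \<and>
      has_weak_gradient \<Omega> v Dv \<and>
      (\<lambda>n. LINT x|lebesgue_on \<Omega>. (norm (V n x - v x))\<^sup>2) \<longlonglongrightarrow> 0 \<and>
      (\<forall>b\<in>Basis. (\<lambda>n. LINT x|lebesgue_on \<Omega>. (norm (DV n b x - Dv b x))\<^sup>2) \<longlonglongrightarrow> 0) \<and>
      (\<lambda>n. LINT z|surface_measure \<Omega>. (norm (V n z - g z))\<^sup>2) \<longlonglongrightarrow> 0)"

text \<open>Distributional outer normal derivative: Green's formula against all of \<open>H1 \<Omega>\<close>. The objects
  \<open>w\<close>, \<open>Du\<close>, \<open>Dv\<close>, \<open>g\<close> are determined almost everywhere by \<open>u\<close> and \<open>v\<close>.\<close>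

definition has_normal_derivative ::
    "'a::euclidean_space set \<Rightarrow> ('a \<Rightarrow> complex) \<Rightarrow> ('a \<Rightarrow> complex) \<Rightarrow> bool" where
  "has_normal_derivative \<Omega> u h \<longleftrightarrow> u \<in> H1 \<Omega> \<and> h \<in> L2 (surface_measure \<Omega>) \<and>
    (\<exists>w\<in>L2 (lebesgue_on \<Omega>). has_distr_laplacian \<Omega> u w \<and>
      (\<forall>v\<in>H1 \<Omega>. \<forall>Du Dv g.
        has_weak_gradient \<Omega> u Du \<and> has_weak_gradient \<Omega> v Dv \<and> has_trace \<Omega> v g \<longrightarrow>
        (LINT x|lebesgue_on \<Omega>. (\<Sum>b\<in>Basis. Du b x * cnj (Dv b x)) + w x * cnj (v x))
          = (LINT z|surface_measure \<Omega>. h z * cnj (g z))))"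


section \<open>The Robin Laplacian\<close>

text \<open>The domain of the Robin Laplacian on \<open>C(closure \<Omega>)\<close>; the operator acts as the
  distributional Laplacian.\<close>

definition robin_domain :: "'a::euclidean_space set \<Rightarrow> ('a \<Rightarrow> real) \<Rightarrow> ('a \<Rightarrow> complex) set" where
  "robin_domain \<Omega> \<beta> = {u \<in> H1 \<Omega> \<inter> cont_funs (closure \<Omega>).
    (\<exists>w\<in>cont_funs (closure \<Omega>). has_distr_laplacian \<Omega> u w) \<and>
    has_normal_derivative \<Omega> u (\<lambda>z. - complex_of_real (\<beta> z) * u z)}"

end

theory Submission
  imports Defs
begin

text \<open>
  A disjointness preserving operator is a weighted composition \<open>f \<mapsto> w \<cdot> (f \<circ> \<tau>)\<close>; let \<open>W\<close> be the dense
  open subset of \<open>\<Omega>2\<close> where \<open>w \<noteq> 0\<close> and \<open>\<tau>\<close> takes values in \<open>\<Omega>1\<close>. Intertwining the Laplacians on the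
  ridge powers \<open>f x = (\<xi> \<bullet> x - s) ^ m\<close> determines, through the radial equation for means over balls,
  the moments of \<open>\<xi> \<bullet> \<tau> - \<xi> \<bullet> \<tau> y\<close> around \<open>y\<close> in terms of \<open>w y\<close>. Their growth as \<open>m \<rightarrow> \<infinity>\<close> shows that
  \<open>\<tau>\<close> is locally a contraction, the second moments turn it into a local isometry, and the zeroth and
  first moments show that \<open>w\<close> is locally constant. So \<open>\<tau>\<close> is an isometry on each component of \<open>W\<close>. A
  boundary point of such a component that is sent into \<open>\<Omega>1\<close> would have to lie on the boundary of \<open>\<Omega>2\<close>,
  where the Robin condition would hold for constant and for all affine functions at once, which is
  impossible; hence each component is mapped onto \<open>\<Omega>1\<close>. Containing a ball of fixed radius each, the
  components are finite in number, so \<open>w\<close> is continuous with finitely many values on the connected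
  set \<open>\<Omega>2\<close>.
\<close>

section \<open>Calculus of smooth functions\<close>

text \<open>Nothing is known about \<open>w\<close> and \<open>\<tau>\<close> beyond continuity, so
  no chain rule is available: every identity is obtained weakly, by testing against radial
  functions, and is read off from how a mean over a ball depends on its radius or on its centre.
  Ridge powers suit this because their Laplacian is a multiple of a lower ridge power in the same
  direction, so the equations for all \<open>m\<close> form a recursion. The weight is complex,
  while pointwise conclusions from integrals need positive weights; hence the local argument runs on
  balls where \<open>w x / w y\<close> has real part at least \<open>1/2\<close>. The even moments
  bound \<open>\<tau>\<close> from above only; the exact second moment then excludes strict
  contraction anywhere. At the boundary the unknown \<open>\<beta>\<close> has to be eliminated: the
  constant function makes the integral of \<open>\<beta>\<close> against every local test function
  vanish, so the affine functions of every slope satisfy a Neumann condition too. This says that the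
  integral of a bump over \<open>\<Omega>2\<close> does not change when the bump is shifted, even
  out of \<open>\<Omega>2\<close>.\<close>

lemma pderiv_at_eq:
  "(f has_derivative f') (at x) \<Longrightarrow> pderiv_at b f x = f' b"
  unfolding pderiv_at_def by (metis frechet_derivative_at)

lemma pderiv_at_cong:
  assumes "open S" "x \<in> S" "\<And>y. y \<in> S \<Longrightarrow> f y = g y"
  shows "pderiv_at b f x = pderiv_at b g x"
proof -
  have "(f has_derivative D) (at x) \<longleftrightarrow> (g has_derivative D) (at x)" for D
    using has_derivative_transform_within_open[of f D x UNIV S g]
      has_derivative_transform_within_open[of g D x UNIV S f] assms by auto
  then show ?thesis unfolding pderiv_at_def frechet_derivative_def by simp
qed

lemma laplacian_cong:
  assumes "open S" "x \<in> S" "\<And>y. y \<in> S \<Longrightarrow> f y = g y"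
  shows "laplacian f x = laplacian g x"
  unfolding laplacian_def
  by (intro sum.cong refl pderiv_at_cong[OF assms(1,2)] pderiv_at_cong[OF assms(1)]) (use assms in auto)

lemma C_k_SucI:
  assumes "\<And>x. (f has_derivative f' x) (at x)" and "\<And>b. b \<in> Basis \<Longrightarrow> C_k k (\<lambda>x. f' x b)"
  shows "C_k (Suc k) f"
proof -
  have "pderiv_at b f = (\<lambda>x. f' x b)" for b
    using pderiv_at_eq[OF assms(1)] by auto
  then show ?thesis using assms by (auto simp: differentiable_def)
qed

lemma C_k_Suc_D: "C_k (Suc k) f \<Longrightarrow> C_k k f"
proof (induction k arbitrary: f)
  case 0
  then show ?case by (auto intro!: continuous_at_imp_continuous_on differentiable_imp_continuous_within)
next
  case (Suc k)
  then show ?case by (metis C_k.simps(2))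
qed

lemma C_k_continuous: "C_k k f \<Longrightarrow> continuous_on S f"
proof (induction k)
  case 0
  then show ?case using continuous_on_subset[of UNIV f S] by auto
next
  case (Suc k)
  then show ?case using C_k_Suc_D by blast
qed

lemma C_k_has_derivative:
  "C_k (Suc k) f \<Longrightarrow> (f has_derivative frechet_derivative f (at x)) (at x)"
  by (simp add: frechet_derivative_works)

lemma C_k_const [simp, intro]: "C_k k (\<lambda>x. c)"
  by (induction k arbitrary: c) (auto simp del: C_k.simps(2) intro!: C_k_SucI[where f'="\<lambda>_ _. 0"])

lemma C_k_add:
  "C_k k f \<Longrightarrow> C_k k g \<Longrightarrow> C_k k (\<lambda>x. f x + g x)"
proof (induction k arbitrary: f g)
  case (Suc k)
  show ?case
    by (rule C_k_SucI[OF has_derivative_add[OF C_k_has_derivative[OF Suc(2)] C_k_has_derivative[OF Suc(3)]]])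
      (use Suc in \<open>auto simp: pderiv_at_def[abs_def]\<close>)
qed (auto intro: continuous_on_add)

lemma C_k_mult:
  "C_k k f \<Longrightarrow> C_k k g \<Longrightarrow> C_k k (\<lambda>x. f x * g x)"
proof (induction k arbitrary: f g)
  case (Suc k)
  have f: "C_k k f" and g: "C_k k g" using Suc C_k_Suc_D by blast+
  show ?case
    by (rule C_k_SucI[OF has_derivative_mult[OF C_k_has_derivative[OF Suc(2)] C_k_has_derivative[OF Suc(3)]]])
      (use Suc f g in \<open>auto simp: pderiv_at_def[abs_def] intro!: C_k_add\<close>)
qed (auto intro: continuous_on_mult)

lemma C_k_minus: "C_k k f \<Longrightarrow> C_k k (\<lambda>x. - f x)"
  using C_k_mult[OF C_k_const[where c="-1"], of k f] by simp

lemma C_k_diff: "C_k k f \<Longrightarrow> C_k k g \<Longrightarrow> C_k k (\<lambda>x. f x - g x)"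
  using C_k_add[OF _ C_k_minus, of k f g] by simp

lemma C_k_power: "C_k k f \<Longrightarrow> C_k k (\<lambda>x. f x ^ n)"
  by (induction n) (auto intro: C_k_mult)

lemma C_k_sum: "(\<And>i. i \<in> I \<Longrightarrow> C_k k (f i)) \<Longrightarrow> C_k k (\<lambda>x. \<Sum>i\<in>I. f i x)"
  by (induction I rule: infinite_finite_induct) (auto intro: C_k_add)

lemma C_k_cnj: "C_k k f \<Longrightarrow> C_k k (\<lambda>x. cnj (f x))"
proof (induction k arbitrary: f)
  case (Suc k)
  show ?case
    by (rule C_k_SucI[OF bounded_linear.has_derivative[OF bounded_linear_cnj C_k_has_derivative[OF Suc(2)]]])
      (use Suc in \<open>auto simp: pderiv_at_def[abs_def]\<close>)
qed (auto intro: continuous_intros)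

lemma C_k_inner: "C_k k (\<lambda>x. complex_of_real (x \<bullet> e))"
proof (cases k)
  case (Suc j)
  show ?thesis unfolding Suc
    by (rule C_k_SucI[where f'="\<lambda>_ h. complex_of_real (h \<bullet> e)"]) (auto intro!: derivative_eq_intros)
qed (auto intro!: continuous_intros)

text \<open>\<open>C_k\<close> speaks of complex-valued functions, so the smoothness of the real
  function \<open>q\<close> is expressed through its complex embedding. The chain rule involves
  \<open>q\<close> itself, whose derivative is recovered as a real part; induction then applies to
  \<open>pderiv_at 1 f\<close>, again composed with \<open>q\<close>.\<close>

lemma C_k_compose:
  fixes f :: "real \<Rightarrow> complex" and q :: "'a::euclidean_space \<Rightarrow> real"
  shows "C_k k f \<Longrightarrow> C_k k (\<lambda>x. complex_of_real (q x)) \<Longrightarrow> C_k k (\<lambda>x. f (q x))"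
proof (induction k arbitrary: f)
  case 0
  have "continuous_on UNIV (\<lambda>x. Re (complex_of_real (q x)))"
    using 0 by (intro continuous_intros) auto
  with 0 show ?case
    using continuous_on_compose2[of UNIV f UNIV q] by auto
next
  case (Suc k)
  let ?Q = "\<lambda>x. frechet_derivative (\<lambda>x. complex_of_real (q x)) (at x)"
  have Q: "((\<lambda>x. complex_of_real (q x)) has_derivative ?Q x) (at x)" for x
    by (rule C_k_has_derivative[OF Suc(3)])
  have q: "(q has_derivative (\<lambda>h. Re (?Q x h))) (at x)" for x
    using bounded_linear.has_derivative[OF bounded_linear_Re Q] by simp
  have Qof: "?Q x h = complex_of_real (Re (?Q x h))" for x h
    using has_derivative_unique[OF Q bounded_linear.has_derivative[OF bounded_linear_of_real q]]
    by metis
  have f: "(f has_derivative frechet_derivative f (at s)) (at s)" for s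
    by (rule C_k_has_derivative[OF Suc(2)])
  have lin: "frechet_derivative f (at s) h = complex_of_real h * pderiv_at 1 f s" for s h
    using linear.scaleR[OF has_derivative_linear[OF f], of s h 1]
    by (simp add: pderiv_at_def scaleR_conv_of_real)
  have C: "C_k k f" "C_k k (\<lambda>x. complex_of_real (q x))" using Suc C_k_Suc_D by blast+
  have C': "C_k k (pderiv_at 1 f)" using Suc by simp
  show ?case
  proof (rule C_k_SucI)
    show "((\<lambda>x. f (q x)) has_derivative (\<lambda>h. ?Q x h * pderiv_at 1 f (q x))) (at x)" for x
      using diff_chain_at[OF q f] unfolding o_def lin Qof[symmetric] .
    show "C_k k (\<lambda>x. ?Q x b * pderiv_at 1 f (q x))" if "b \<in> Basis" for b
      by (rule C_k_mult[OF _ Suc(1)[OF C' C(2)]]) (use Suc(3) that in \<open>simp add: pderiv_at_def[abs_def]\<close>)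
  qed
qed

lemma C_k_Suc_real:
  assumes "\<And>s. (f has_vector_derivative f' s) (at s)" "C_k k f'"
  shows "C_k (Suc k) (f :: real \<Rightarrow> complex)"
  by (rule C_k_SucI[OF assms(1)[unfolded has_vector_derivative_def]]) (use assms in auto)

subsection \<open>Test functions\<close>

lemma closure_support: "x \<notin> closure {x. f x \<noteq> 0} \<Longrightarrow> f x = 0"
  by (rule ccontr) (meson closure_subset mem_Collect_eq subsetD)

lemma test_funsD:
  assumes "\<phi> \<in> test_funs \<Omega>"
  shows "C_k k \<phi>" "compact (closure {x. \<phi> x \<noteq> 0})" "closure {x. \<phi> x \<noteq> 0} \<subseteq> \<Omega>"
    "x \<notin> \<Omega> \<Longrightarrow> \<phi> x = 0"
proof -
  show "C_k k \<phi>" "compact (closure {x. \<phi> x \<noteq> 0})" and sub: "closure {x. \<phi> x \<noteq> 0} \<subseteq> \<Omega>"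
    using assms by (simp_all add: test_funs_def)
  show "\<phi> x = 0" if "x \<notin> \<Omega>"
    by (rule closure_support[of x \<phi>]) (use that sub in auto)
qed

lemma test_funsI:
  assumes "\<And>k. C_k k \<phi>" "compact K" "K \<subseteq> \<Omega>" "\<And>x. x \<notin> K \<Longrightarrow> \<phi> x = 0"
  shows "\<phi> \<in> test_funs \<Omega>"
proof -
  have "closure {x. \<phi> x \<noteq> 0} \<subseteq> K"
    using assms by (intro closure_minimal) (auto simp: compact_imp_closed)
  moreover have "bounded {x. \<phi> x \<noteq> 0}"
    using assms by (intro bounded_subset[OF compact_imp_bounded]) auto
  ultimately show ?thesis using assms unfolding test_funs_def
    by (auto simp: compact_closure)
qed

lemma test_funs_mult:
  assumes "\<phi> \<in> test_funs \<Omega>" "\<And>k. C_k k f"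
  shows "(\<lambda>x. f x * \<phi> x) \<in> test_funs \<Omega>"
proof (rule test_funsI[OF _ test_funsD(2,3)[OF assms(1)]])
  show "C_k k (\<lambda>x. f x * \<phi> x)" for k by (intro C_k_mult assms(2) test_funsD(1)[OF assms(1)])
  show "f x * \<phi> x = 0" if "x \<notin> closure {x. \<phi> x \<noteq> 0}" for x
    by (simp only: closure_support[OF that] mult_zero_right)
qed

lemma test_funs_inter:
  assumes "\<phi> \<in> test_funs A" "\<psi> \<in> test_funs B"
  shows "(\<lambda>x. \<phi> x * \<psi> x) \<in> test_funs (A \<inter> B)"
proof (rule test_funsI)
  let ?c = "\<lambda>f :: 'a \<Rightarrow> complex. closure {x. f x \<noteq> 0}"
  show "compact (?c \<phi> \<inter> ?c \<psi>)" by (rule compact_Int[OF test_funsD(2)[OF assms(1)] test_funsD(2)[OF assms(2)]])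
  show "?c \<phi> \<inter> ?c \<psi> \<subseteq> A \<inter> B" using test_funsD(3)[OF assms(1)] test_funsD(3)[OF assms(2)] by blast
  show "\<phi> x * \<psi> x = 0" if "x \<notin> ?c \<phi> \<inter> ?c \<psi>" for x
  proof -
    have "x \<notin> ?c \<phi> \<or> x \<notin> ?c \<psi>" using that by blast
    then have "\<phi> x = 0 \<or> \<psi> x = 0" by (rule disj_forward) (erule closure_support)+
    then show ?thesis by auto
  qed
  show "C_k k (\<lambda>x. \<phi> x * \<psi> x)" for k by (intro C_k_mult test_funsD(1)[OF assms(1)] test_funsD(1)[OF assms(2)])
qed

lemma test_funs_add:
  assumes "\<phi> \<in> test_funs \<Omega>" "\<psi> \<in> test_funs \<Omega>"
  shows "(\<lambda>x. \<phi> x + \<psi> x) \<in> test_funs \<Omega>"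
proof (rule test_funsI)
  let ?c = "\<lambda>f :: 'a \<Rightarrow> complex. closure {x. f x \<noteq> 0}"
  show "compact (?c \<phi> \<union> ?c \<psi>)" by (rule compact_Un[OF test_funsD(2)[OF assms(1)] test_funsD(2)[OF assms(2)]])
  show "?c \<phi> \<union> ?c \<psi> \<subseteq> \<Omega>" using test_funsD(3)[OF assms(1)] test_funsD(3)[OF assms(2)] by blast
  show "\<phi> x + \<psi> x = 0" if "x \<notin> ?c \<phi> \<union> ?c \<psi>" for x
  proof -
    have "x \<notin> ?c \<phi> \<and> x \<notin> ?c \<psi>" using that by blast
    then have "\<phi> x = 0 \<and> \<psi> x = 0" by (rule conj_forward) (erule closure_support)+
    then show ?thesis by auto
  qed
  show "C_k k (\<lambda>x. \<phi> x + \<psi> x)" for k by (intro C_k_add test_funsD(1)[OF assms(1)] test_funsD(1)[OF assms(2)])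
qed

lemma test_funs_mono: "A \<subseteq> B \<Longrightarrow> test_funs A \<subseteq> test_funs B"
  unfolding test_funs_def by auto

lemma test_funs_pderiv:
  assumes "\<phi> \<in> test_funs \<Omega>" "b \<in> Basis"
  shows "pderiv_at b \<phi> \<in> test_funs \<Omega>"
proof (rule test_funsI[OF _ test_funsD(2,3)[OF assms(1)]])
  show "C_k k (pderiv_at b \<phi>)" for k
    using test_funsD(1)[OF assms(1), of "Suc k"] assms(2) by simp
  fix x assume x: "x \<notin> closure {x. \<phi> x \<noteq> 0}"
  have "pderiv_at b \<phi> x = pderiv_at b (\<lambda>_. 0) x"
  proof (rule pderiv_at_cong[of "- closure {x. \<phi> x \<noteq> 0}"])
    show "\<phi> y = 0" if "y \<in> - closure {x. \<phi> x \<noteq> 0}" for y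
      by (rule closure_support[of y \<phi>]) (use that in blast)
    show "open (- closure {x. \<phi> x \<noteq> 0})" by (rule open_Compl[OF closed_closure])
    show "x \<in> - closure {x. \<phi> x \<noteq> 0}" unfolding Compl_iff by (rule x)
  qed
  then show "pderiv_at b \<phi> x = 0"
    using pderiv_at_eq[OF has_derivative_const] by metis
qed

lemma test_funs_0: "(\<lambda>x. 0) \<in> test_funs \<Omega>"
  by (rule test_funsI[of _ "{}"]) auto

lemma test_funs_sum:
  assumes "\<And>i. i \<in> I \<Longrightarrow> \<phi> i \<in> test_funs \<Omega>"
  shows "(\<lambda>x. \<Sum>i\<in>I. \<phi> i x) \<in> test_funs \<Omega>"
  using assms
proof (induction I rule: infinite_finite_induct)
  case (insert i I)
  then show ?case using test_funs_add[of "\<phi> i" \<Omega> "\<lambda>x. \<Sum>i\<in>I. \<phi> i x"] by simp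
qed (simp_all add: test_funs_0)

lemma test_funs_laplacian:
  assumes "\<phi> \<in> test_funs \<Omega>"
  shows "laplacian \<phi> \<in> test_funs \<Omega>"
  unfolding laplacian_def[abs_def]
  using assms by (intro test_funs_sum test_funs_pderiv)

lemma pderiv_at_mult:
  assumes "f differentiable (at x)" "g differentiable (at x)"
  shows "pderiv_at b (\<lambda>x. f x * g x) x = f x * pderiv_at b g x + pderiv_at b f x * g x"
  using pderiv_at_eq[OF has_derivative_mult[OF assms(1)[unfolded frechet_derivative_works] assms(2)[unfolded frechet_derivative_works]]]
  unfolding pderiv_at_def by simp

lemma C_k_differentiable: "C_k (Suc k) f \<Longrightarrow> f differentiable (at x)"
  by simp

lemma test_funs_cnj:
  assumes "\<phi> \<in> test_funs \<Omega>"
  shows "(\<lambda>x. cnj (\<phi> x)) \<in> test_funs \<Omega>"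
proof (rule test_funsI[OF _ test_funsD(2,3)[OF assms]])
  show "C_k k (\<lambda>x. cnj (\<phi> x))" for k by (intro C_k_cnj test_funsD(1)[OF assms])
  show "cnj (\<phi> x) = 0" if "x \<notin> closure {x. \<phi> x \<noteq> 0}" for x
    by (simp only: closure_support[OF that] complex_cnj_zero)
qed

subsection \<open>Bump functions\<close>

text \<open>The flat function exp(-1/s), extended by zero, with a polynomial in 1/s in front. The
  polynomial makes the family closed under differentiation, which reduces smoothness to
  differentiability of each member.\<close>

definition expinv :: "real poly \<Rightarrow> real \<Rightarrow> real" where
  "expinv P s = (if s > 0 then poly P (1 / s) * exp (- (1 / s)) else 0)"

lemma poly_exp_tendsto_0: "((\<lambda>u::real. poly P u * exp (- u)) \<longlongrightarrow> 0) at_top"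
proof -
  have "((\<lambda>u. \<Sum>i\<le>degree P. coeff P i * (u ^ i / exp u)) \<longlongrightarrow> (\<Sum>i\<le>degree P. coeff P i * 0)) at_top"
    by (intro tendsto_intros tendsto_power_div_exp_0)
  then show ?thesis
    by (simp add: poly_altdef exp_minus sum_distrib_right divide_inverse mult.assoc)
qed

text \<open>With u = 1/s, the derivative of P(u) exp(-u) is u^2 (P - P')(u) exp(-u), and
  \<open>[:0,0,1:]\<close> is the polynomial u^2.\<close>

lemma has_real_derivative_expinv:
  "(expinv P has_real_derivative expinv ([:0,0,1:] * (P - pderiv P)) s) (at s)"
proof (cases s "0::real" rule: linorder_cases)
  case less
  have "((\<lambda>_. 0) has_real_derivative 0) (at s)" by simp
  then have "(expinv P has_real_derivative 0) (at s)"
    by (rule DERIV_cong_ev[THEN iffD1, rotated 3])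
      (use less eventually_nhds_in_open[of "{..<0}" s] in \<open>auto simp: expinv_def elim!: eventually_mono\<close>)
  then show ?thesis using less by (simp add: expinv_def)
next
  case greater
  have "((\<lambda>s. poly P (1 / s) * exp (- (1 / s))) has_real_derivative expinv ([:0,0,1:] * (P - pderiv P)) s) (at s)"
    using greater
    by (auto intro!: derivative_eq_intros poly_DERIV[THEN DERIV_chain2] simp: expinv_def)
      (simp add: field_simps power2_eq_square)
  then show ?thesis
    by (rule DERIV_cong_ev[THEN iffD1, rotated 3])
      (use greater eventually_nhds_in_open[of "{0<..}" s] in \<open>auto simp: expinv_def elim!: eventually_mono\<close>)
next
  case equal
  have "((\<lambda>h. expinv P h / h) \<longlongrightarrow> 0) (at 0)"
  proof (rule filterlim_split_at)
    show "((\<lambda>h. expinv P h / h) \<longlongrightarrow> 0) (at_left 0)"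
      by (rule tendsto_eventually) (auto simp: eventually_at_filter expinv_def)
    \<comment> \<open>\<open>pCons 0 P\<close> is u * P(u), so the division by h = 1/u in the
      difference quotient is absorbed into the polynomial.\<close>
    have "((\<lambda>h. poly (pCons 0 P) (inverse h) * exp (- inverse h)) \<longlongrightarrow> 0) (at_right 0)"
      by (rule filterlim_compose[OF poly_exp_tendsto_0 filterlim_inverse_at_top_right])
    then show "((\<lambda>h. expinv P h / h) \<longlongrightarrow> 0) (at_right 0)"
      by (rule Lim_transform_eventually)
        (auto simp: eventually_at_filter expinv_def field_simps)
  qed
  then show ?thesis using equal
    by (simp add: DERIV_def expinv_def)
qed

lemma C_k_expinv: "C_k k (\<lambda>s. complex_of_real (expinv P s))"
proof (induction k arbitrary: P)
  case 0
  have "isCont (expinv P) s" for s by (rule DERIV_isCont[OF has_real_derivative_expinv])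
  then show ?case by (auto intro!: continuous_intros simp: continuous_on_eq_continuous_at)
next
  case (Suc k)
  show ?case
    by (rule C_k_Suc_real[OF _ Suc, of _ "[:0,0,1:] * (P - pderiv P)"])
      (use has_real_derivative_expinv in \<open>auto simp: has_real_derivative_iff_has_vector_derivative
         intro!: has_vector_derivative_of_real simp del: mult_pCons_left\<close>)
qed

lemma expinv_1_pos: "s > 0 \<Longrightarrow> expinv 1 s > 0" and expinv_1_nonneg: "expinv 1 s \<ge> 0"
  and expinv_1_le: "expinv 1 s \<le> 1" and expinv_zero: "s \<le> 0 \<Longrightarrow> expinv P s = 0"
  by (auto simp: expinv_def)

definition smooth :: "(real \<Rightarrow> real) \<Rightarrow> bool" where
  "smooth g \<longleftrightarrow> (\<forall>k. C_k k (\<lambda>s. complex_of_real (g s)))"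

lemma smooth_mult: "smooth f \<Longrightarrow> smooth g \<Longrightarrow> smooth (\<lambda>s. f s * g s)"
  unfolding smooth_def by (auto intro: C_k_mult)

lemma smooth_id: "smooth (\<lambda>s. s)"
  unfolding smooth_def using C_k_inner[where e="1::real"] by simp

lemma smooth_expinv: "smooth (\<lambda>s. expinv 1 (a * s + b))"
  unfolding smooth_def
proof
  fix k
  have "C_k k (\<lambda>s. complex_of_real (a * s + b))"
    using C_k_add[OF C_k_inner[where e=a] C_k_const[of k "complex_of_real b"]] by (simp add: mult.commute)
  from C_k_compose[OF C_k_expinv this] show "C_k k (\<lambda>s. complex_of_real (expinv 1 (a * s + b)))" .
qed

lemma smooth_isCont: assumes "smooth g" shows "isCont g s"
proof -
  have "C_k 0 (\<lambda>s. complex_of_real (g s))"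
    using assms unfolding smooth_def by (rule spec)
  from continuous_on_Re[OF C_k_continuous[OF this, of UNIV]] show ?thesis by (simp add: continuous_on_eq_continuous_at)
qed

lemma smooth_continuous_on: "smooth g \<Longrightarrow> continuous_on S g"
  by (meson continuous_at_imp_continuous_on smooth_isCont)

lemma smooth_deriv:
  assumes "smooth g"
  obtains g' where "smooth g'" "\<And>s. (g has_real_derivative g' s) (at s)"
proof
  let ?D = "pderiv_at 1 (\<lambda>s. complex_of_real (g s))"
  let ?F = "\<lambda>s. frechet_derivative (\<lambda>s. complex_of_real (g s)) (at s)"
  have C: "C_k (Suc k) (\<lambda>s. complex_of_real (g s))" for k
    using assms unfolding smooth_def by (rule spec)
  have F: "((\<lambda>s. complex_of_real (g s)) has_derivative ?F s) (at s)" for s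
    by (rule C_k_has_derivative[OF C])
  have g: "(g has_derivative (\<lambda>h. Re (?F s h))) (at s)" for s
    using bounded_linear.has_derivative[OF bounded_linear_Re F] by simp
  have lin: "?F s h = complex_of_real h * ?D s" for s h
    using linear.scaleR[OF has_derivative_linear[OF F[of s]], of h 1]
    by (simp add: pderiv_at_def scaleR_conv_of_real)
  have "(\<lambda>h. Re (?F s h)) = (*) (Re (?D s))" for s
    unfolding lin by (simp add: fun_eq_iff)
  then show "(g has_real_derivative Re (?D s)) (at s)" for s
    using g[of s] unfolding has_field_derivative_def by simp
  have "?F s = (\<lambda>h. complex_of_real (Re (?F s h)))" for s
    by (rule has_derivative_unique[OF F bounded_linear.has_derivative[OF bounded_linear_of_real g]])
  from fun_cong[OF this, of _ 1] have Dreal: "?D s = complex_of_real (Re (?D s))" for s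
    unfolding pderiv_at_def .
  have "(\<lambda>s. complex_of_real (Re (?D s))) = ?D" by (intro ext) (rule Dreal[symmetric])
  with C show "smooth (\<lambda>s. Re (?D s))"
    unfolding smooth_def by simp
qed

section \<open>Kernel profiles and their antiderivatives\<close>

definition kernel :: "(real \<Rightarrow> real) \<Rightarrow> bool" where
  "kernel g \<longleftrightarrow> smooth g \<and> (\<forall>s\<ge>1. g s = 0)"

lemma kernel_bounded:
  assumes "kernel g" obtains B where "B \<ge> 0" "\<And>s. s \<ge> 0 \<Longrightarrow> \<bar>g s\<bar> \<le> B"
proof -
  have "compact (g ` {0..1})"
    using assms by (intro compact_continuous_image smooth_continuous_on) (auto simp: kernel_def)
  then have "\<exists>B. \<forall>s\<in>{0..1}. \<bar>g s\<bar> \<le> B"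
    by (auto dest!: compact_imp_bounded simp: bounded_iff)
  then obtain B where B: "\<And>s. s \<in> {0..1} \<Longrightarrow> \<bar>g s\<bar> \<le> B" by metis
  show ?thesis
  proof
    show "0 \<le> B" using B[of 0] by simp
    then show "\<bar>g s\<bar> \<le> B" if "s \<ge> 0" for s
      using assms that B[of s] by (cases "s \<ge> 1") (auto simp: kernel_def)
  qed
qed

lemma kernel_deriv:
  assumes "kernel g"
  obtains g' where "kernel g'" "\<And>s. (g has_real_derivative g' s) (at s)"
proof -
  obtain g' where g': "smooth g'" "\<And>s. (g has_real_derivative g' s) (at s)"
    using smooth_deriv[of g] assms unfolding kernel_def by metis
  have "g' s = 0" if "s > 1" for s
  proof -
    have "((\<lambda>_. 0) has_real_derivative 0) (at s)" by simp
    then have "(g has_real_derivative 0) (at s)"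
      by (rule DERIV_cong_ev[THEN iffD1, rotated 3])
        (use assms that eventually_nhds_in_open[of "{1<..}" s] in \<open>auto simp: kernel_def elim!: eventually_mono\<close>)
    then show ?thesis using g'(2) DERIV_unique by blast
  qed
  \<comment> \<open>The argument above covers only s > 1; the endpoint s = 1 follows because the
    zero set of the continuous \<open>g'\<close> is closed.\<close>
  then have "{1<..} \<subseteq> {s. g' s = 0}" by auto
  moreover have "closed {s. g' s = 0}"
    by (intro closed_Collect_eq smooth_continuous_on g' continuous_intros)
  ultimately have "closure {1<..} \<subseteq> {s. g' s = 0}" by (rule closure_minimal)
  then show ?thesis using that g' unfolding kernel_def by auto
qed

text \<open>The antiderivative of -g that vanishes at 1. For s > 1 the interval is empty, so the
  value is again 0 and a tail is itself a kernel. Differentiating a mean with profile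
  \<open>g\<close> in the radius produces the mean of the Laplacian with profile
  \<open>tail g\<close>.\<close>

definition tail :: "(real \<Rightarrow> real) \<Rightarrow> real \<Rightarrow> real" where
  "tail g s = integral {s..1} g"

lemma tail_deriv:
  assumes "kernel g" shows "(tail g has_real_derivative - g s) (at s)"
proof -
  \<comment> \<open>The interval {a..c} has both s and 1 in its interior, so the fundamental theorem
    gives a two-sided derivative whatever the position of s relative to 1. Moving the upper limit
    from 1 to c changes nothing since \<open>g\<close> vanishes there.\<close>
  define a where "a = min s 0 - 1"
  define c where "c = max s 1 + 1"
  have ac: "a < s" "s < c" "1 < c" by (auto simp: a_def c_def)
  have cont: "continuous_on S g" for S using assms smooth_continuous_on kernel_def by blast
  have tail: "tail g t = integral {t..c} g" if "t < c" for t
  proof -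
    have "integral {max t 1..c} g = integral {max t 1..c} (\<lambda>_. 0)"
      by (rule integral_cong) (use assms in \<open>auto simp: kernel_def\<close>)
    then have z: "integral {max t 1..c} g = 0" by simp
    show ?thesis
    proof (cases "t \<le> 1")
      case True
      then show ?thesis
        using Henstock_Kurzweil_Integration.integral_combine[of t 1 c g] z ac
          integrable_continuous_interval[OF cont] by (simp add: tail_def max_def)
    next
      case False then show ?thesis using z by (simp add: tail_def max_def)
    qed
  qed
  have eq: "integral {a..c} g - integral {a..t} g = tail g t" if "t \<in> {a<..<c}" for t
    using that tail[of t] Henstock_Kurzweil_Integration.integral_combine[of a t c g]
      integrable_continuous_interval[OF cont] by auto
  have "((\<lambda>t. integral {a..t} g) has_real_derivative g s) (at s within {a..c})"
    using integral_has_real_derivative[OF cont] ac by auto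
  then have "((\<lambda>t. integral {a..t} g) has_real_derivative g s) (at s)"
    using ac at_within_interior[of s "{a..c}"] by auto
  then have "((\<lambda>t. integral {a..c} g - integral {a..t} g) has_real_derivative - g s) (at s)"
    by (auto intro!: derivative_eq_intros)
  then show ?thesis
    using eventually_nhds_in_open[of "{a<..<c}" s] ac eq
    by (subst DERIV_cong_ev[OF refl _ refl, symmetric]) (auto elim!: eventually_mono)
qed

lemma kernel_tail: assumes "kernel g" shows "kernel (tail g)"
proof -
  have 1: "((\<lambda>s. complex_of_real (tail g s)) has_vector_derivative (- complex_of_real (g s))) (at s)" for s
    using has_vector_derivative_of_real[of "tail g" "- g s"] tail_deriv[OF assms, of s]
    by (simp add: has_real_derivative_iff_has_vector_derivative)
  have "C_k (Suc k) (\<lambda>s. complex_of_real (tail g s))" for k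
    by (rule C_k_Suc_real[OF 1]) (use assms in \<open>auto simp: kernel_def smooth_def intro: C_k_minus\<close>)
  then have "C_k k (\<lambda>s. complex_of_real (tail g s))" for k using C_k_Suc_D by blast
  moreover have "tail g s = 0" if "s \<ge> 1" for s using that by (cases "s = 1") (auto simp: tail_def)
  ultimately show ?thesis by (simp add: kernel_def smooth_def)
qed

text \<open>Each integration raises the order of vanishing at 1 by one and gains the divisor
  \<open>Suc j\<close>. Iterated, these divisors build up the factorials in the moment
  estimate.\<close>

lemma tail_bound:
  assumes "kernel g" "\<And>s. s \<in> {0..1} \<Longrightarrow> \<bar>g s\<bar> \<le> B * (1 - s) ^ j" "s \<in> {0..1}"
  shows "\<bar>tail g s\<bar> \<le> B / real (Suc j) * (1 - s) ^ Suc j"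
proof -
  define c where "c = B / real (Suc j)"
  have Bc: "B = c * (1 + real j)" by (simp add: c_def field_simps)
  have "((\<lambda>t. - (c * (1 - t) ^ Suc j)) has_real_derivative B * (1 - t) ^ j) (at t within S)" for t S
    unfolding Bc by (auto intro!: derivative_eq_intros simp del: power_Suc)
  then have "((\<lambda>t. B * (1 - t) ^ j) has_integral (- (c * (1 - 1) ^ Suc j)) - (- (c * (1 - s) ^ Suc j))) {s..1}"
    using assms(3)
    by (intro fundamental_theorem_of_calculus) (auto simp flip: has_real_derivative_iff_has_vector_derivative simp del: power_Suc)
  then have I: "((\<lambda>t. B * (1 - t) ^ j) has_integral (B / real (Suc j) * (1 - s) ^ Suc j)) {s..1}"
    unfolding c_def by simp
  have "norm (integral {s..1} g) \<le> integral {s..1} (\<lambda>t. B * (1 - t) ^ j)"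
    by (rule integral_norm_bound_integral[OF integrable_continuous_interval[OF smooth_continuous_on] has_integral_integrable[OF I]])
      (use assms in \<open>auto simp: kernel_def\<close>)
  from this[unfolded integral_unique[OF I]] show ?thesis by (simp add: tail_def)
qed

text \<open>The tail of a bump supported in [1/2, 1] is constant to the left of 1/2, decreasing, and
  zero to the right of 1; dividing by the constant gives the cutoff.\<close>

lemma ex_smooth_cutoff:
  obtains F where "smooth F" "\<And>s. s \<le> 1/2 \<Longrightarrow> F s = 1" "\<And>s. s \<ge> 1 \<Longrightarrow> F s = 0"
    "\<And>s. 0 \<le> F s \<and> F s \<le> 1"
proof -
  define \<beta> where "\<beta> s = expinv 1 ((-1) * s + 1) * expinv 1 (1 * s + (-1/2))" for s
  have "smooth \<beta>" unfolding \<beta>_def[abs_def] by (intro smooth_mult smooth_expinv)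
  then have k: "kernel \<beta>"
    unfolding kernel_def by (simp add: \<beta>_def expinv_zero)
  have nn: "\<beta> s \<ge> 0" for s by (auto simp: \<beta>_def intro!: mult_nonneg_nonneg expinv_1_nonneg)
  have anti: "tail \<beta> t \<le> tail \<beta> s" if "s \<le> t" for s t
    by (rule DERIV_nonpos_imp_nonincreasing[OF that]) (use tail_deriv[OF k] nn in force)
  \<comment> \<open>The midpoint of the support: the tail decreases strictly there, which makes the
    normalising constant \<open>tail \<beta> (1/2)\<close> positive.\<close>
  have "\<beta> (3/4) > 0" unfolding \<beta>_def by (intro mult_pos_pos expinv_1_pos) auto
  then obtain d where d: "d > 0" "\<And>h. 0 < h \<Longrightarrow> h < d \<Longrightarrow> tail \<beta> (3/4 + h) < tail \<beta> (3/4)"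
    using DERIV_neg_dec_right[OF tail_deriv[OF k, of "3/4"]] by auto
  have nnt: "tail \<beta> s \<ge> 0" for s
    using anti[of s "max s 1"] kernel_tail[OF k] by (simp add: kernel_def)
  have pos: "tail \<beta> (1/2) > 0"
    using d(2)[of "d/2"] d(1) nnt[of "3/4 + d/2"] anti[of "1/2" "3/4"] by auto
  have const: "tail \<beta> s = tail \<beta> (1/2)" if s: "s \<le> 1/2" for s
  proof (rule antisym[OF _ anti[OF s]])
    show "tail \<beta> s \<le> tail \<beta> (1/2)"
      by (rule DERIV_nonneg_imp_nondecreasing[OF s])
        (intro exI conjI, rule tail_deriv[OF k], auto simp: \<beta>_def expinv_zero)
  qed
  have "C_k n (\<lambda>s. complex_of_real (tail \<beta> s) * complex_of_real (1 / tail \<beta> (1/2)))" for n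
    using kernel_tail[OF k] by (intro C_k_mult C_k_const) (auto simp: kernel_def smooth_def)
  then have "smooth (\<lambda>s. tail \<beta> s / tail \<beta> (1/2))" by (simp add: smooth_def)
  moreover have "tail \<beta> s \<le> tail \<beta> (1/2)" for s
    using const[of s] anti[of "1/2" s] by (cases "s \<le> 1/2") auto
  ultimately show ?thesis
  proof (intro that)
    fix s
    show "s \<le> 1/2 \<Longrightarrow> tail \<beta> s / tail \<beta> (1/2) = 1" using const[of s] pos by simp
    show "s \<ge> 1 \<Longrightarrow> tail \<beta> s / tail \<beta> (1/2) = 0" using kernel_tail[OF k] by (simp add: kernel_def)
    show "0 \<le> tail \<beta> s / tail \<beta> (1/2) \<and> tail \<beta> s / tail \<beta> (1/2) \<le> 1"
      using \<open>\<And>s. tail \<beta> s \<le> tail \<beta> (1/2)\<close>[of s] pos nnt[of s] by simp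
  qed
qed

subsection \<open>Radial functions\<close>

text \<open>The profile is taken in the squared distance, which is a polynomial in x, so smoothness
  of \<open>g\<close> gives smoothness at the centre without a separate argument.\<close>

definition radial :: "(real \<Rightarrow> real) \<Rightarrow> 'a::euclidean_space \<Rightarrow> real \<Rightarrow> 'a \<Rightarrow> real" where
  "radial g y r x = g ((norm (x - y))\<^sup>2 / r\<^sup>2)"

lemma C_k_norm_sq: "C_k k (\<lambda>x::'a::euclidean_space. complex_of_real ((norm (x - y))\<^sup>2 / r\<^sup>2))"
proof -
  have "C_k k (\<lambda>x. (\<Sum>b\<in>Basis. (complex_of_real (x \<bullet> b) - complex_of_real (y \<bullet> b)) ^ 2) * complex_of_real (1 / r\<^sup>2))"
    by (intro C_k_mult C_k_sum C_k_power C_k_diff C_k_inner C_k_const)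
  moreover have "(norm (x - y))\<^sup>2 = (\<Sum>b\<in>Basis. (x \<bullet> b - y \<bullet> b)\<^sup>2)" for x
    unfolding power2_norm_eq_inner by (subst euclidean_inner) (simp add: power2_eq_square inner_diff_left)
  ultimately show ?thesis by simp
qed

lemma C_k_radial: "smooth g \<Longrightarrow> C_k k (\<lambda>x. complex_of_real (radial g y r x))"
  unfolding radial_def smooth_def
  by (rule C_k_compose[where f="\<lambda>s. complex_of_real (g s)", OF _ C_k_norm_sq]) (erule spec)

lemma continuous_on_radial: assumes "smooth g" shows "continuous_on S (radial g y r)"
  using continuous_on_Re[OF C_k_continuous[OF C_k_radial[OF assms, of 0 y r], of S]] by simp

lemma radial_zero:
  assumes "kernel g" "r > 0" "x \<notin> ball y r" shows "radial g y r x = 0"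
proof -
  have "r\<^sup>2 \<le> (norm (x - y))\<^sup>2"
    using assms by (intro power_mono) (auto simp: dist_norm norm_minus_commute)
  then have "1 \<le> (norm (x - y))\<^sup>2 / r\<^sup>2" using assms by simp
  then show ?thesis using assms unfolding kernel_def radial_def by blast
qed

lemma radial_test_funs:
  assumes "kernel g" "r > 0" "cball y r \<subseteq> \<Omega>"
  shows "(\<lambda>x. complex_of_real (radial g y r x)) \<in> test_funs \<Omega>"
proof (rule test_funsI[OF C_k_radial compact_cball assms(3)])
  show "smooth g" using assms(1) unfolding kernel_def by simp
  show "complex_of_real (radial g y r x) = 0" if "x \<notin> cball y r" for x
    using radial_zero[OF assms(1,2), of x] that by simp
qed

lemma radial_has_derivative:
  assumes "\<And>s. (G has_real_derivative g s) (at s)"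
  shows "((\<lambda>x. complex_of_real (radial G y r x)) has_derivative
    (\<lambda>h. complex_of_real (radial g y r x * (2 * ((x - y) \<bullet> h) / r\<^sup>2)))) (at x)"
proof -
  have 1: "((\<lambda>x. (norm (x - y))\<^sup>2 / r\<^sup>2) has_derivative (\<lambda>h. 2 * ((x - y) \<bullet> h) / r\<^sup>2)) (at x)"
    unfolding power2_norm_eq_inner divide_inverse
    by (auto intro!: derivative_eq_intros simp: inner_commute algebra_simps)
  have 2: "(G has_derivative (\<lambda>h. g ((norm (x - y))\<^sup>2 / r\<^sup>2) * h)) (at ((norm (x - y))\<^sup>2 / r\<^sup>2))"
    using assms by (simp add: has_field_derivative_def)
  show ?thesis
    using bounded_linear.has_derivative[OF bounded_linear_of_real diff_chain_at[OF 1 2]]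
    unfolding o_def radial_def .
qed

lemma laplacian_radial:
  fixes x y :: "'a::euclidean_space"
  assumes "\<And>s. (G has_real_derivative g s) (at s)" "\<And>s. (g has_real_derivative g' s) (at s)"
  shows "laplacian (\<lambda>x. complex_of_real (radial G y r x)) x =
    complex_of_real (2 * DIM('a) / r\<^sup>2 * radial g y r x + 4 * (norm (x - y))\<^sup>2 / r^4 * radial g' y r x)"
proof -
  have 1: "pderiv_at b (\<lambda>x. complex_of_real (radial G y r x)) =
      (\<lambda>x. complex_of_real (radial g y r x) * complex_of_real (2 * ((x - y) \<bullet> b) / r\<^sup>2))" for b
    by (rule ext, subst pderiv_at_eq[OF radial_has_derivative[OF assms(1)]]) simp
  have lin: "((\<lambda>x. complex_of_real (2 * ((x - y) \<bullet> b) / r\<^sup>2)) has_derivative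
      (\<lambda>h. complex_of_real (2 * (h \<bullet> b) / r\<^sup>2))) (at x)" for b
    unfolding divide_inverse by (auto intro!: derivative_eq_intros)
  have 2: "pderiv_at b (pderiv_at b (\<lambda>x. complex_of_real (radial G y r x))) x =
     complex_of_real (radial g y r x * (2 / r\<^sup>2) + radial g' y r x * (4 / r^4 * ((x - y) \<bullet> b)\<^sup>2))"
    if "b \<in> Basis" for b
  proof -
    have "pderiv_at b (pderiv_at b (\<lambda>x. complex_of_real (radial G y r x))) x =
       complex_of_real (radial g y r x) * complex_of_real (2 * (b \<bullet> b) / r\<^sup>2) +
       complex_of_real (radial g' y r x * (2 * ((x - y) \<bullet> b) / r\<^sup>2)) * complex_of_real (2 * ((x - y) \<bullet> b) / r\<^sup>2)"
      unfolding 1 by (rule pderiv_at_eq[OF has_derivative_mult[OF radial_has_derivative[OF assms(2)] lin]])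
    also have "\<dots> = complex_of_real (radial g y r x * (2 * (b \<bullet> b) / r\<^sup>2) +
       radial g' y r x * (2 * ((x - y) \<bullet> b) / r\<^sup>2) * (2 * ((x - y) \<bullet> b) / r\<^sup>2))"
      by (simp only: of_real_mult of_real_add)
    also have "radial g y r x * (2 * (b \<bullet> b) / r\<^sup>2) +
        radial g' y r x * (2 * ((x - y) \<bullet> b) / r\<^sup>2) * (2 * ((x - y) \<bullet> b) / r\<^sup>2) =
      radial g y r x * (2 / r\<^sup>2) + radial g' y r x * (4 / r^4 * ((x - y) \<bullet> b)\<^sup>2)"
      using that by (simp add: power2_eq_square power4_eq_xxxx mult_ac)
    finally show ?thesis .
  qed
  have "(norm (x - y))\<^sup>2 = (\<Sum>b\<in>Basis. ((x - y) \<bullet> b)\<^sup>2)"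
    unfolding power2_norm_eq_inner by (subst euclidean_inner) (simp add: power2_eq_square)
  then have "(\<Sum>b\<in>Basis. radial g y r x * (2 / r\<^sup>2) + radial g' y r x * (4 / r^4 * ((x - y) \<bullet> b)\<^sup>2)) =
    2 * DIM('a) / r\<^sup>2 * radial g y r x + 4 * (norm (x - y))\<^sup>2 / r^4 * radial g' y r x"
    by (simp add: sum.distrib sum_distrib_left sum_distrib_right sum_divide_distrib mult_ac)
  then show ?thesis
    unfolding laplacian_def by (simp only: 2 flip: of_real_sum cong: sum.cong)
qed

section \<open>Integration\<close>

lemma integrable_lebesgue_on_bounded:
  fixes f :: "'a::euclidean_space \<Rightarrow> 'b::{banach, second_countable_topology}"
  assumes "S \<in> lmeasurable" "f \<in> borel_measurable (lebesgue_on S)" "\<And>x. x \<in> S \<Longrightarrow> norm (f x) \<le> B"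
  shows "integrable (lebesgue_on S) f"
proof -
  interpret finite_measure "lebesgue_on S" by (rule finite_measure_lebesgue_on[OF assms(1)])
  show ?thesis by (rule integrable_const_bound[of _ B]) (use assms in auto)
qed

lemma integrable_lebesgue_on_continuous:
  fixes f :: "'a::euclidean_space \<Rightarrow> 'b::{banach, second_countable_topology}"
  assumes "open S" "bounded S" "continuous_on S f" "\<And>x. x \<in> S \<Longrightarrow> norm (f x) \<le> B"
  shows "integrable (lebesgue_on S) f"
  using assms by (intro integrable_lebesgue_on_bounded[of S f B] continuous_imp_measurable_on_sets_lebesgue)
    (auto intro: bounded_set_imp_lmeasurable)

lemma LINT_lebesgue_on_support:
  fixes f :: "'a::euclidean_space \<Rightarrow> 'b::{banach, second_countable_topology}"
  assumes "S \<in> sets lebesgue" "\<And>x. x \<notin> S \<Longrightarrow> f x = 0"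
  shows "(LINT x|lebesgue_on S. f x) = (LINT x|lebesgue. f x)"
proof -
  have "(\<lambda>x. indicator S x *\<^sub>R f x) = f" using assms(2) by (auto simp: indicator_def fun_eq_iff)
  then show ?thesis using assms(1) by (simp add: integral_restrict_space)
qed

lemma LINT_lebesgue_on_mono:
  fixes f :: "'a::euclidean_space \<Rightarrow> 'b::{banach, second_countable_topology}"
  assumes "S \<in> sets lebesgue" "T \<in> sets lebesgue" "S \<subseteq> T" "\<And>x. x \<in> T - S \<Longrightarrow> f x = 0"
  shows "(LINT x|lebesgue_on T. f x) = (LINT x|lebesgue_on S. f x)"
proof -
  have "(\<lambda>x. indicator T x *\<^sub>R f x) = (\<lambda>x. indicator S x *\<^sub>R f x)"
    using assms(3,4) by (auto simp: indicator_def fun_eq_iff)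
  then show ?thesis using assms(1,2) by (simp add: integral_restrict_space)
qed

lemma LINT_lebesgue_affine:
  fixes f :: "'a::euclidean_space \<Rightarrow> 'b::{banach, second_countable_topology}"
  assumes "f \<in> borel_measurable borel" "c \<noteq> 0"
  shows "(LINT x|lebesgue. f (t + c *\<^sub>R x)) = (1 / \<bar>c\<bar> ^ DIM('a)) *\<^sub>R (LINT x|lebesgue. f x)"
proof -
  have "(LINT x|lebesgue. f x) = (LINT x|lborel. f x)"
    using assms by (simp add: integral_completion)
  also have "\<dots> = (LINT x|density (distr lborel borel (\<lambda>x. t + c *\<^sub>R x)) (\<lambda>_. ennreal (\<bar>c\<bar> ^ DIM('a))). f x)"
    using lborel_affine[OF assms(2), of t] by (simp add: ennreal_power)
  also have "\<dots> = \<bar>c\<bar> ^ DIM('a) *\<^sub>R (LINT x|lborel. f (t + c *\<^sub>R x))"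
    using assms(1) by (subst integral_density) (auto simp: integral_distr)
  also have "(LINT x|lborel. f (t + c *\<^sub>R x)) = (LINT x|lebesgue. f (t + c *\<^sub>R x))"
    by (intro integral_completion[symmetric] measurable_compose[OF _ assms(1)]) simp
  finally show ?thesis using assms(2) by simp
qed

text \<open>Dominated convergence along sequences. The mean value inequality on the convex set T
  bounds the difference quotient by B, hence the remainder quotient by 2 * B, and 2 * B times the
  norm of \<open>u\<close> is the integrable majorant.\<close>

lemma has_vector_derivative_LINT:
  fixes u :: "'b \<Rightarrow> complex" and \<Phi> \<Phi>' :: "real \<Rightarrow> 'b \<Rightarrow> complex"
  assumes u: "integrable M u"
    and meas: "\<And>s. s \<in> T \<Longrightarrow> \<Phi> s \<in> borel_measurable M" "\<And>s. s \<in> T \<Longrightarrow> \<Phi>' s \<in> borel_measurable M"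
    and bnd: "\<And>s x. s \<in> T \<Longrightarrow> x \<in> space M \<Longrightarrow> norm (\<Phi> s x) \<le> B"
      "\<And>s x. s \<in> T \<Longrightarrow> x \<in> space M \<Longrightarrow> norm (\<Phi>' s x) \<le> B"
    and der: "\<And>s x. s \<in> T \<Longrightarrow> x \<in> space M \<Longrightarrow> ((\<lambda>s. \<Phi> s x) has_vector_derivative \<Phi>' s x) (at s)"
    and T: "open T" "convex T" "t \<in> T"
  shows "((\<lambda>s. LINT x|M. u x * \<Phi> s x) has_vector_derivative (LINT x|M. u x * \<Phi>' t x)) (at t)"
proof -
  note [measurable] = meas(1) meas(2)[OF T(3)] borel_measurable_integrable[OF u]
  have int: "integrable M (\<lambda>x. u x * f x)"
    if "f \<in> borel_measurable M" "\<And>x. x \<in> space M \<Longrightarrow> norm (f x) \<le> B" for f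
  proof (rule Bochner_Integration.integrable_bound[where f="\<lambda>x. B * norm (u x)"])
    show "AE x in M. norm (u x * f x) \<le> norm (B * norm (u x))"
    proof (rule AE_I2)
      fix x assume "x \<in> space M"
      then have "norm (u x) * norm (f x) \<le> norm (u x) * B" by (intro mult_left_mono that) auto
      also have "\<dots> \<le> \<bar>B\<bar> * norm (u x)" by (simp add: mult.commute mult_right_mono)
      finally show "norm (u x * f x) \<le> norm (B * norm (u x))" by (simp add: norm_mult abs_mult)
    qed
  qed (use u that in auto)
  let ?F = "\<lambda>s. LINT x|M. u x * \<Phi> s x" and ?D = "LINT x|M. u x * \<Phi>' t x"
  let ?q = "\<lambda>s x. (1 / norm (s - t)) *\<^sub>R (\<Phi> s x - (\<Phi> t x + (s - t) *\<^sub>R \<Phi>' t x))"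
  have "((\<lambda>s. (1 / norm (s - t)) *\<^sub>R (?F s - (?F t + (s - t) *\<^sub>R ?D))) \<longlongrightarrow> 0) (at t within T)"
  proof (subst tendsto_at_iff_sequentially, intro allI impI)
    fix X :: "nat \<Rightarrow> real" assume X: "\<forall>i. X i \<in> T - {t}" "X \<longlonglongrightarrow> t"
    have I: "integrable M (\<lambda>x. u x * \<Phi> (X i) x)" for i by (rule int) (use X meas bnd in auto)
    have I1: "integrable M (\<lambda>x. u x * \<Phi> t x)" by (rule int) (use T meas bnd in auto)
    have I2: "integrable M (\<lambda>x. u x * \<Phi>' t x)" by (rule int) (use T meas bnd in auto)
    have eq: "(1 / norm (X i - t)) *\<^sub>R (?F (X i) - (?F t + (X i - t) *\<^sub>R ?D)) = (LINT x|M. u x * ?q (X i) x)" for i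
    proof -
      have "(LINT x|M. u x * ?q (X i) x) =
        (LINT x|M. (1 / norm (X i - t)) *\<^sub>R (u x * \<Phi> (X i) x - (u x * \<Phi> t x + (X i - t) *\<^sub>R (u x * \<Phi>' t x))))"
        by (rule Bochner_Integration.integral_cong) (auto simp: algebra_simps)
      also have "\<dots> = (1 / norm (X i - t)) *\<^sub>R (?F (X i) - (?F t + (X i - t) *\<^sub>R ?D))"
        using I[of i] I1 I2 by simp
      finally show ?thesis by (rule sym)
    qed
    have "(\<lambda>i. LINT x|M. u x * ?q (X i) x) \<longlonglongrightarrow> (LINT x|M. 0)"
    proof (rule integral_dominated_convergence[where w="\<lambda>x. 2 * B * norm (u x)"])
      show "(\<lambda>x. u x * ?q (X i) x) \<in> borel_measurable M" for i
      proof -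
        have "X i \<in> T" using X by blast
        then show ?thesis
          by (intro borel_measurable_times borel_measurable_scaleR borel_measurable_diff borel_measurable_add
              borel_measurable_const meas borel_measurable_integrable[OF u] T)
      qed
      show "integrable M (\<lambda>x. 2 * B * norm (u x))" using u by auto
      show "AE x in M. (\<lambda>i. u x * ?q (X i) x) \<longlonglongrightarrow> 0"
      proof (rule AE_I2)
        fix x assume x: "x \<in> space M"
        have "((\<lambda>s. ?q s x) \<longlongrightarrow> 0) (at t within T)"
          using has_vector_derivative_at_within[OF der[OF T(3) x], of T]
          unfolding has_vector_derivative_def has_derivative_within by simp
        then have "(\<lambda>i. ?q (X i) x) \<longlonglongrightarrow> 0"
          unfolding tendsto_at_iff_sequentially o_def using X by blast
        from tendsto_mult[OF tendsto_const this, of "u x"]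
        show "(\<lambda>i. u x * ?q (X i) x) \<longlonglongrightarrow> 0" by simp
      qed
      show "AE x in M. norm (u x * ?q (X i) x) \<le> 2 * B * norm (u x)" for i
      proof (rule AE_I2)
        fix x assume x: "x \<in> space M"
        have "norm (\<Phi> (X i) x - \<Phi> t x) \<le> B * norm (X i - t)"
        proof (rule differentiable_bound[OF T(2)])
          show "((\<lambda>s. \<Phi> s x) has_derivative (\<lambda>h. h *\<^sub>R \<Phi>' s x)) (at s within T)" if "s \<in> T" for s
            using has_vector_derivative_at_within[OF der[OF that x]] unfolding has_vector_derivative_def .
          show "onorm (\<lambda>h. h *\<^sub>R \<Phi>' s x) \<le> B" if "s \<in> T" for s
          proof (rule onorm_le)
            fix h :: real
            have "\<bar>h\<bar> * norm (\<Phi>' s x) \<le> \<bar>h\<bar> * B" using bnd(2)[OF that x] by (intro mult_left_mono) auto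
            then show "norm (h *\<^sub>R \<Phi>' s x) \<le> B * norm h" by (simp add: mult.commute)
          qed
        qed (use X T in auto)
        moreover have "norm ((X i - t) *\<^sub>R \<Phi>' t x) \<le> B * norm (X i - t)"
          using bnd(2)[OF T(3) x] by (simp add: mult.commute mult_right_mono)
        ultimately have "norm (\<Phi> (X i) x - \<Phi> t x - (X i - t) *\<^sub>R \<Phi>' t x) \<le> 2 * B * norm (X i - t)"
          using norm_triangle_ineq4[of "\<Phi> (X i) x - \<Phi> t x" "(X i - t) *\<^sub>R \<Phi>' t x"] by linarith
        moreover have "norm (X i - t) > 0" using X by auto
        ultimately have "norm (\<Phi> (X i) x - \<Phi> t x - (X i - t) *\<^sub>R \<Phi>' t x) / norm (X i - t) \<le> 2 * B"
          by (simp only: pos_divide_le_eq)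
        then have "norm (?q (X i) x) \<le> 2 * B"
          by (simp only: diff_diff_eq norm_scaleR) simp
        then have "norm (u x) * norm (?q (X i) x) \<le> norm (u x) * (2 * B)" by (intro mult_left_mono) auto
        then show "norm (u x * ?q (X i) x) \<le> 2 * B * norm (u x)" by (simp only: norm_mult mult.commute)
      qed
    qed simp
    then show "((\<lambda>s. (1 / norm (s - t)) *\<^sub>R (?F s - (?F t + (s - t) *\<^sub>R ?D))) \<circ> X) \<longlonglongrightarrow> 0"
      unfolding o_def eq by simp
  qed
  then have "(?F has_derivative (\<lambda>h. h *\<^sub>R ?D)) (at t within T)"
    unfolding has_derivative_within by (simp add: bounded_linear_scaleR_left)
  then show ?thesis
    unfolding has_vector_derivative_def using at_within_open[OF T(3,1)] by simp
qed

lemma const_of_zero_vector_derivative: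
  fixes F :: "real \<Rightarrow> 'b::real_normed_vector"
  assumes "\<And>t. t \<in> T \<Longrightarrow> (F has_vector_derivative 0) (at t)" "convex T" "s \<in> T" "t \<in> T"
  shows "F s = F t"
proof -
  have "norm (F s - F t) \<le> 0 * norm (s - t)"
    by (rule differentiable_bound[OF assms(2) _ _ assms(3,4), where f'="\<lambda>_ h. 0"])
      (use assms(1) in \<open>auto simp: has_vector_derivative_def onorm_zero intro: has_derivative_at_withinI\<close>)
  then show ?thesis by simp
qed

section \<open>Integration by parts against test functions\<close>

lemma test_funs_bounded:
  assumes "\<phi> \<in> test_funs \<Omega>" obtains B where "B \<ge> 0" "\<And>x. norm (\<phi> x) \<le> B"
proof -
  let ?K = "closure {x. \<phi> x \<noteq> 0}"
  have "compact (\<phi> ` ?K)"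
    by (intro compact_continuous_image C_k_continuous[of 0] test_funsD(1,2)[OF assms])
  then have "\<exists>B. \<forall>x\<in>?K. norm (\<phi> x) \<le> B"
    by (auto dest!: compact_imp_bounded simp: bounded_iff)
  then obtain B where B: "\<forall>x\<in>?K. norm (\<phi> x) \<le> B" ..
  have "norm (\<phi> x) \<le> max 0 B" for x
  proof (cases "x \<in> ?K")
    case True then show ?thesis using B by fastforce
  next
    case False
    then have "\<phi> x = 0" by (rule closure_support[of x \<phi>])
    then show ?thesis by simp
  qed
  then show ?thesis using that[of "max 0 B"] by simp
qed

lemma test_funs_measurable [measurable]:
  assumes "\<phi> \<in> test_funs \<Omega>" shows "\<phi> \<in> borel_measurable borel"
  by (rule borel_measurable_continuous_onI[OF C_k_continuous[OF test_funsD(1)[OF assms, of 0]]])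

lemma borel_measurable_lebesgue_onI:
  "f \<in> borel_measurable borel \<Longrightarrow> f \<in> borel_measurable (lebesgue_on S)"
  by (intro measurable_restrict_space1 measurable_completion) simp

lemma test_funs_integrable:
  assumes "\<phi> \<in> test_funs \<Omega>" "S \<in> sets lebesgue" shows "integrable (lebesgue_on S) \<phi>"
proof -
  let ?K = "closure {x. \<phi> x \<noteq> 0}"
  have "integrable lborel (\<lambda>x. indicator ?K x *\<^sub>R \<phi> x)"
    by (intro borel_integrable_compact C_k_continuous[of 0] test_funsD(1,2)[OF assms(1)])
  also have "(\<lambda>x. indicator ?K x *\<^sub>R \<phi> x) = \<phi>"
  proof
    fix x show "indicator ?K x *\<^sub>R \<phi> x = \<phi> x"
      using closure_support[of x \<phi>] by (cases "x \<in> ?K") (simp_all only: indicator_simps scaleR_one scaleR_zero_left not_False_eq_True simp_thms)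
  qed
  finally have "integrable lebesgue \<phi>"
    using test_funs_measurable[OF assms(1)] by (simp add: integrable_completion)
  then show ?thesis
    using assms(2) by (simp add: integrable_restrict_space integrable_mult_indicator)
qed

text \<open>The integral of a translate does not depend on the translation, so its derivative along
  b is zero; differentiating under the integral sign gives the integral of the partial
  derivative.\<close>

lemma LINT_pderiv_test_fun:
  assumes "\<phi> \<in> test_funs \<Omega>" "\<Omega> \<in> sets lebesgue" "b \<in> Basis"
  shows "(LINT x|lebesgue_on \<Omega>. pderiv_at b \<phi> x) = 0"
proof -
  let ?K = "closure {x. \<phi> x \<noteq> 0}"
  obtain R where R: "?K \<subseteq> cball 0 R"
    using bounded_subset_ballD[OF compact_imp_bounded[OF test_funsD(2)[OF assms(1)]]] ball_subset_cball
    by (metis subset_trans)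
  \<comment> \<open>One unit larger than a ball containing the support, so that all translates by
    less than one unit still vanish off S.\<close>
  define S :: "'a set" where "S = cball 0 (R + 1)"
  note p = test_funs_pderiv[OF assms(1,3)]
  obtain B1 where B1: "\<And>x. norm (\<phi> x) \<le> B1" using test_funs_bounded[OF assms(1)] by metis
  obtain B2 where B2: "\<And>x. norm (pderiv_at b \<phi> x) \<le> B2" using test_funs_bounded[OF p] by metis
  note [measurable] = test_funs_measurable[OF assms(1)] test_funs_measurable[OF p]
  have "((\<lambda>s. LINT x|lebesgue_on S. 1 * \<phi> (s *\<^sub>R b + x)) has_vector_derivative
      (LINT x|lebesgue_on S. 1 * pderiv_at b \<phi> (0 *\<^sub>R b + x))) (at 0)"
  proof (rule has_vector_derivative_LINT[where B="max B1 B2" and T="{-1<..<1}"])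
    show "integrable (lebesgue_on S) (\<lambda>x. 1 :: complex)"
      by (rule integrable_lebesgue_on_bounded[of _ _ 1]) (auto simp: S_def)
    fix s :: real and x
    show "norm (\<phi> (s *\<^sub>R b + x)) \<le> max B1 B2" "norm (pderiv_at b \<phi> (s *\<^sub>R b + x)) \<le> max B1 B2"
      using B1[of "s *\<^sub>R b + x"] B2[of "s *\<^sub>R b + x"] by auto
    have \<phi>: "(\<phi> has_derivative frechet_derivative \<phi> (at z)) (at z)" for z
      by (rule C_k_has_derivative[OF test_funsD(1)[OF assms(1), of "Suc 0"]])
    have "((\<lambda>s. s *\<^sub>R b + x) has_derivative (\<lambda>h. h *\<^sub>R b)) (at s)"
      by (auto intro!: derivative_eq_intros)
    from diff_chain_at[OF this \<phi>] show "((\<lambda>s. \<phi> (s *\<^sub>R b + x)) has_vector_derivative pderiv_at b \<phi> (s *\<^sub>R b + x)) (at s)"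
      unfolding has_vector_derivative_def o_def linear.scaleR[OF has_derivative_linear[OF \<phi>]] pderiv_at_def .
  qed (auto intro!: borel_measurable_lebesgue_onI)
  moreover have "((\<lambda>s. LINT x|lebesgue_on S. 1 * \<phi> (s *\<^sub>R b + x)) has_vector_derivative 0) (at 0)"
  proof (rule has_vector_derivative_transform_within_open[where S="{-1<..<1}"])
    show "((\<lambda>s. LINT x|lebesgue. \<phi> x) has_vector_derivative 0) (at 0)" by simp
    fix s :: real assume s: "s \<in> {-1<..<1}"
    have z: "1 * \<phi> (s *\<^sub>R b + x) = 0" if "x \<notin> S" for x
    proof -
      have "R + 1 < norm x" using that by (simp add: S_def)
      also have "norm x \<le> norm (s *\<^sub>R b + x) + norm (s *\<^sub>R b)"
        using norm_triangle_ineq4[of "s *\<^sub>R b + x" "s *\<^sub>R b"] by simp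
      also have "norm (s *\<^sub>R b) \<le> 1" using s assms(3) by (simp add: abs_le_iff)
      finally have "s *\<^sub>R b + x \<notin> ?K" using R by auto
      then have "\<phi> (s *\<^sub>R b + x) = 0" by (rule closure_support[of _ \<phi>])
      then show ?thesis by simp
    qed
    have "(LINT x|lebesgue_on S. 1 * \<phi> (s *\<^sub>R b + x)) = (LINT x|lebesgue. 1 * \<phi> (s *\<^sub>R b + x))"
      by (rule LINT_lebesgue_on_support[OF _ z]) (auto simp: S_def)
    also have "\<dots> = (LINT x|lebesgue. \<phi> x)"
      using LINT_lebesgue_affine[of \<phi> 1 "s *\<^sub>R b"] by simp
    finally show "(LINT x|lebesgue. \<phi> x) = (LINT x|lebesgue_on S. 1 * \<phi> (s *\<^sub>R b + x))" by simp
  qed auto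
  ultimately have "(LINT x|lebesgue_on S. pderiv_at b \<phi> x) = 0"
    using vector_derivative_unique_at by fastforce
  also have "(LINT x|lebesgue_on S. pderiv_at b \<phi> x) = (LINT x|lebesgue. pderiv_at b \<phi> x)"
  proof (rule LINT_lebesgue_on_support)
    fix x assume "x \<notin> S"
    then have "x \<notin> ?K" using R by (auto simp: S_def)
    then show "pderiv_at b \<phi> x = 0"
      using pderiv_at_cong[of "- ?K" x \<phi> "\<lambda>_. 0" b] pderiv_at_eq[OF has_derivative_const[of 0], of b x]
        closure_support[of _ \<phi>] by (metis ComplD ComplI closed_closure open_Compl)
  qed (auto simp: S_def)
  also have "\<dots> = (LINT x|lebesgue_on \<Omega>. pderiv_at b \<phi> x)"
    by (rule LINT_lebesgue_on_support[symmetric, OF assms(2) test_funsD(4)[OF p]])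
  finally show ?thesis .
qed

lemma integration_by_parts:
  assumes "\<And>k. C_k k f" "\<phi> \<in> test_funs \<Omega>" "\<Omega> \<in> sets lebesgue" "b \<in> Basis"
  shows "(LINT x|lebesgue_on \<Omega>. f x * pderiv_at b \<phi> x) = - (LINT x|lebesgue_on \<Omega>. pderiv_at b f x * \<phi> x)"
proof -
  have f': "C_k k (pderiv_at b f)" for k using assms(1)[of "Suc k"] assms(4) by simp
  have I1: "integrable (lebesgue_on \<Omega>) (\<lambda>x. f x * pderiv_at b \<phi> x)"
    by (rule test_funs_integrable[OF test_funs_mult[OF test_funs_pderiv[OF assms(2,4)] assms(1)] assms(3)])
  have I2: "integrable (lebesgue_on \<Omega>) (\<lambda>x. pderiv_at b f x * \<phi> x)"
    by (rule test_funs_integrable[OF test_funs_mult[OF assms(2) f'] assms(3)])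
  have "0 = (LINT x|lebesgue_on \<Omega>. pderiv_at b (\<lambda>x. f x * \<phi> x) x)"
    by (rule LINT_pderiv_test_fun[symmetric, OF test_funs_mult[OF assms(2,1)] assms(3,4)])
  also have "\<dots> = (LINT x|lebesgue_on \<Omega>. f x * pderiv_at b \<phi> x + pderiv_at b f x * \<phi> x)"
    by (intro Bochner_Integration.integral_cong refl pderiv_at_mult
        C_k_differentiable[OF assms(1)] C_k_differentiable[OF test_funsD(1)[OF assms(2)]])
  also have "\<dots> = (LINT x|lebesgue_on \<Omega>. f x * pderiv_at b \<phi> x) + (LINT x|lebesgue_on \<Omega>. pderiv_at b f x * \<phi> x)"
    using I1 I2 by simp
  finally show ?thesis by (simp add: eq_neg_iff_add_eq_0)
qed

text \<open>The integrand vanishes almost everywhere, and the set where a continuous function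
  differs from zero is open; a nonempty open set is not negligible.\<close>

lemma continuous_AE_zero:
  fixes f :: "'a::euclidean_space \<Rightarrow> real"
  assumes "open S" "continuous_on S f" "integrable (lebesgue_on S) f" "\<And>x. x \<in> S \<Longrightarrow> f x \<ge> 0"
    "(LINT x|lebesgue_on S. f x) \<le> 0" "x \<in> S"
  shows "f x = 0"
proof (rule ccontr)
  assume "f x \<noteq> 0"
  have nn: "AE x in lebesgue_on S. 0 \<le> f x" using assms(4) by (intro AE_I2) auto
  have "(LINT x|lebesgue_on S. f x) \<ge> 0" using assms(4) by (intro Bochner_Integration.integral_nonneg) auto
  then have "AE x in lebesgue_on S. f x = 0"
    using integral_nonneg_eq_0_iff_AE[OF assms(3) nn] assms(5) by simp
  then have "AE x in lebesgue. x \<in> S \<longrightarrow> f x = 0"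
    using assms(1) by (simp add: AE_restrict_space_iff)
  then have "negligible {x. \<not> (x \<in> S \<longrightarrow> f x = 0)}"
    by (simp add: eventually_ae_filter_negligible) (meson negligible_subset)
  moreover have "{x. \<not> (x \<in> S \<longrightarrow> f x = 0)} = S \<inter> f -` (- {0})" by auto
  moreover have "open (S \<inter> f -` (- {0}))"
    by (rule continuous_open_preimage[OF assms(2,1)]) auto
  ultimately show False using open_not_negligible[of "S \<inter> f -` (- {0})"] assms(6) \<open>f x \<noteq> 0\<close> by auto
qed

section \<open>Weighted means over balls\<close>

text \<open>The power of r makes the mean of the constant 1 independent of the radius, equal to
  \<open>kmass\<close>. The means are not divided by this mass, since signed profiles such as the
  derivative of a bump occur as well.\<close>

definition kavg :: "'a::euclidean_space set \<Rightarrow> (real \<Rightarrow> real) \<Rightarrow> ('a \<Rightarrow> complex) \<Rightarrow> 'a \<Rightarrow> real \<Rightarrow> complex" where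
  "kavg \<Omega> g u y r = (LINT x|lebesgue_on \<Omega>. u x * complex_of_real (radial g y r x / r ^ DIM('a)))"

definition kmass :: "'a::euclidean_space itself \<Rightarrow> (real \<Rightarrow> real) \<Rightarrow> real" where
  "kmass _ g = (LINT x|lebesgue. radial g (0::'a) 1 x)"

lemma kavg_cmult: "kavg \<Omega> g (\<lambda>x. k * u x) y r = k * kavg \<Omega> g u y r"
  unfolding kavg_def by (simp add: mult.assoc)

lemma kernel_continuous_on: "kernel g \<Longrightarrow> continuous_on S (radial g y r)"
  unfolding kernel_def by (intro continuous_on_radial) simp

lemma kavg_integrable:
  fixes u :: "'a::euclidean_space \<Rightarrow> complex"
  assumes "\<Omega> \<in> sets lebesgue" "continuous_on (cball y r) u" "cball y r \<subseteq> \<Omega>" "kernel g" "r > 0"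
  shows "integrable (lebesgue_on \<Omega>) (\<lambda>x. u x * complex_of_real (radial g y r x / r ^ DIM('a)))"
    (is "integrable _ ?f")
proof -
  have "integrable lborel (\<lambda>x. indicator (cball y r) x *\<^sub>R ?f x)"
    by (intro borel_integrable_compact continuous_intros kernel_continuous_on assms compact_cball) (use assms in auto)
  then have "integrable lebesgue (\<lambda>x. indicator (cball y r) x *\<^sub>R ?f x)"
    by (simp add: integrable_completion borel_measurable_integrable)
  also have "(\<lambda>x. indicator (cball y r) x *\<^sub>R ?f x) = (\<lambda>x. indicator \<Omega> x *\<^sub>R ?f x)"
  proof
    fix x show "indicator (cball y r) x *\<^sub>R ?f x = indicator \<Omega> x *\<^sub>R ?f x"
      using assms(3) radial_zero[OF assms(4,5), of x] by (cases "x \<in> cball y r") auto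
  qed
  finally show ?thesis using assms(1) by (simp add: integrable_restrict_space)
qed

lemma integrable_lebesgue_on_subset:
  fixes f :: "'a::euclidean_space \<Rightarrow> 'b::{banach, second_countable_topology}"
  assumes "integrable (lebesgue_on T) f" "S \<subseteq> T" "S \<in> sets lebesgue" "T \<in> sets lebesgue"
  shows "integrable (lebesgue_on S) f"
proof -
  have "integrable lebesgue (\<lambda>x. indicator S x *\<^sub>R (indicator T x *\<^sub>R f x))"
  proof (rule integrable_mult_indicator)
    show "integrable lebesgue (\<lambda>x. indicator T x *\<^sub>R f x)"
      using assms(1,4) by (simp add: integrable_restrict_space)
  qed (use assms in simp)
  also have "(\<lambda>x. indicator S x *\<^sub>R (indicator T x *\<^sub>R f x)) = (\<lambda>x. indicator S x *\<^sub>R f x)"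
    using assms(2) by (auto simp: indicator_def fun_eq_iff)
  finally show ?thesis using assms(3) by (simp add: integrable_restrict_space)
qed

lemma kavg_ball:
  assumes "\<Omega> \<in> sets lebesgue" "ball y \<rho> \<subseteq> \<Omega>" "kernel g" "0 < r" "r \<le> \<rho>"
  shows "kavg \<Omega> g u y r = kavg (ball y \<rho>) g u y r"
  unfolding kavg_def
proof (rule LINT_lebesgue_on_mono[OF _ assms(1,2)])
  fix x assume "x \<in> \<Omega> - ball y \<rho>"
  then have "x \<notin> ball y r" using assms by auto
  then show "u x * complex_of_real (radial g y r x / r ^ DIM('a)) = 0"
    using radial_zero[OF assms(3,4), of x y] by simp
qed simp

lemma kavg_one:
  fixes y :: "'a::euclidean_space"
  assumes "\<Omega> \<in> sets lebesgue" "cball y r \<subseteq> \<Omega>" "kernel g" "0 < r"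
  shows "kavg \<Omega> g (\<lambda>_. 1) y r = complex_of_real (kmass TYPE('a) g)"
proof -
  have m: "radial g y r \<in> borel_measurable borel"
    by (rule borel_measurable_continuous_onI[OF kernel_continuous_on[OF assms(3)]])
  have "kavg \<Omega> g (\<lambda>_. 1) y r = (LINT x|lebesgue. complex_of_real (radial g y r x / r ^ DIM('a)))"
    unfolding kavg_def mult_1
  proof (rule LINT_lebesgue_on_support[OF assms(1)])
    fix x assume "x \<notin> \<Omega>"
    then have "x \<notin> ball y r" using assms(2) ball_subset_cball by blast
    then show "complex_of_real (radial g y r x / r ^ DIM('a)) = 0"
      using radial_zero[OF assms(3,4), of x y] by simp
  qed
  also have "\<dots> = complex_of_real ((1 / \<bar>r\<bar> ^ DIM('a)) *\<^sub>R (LINT x|lebesgue. radial g y r x))"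
    using assms(4) by (simp add: integral_complex_of_real del: of_real_divide)
  also have "(1 / \<bar>r\<bar> ^ DIM('a)) *\<^sub>R (LINT x|lebesgue. radial g y r x) = (LINT x|lebesgue. radial g y r (y + r *\<^sub>R x))"
    using LINT_lebesgue_affine[OF m, of r y] assms(4) by simp
  also have "(\<lambda>x. radial g y r (y + r *\<^sub>R x)) = radial g (0::'a) 1"
    using assms(4) by (auto simp: radial_def power_mult_distrib)
  finally show ?thesis by (simp add: kmass_def)
qed

lemma kavg_bound:
  fixes u :: "'a::euclidean_space \<Rightarrow> complex"
  assumes "\<Omega> \<in> sets lebesgue" "continuous_on (cball y r) u" "cball y r \<subseteq> \<Omega>" "kernel g" "r > 0"
    "\<And>s. s \<in> {0..1} \<Longrightarrow> \<bar>g s\<bar> \<le> B" "\<And>x. x \<in> ball y r \<Longrightarrow> norm (u x) \<le> K" "0 \<le> K"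
  shows "norm (kavg \<Omega> g u y r) \<le> K * B * measure lborel (ball (0::'a) 1)"
proof -
  let ?f = "\<lambda>x. u x * complex_of_real (radial g y r x / r ^ DIM('a))"
  have I: "integrable (lebesgue_on (ball y r)) ?f"
  proof -
    have "integrable (lebesgue_on (cball y r)) ?f"
      by (rule kavg_integrable) (use assms in auto)
    then show ?thesis by (rule integrable_lebesgue_on_subset) auto
  qed
  have "kavg \<Omega> g u y r = kavg (ball y r) g u y r"
    by (rule kavg_ball) (use assms ball_subset_cball in auto)
  also have "norm \<dots> \<le> (LINT x|lebesgue_on (ball y r). norm (?f x))"
    unfolding kavg_def by (rule integral_norm_bound)
  also have "\<dots> \<le> (LINT x|lebesgue_on (ball y r). K * B / r ^ DIM('a))"
  proof (rule integral_mono)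
    fix x assume "x \<in> space (lebesgue_on (ball y r))"
    then have x: "x \<in> ball y r" by simp
    then have "(norm (x - y))\<^sup>2 \<le> r\<^sup>2" using assms(5) by (intro power_mono) (auto simp: dist_norm norm_minus_commute)
    then have "(norm (x - y))\<^sup>2 / r\<^sup>2 \<in> {0..1}" using assms(5) by auto
    from assms(6)[OF this] have "\<bar>radial g y r x\<bar> \<le> B" by (simp add: radial_def)
    then have "norm (u x) * \<bar>radial g y r x\<bar> \<le> K * B" using assms(7)[OF x] assms(8) by (intro mult_mono) auto
    then show "norm (?f x) \<le> K * B / r ^ DIM('a)"
      using assms(5) by (simp add: norm_mult norm_divide norm_power divide_right_mono)
  qed (use I in \<open>auto intro!: integrable_lebesgue_on_bounded[where B="\<bar>K * B / r ^ DIM('a)\<bar>"]\<close>)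
  also have "\<dots> = K * B / r ^ DIM('a) * measure lborel (ball y r)"
    by (simp add: measure_restrict_space)
  also have "\<dots> = K * B * measure lborel (ball (0::'a) 1)"
    using content_ball_conv_unit_ball[of r y] assms(5) by simp
  finally show ?thesis .
qed

text \<open>The radial equation. The derivative in r of the scaled kernel equals r / (2 * r^d) times
  the Laplacian in x of the radial function with profile \<open>tail g\<close>, where d is the
  dimension. That radial function is an admissible test function, so the weak identity moves the
  Laplacian from it to \<open>u\<close>, and no derivative of \<open>u\<close> enters.\<close>

lemma kavg_has_vector_derivative:
  fixes u :: "'a::euclidean_space \<Rightarrow> complex"
  assumes "\<Omega> \<in> sets lebesgue" "continuous_on \<Omega> u" "has_distr_laplacian \<Omega> u v" "kernel g"
    "cball y \<rho> \<subseteq> \<Omega>" "0 < r" "r < \<rho>"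
  shows "((\<lambda>r. kavg \<Omega> g u y r) has_vector_derivative
    (complex_of_real (r / 2) * kavg \<Omega> (tail g) v y r)) (at r)"
proof -
  obtain g' where g': "kernel g'" "\<And>s. (g has_real_derivative g' s) (at s)"
    using kernel_deriv[OF assms(4)] by metis
  let ?d = "DIM('a)"
  define M where "M = lebesgue_on (ball y \<rho>)"
  define \<Phi> where "\<Phi> s x = radial g y s x / s ^ ?d" for s x
  define \<Phi>' where "\<Phi>' s x = - (s / (2 * s ^ ?d)) *
    (2 * ?d / s\<^sup>2 * radial g y s x + 4 * (norm (x - y))\<^sup>2 / s ^ 4 * radial g' y s x)" for s x
  \<comment> \<open>A compact range of radii and points, bounded away from radius 0, on which the
    kernel and its radius derivative are bounded; this supplies the constant for differentiation
    under the integral.\<close>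
  define K where "K = {r/2..\<rho>} \<times> cball y \<rho>"
  have Knz: "fst p \<noteq> 0" "fst p > 0" if "p \<in> K" for p using that assms(6) by (auto simp: K_def)
  have contr: "continuous_on K (\<lambda>p. radial h y (fst p) (snd p))" if "kernel h" for h
  proof -
    have "smooth h" using that unfolding kernel_def by simp
    then show ?thesis unfolding radial_def
      by (intro continuous_on_compose2[OF smooth_continuous_on[of h UNIV]] continuous_intros) (use Knz in auto)
  qed
  have c1: "continuous_on K (\<lambda>p. \<Phi> (fst p) (snd p))" "continuous_on K (\<lambda>p. \<Phi>' (fst p) (snd p))"
    unfolding \<Phi>_def \<Phi>'_def by (intro continuous_intros contr g' assms(4), use Knz in auto)+
  have "compact K" by (simp add: K_def compact_Times)
  from compact_imp_bounded[OF compact_continuous_image[OF c1(1) this]] compact_imp_bounded[OF compact_continuous_image[OF c1(2) this]]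
  obtain B1 B2 where B: "\<And>p. p \<in> K \<Longrightarrow> \<bar>\<Phi> (fst p) (snd p)\<bar> \<le> B1" "\<And>p. p \<in> K \<Longrightarrow> \<bar>\<Phi>' (fst p) (snd p)\<bar> \<le> B2"
    unfolding bounded_iff ball_simps real_norm_def by metis
  have u_int: "integrable M u"
  proof -
    have cu: "continuous_on (cball y \<rho>) u" using assms(2,5) by (rule continuous_on_subset)
    then have "compact (u ` cball y \<rho>)" by (intro compact_continuous_image) auto
    then obtain C where "\<forall>x\<in>cball y \<rho>. norm (u x) \<le> C" by (auto dest!: compact_imp_bounded simp: bounded_iff)
    then show ?thesis unfolding M_def
      by (intro integrable_lebesgue_on_continuous[of _ _ C] continuous_on_subset[OF cu]) (auto simp: ball_subset_cball)
  qed
  have cx: "continuous_on UNIV (\<Phi> s)" "continuous_on UNIV (\<Phi>' s)" if "s > 0" for s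
    unfolding \<Phi>_def[abs_def] \<Phi>'_def[abs_def]
    by (intro continuous_intros kernel_continuous_on g' assms(4), use that in auto)+
  have D: "((\<lambda>s. LINT x|M. u x * complex_of_real (\<Phi> s x)) has_vector_derivative
     (LINT x|M. u x * complex_of_real (\<Phi>' r x))) (at r)"
  proof (rule has_vector_derivative_LINT[where B="max B1 B2" and T="{r/2<..<\<rho>}", OF u_int])
    fix s x assume s: "s \<in> {r/2<..<\<rho>}" and "x \<in> space M"
    then have p: "(s, x) \<in> K" and s0: "s > 0" using assms by (auto simp: K_def M_def)
    show "norm (complex_of_real (\<Phi> s x)) \<le> max B1 B2" "norm (complex_of_real (\<Phi>' s x)) \<le> max B1 B2"
      using B(1)[OF p] B(2)[OF p] by auto
    have "((\<lambda>s. (norm (x - y))\<^sup>2 / s\<^sup>2) has_real_derivative (- 2 * (norm (x - y))\<^sup>2 / s ^ 3)) (at s)"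
      using s0 by (auto intro!: derivative_eq_intros simp: field_simps eval_nat_numeral)
    from DERIV_chain2[OF g'(2) this]
    have "((\<lambda>s. radial g y s x) has_real_derivative radial g' y s x * (- 2 * (norm (x - y))\<^sup>2 / s ^ 3)) (at s)"
      unfolding radial_def .
    then have "((\<lambda>s. \<Phi> s x) has_real_derivative
      ((radial g' y s x * (- 2 * (norm (x - y))\<^sup>2 / s ^ 3)) * s ^ ?d - radial g y s x * (real ?d * s ^ (?d - 1))) / (s ^ ?d * s ^ ?d)) (at s)"
      unfolding \<Phi>_def by (rule DERIV_divide) (use s0 in \<open>auto intro!: derivative_eq_intros\<close>)
    also have "((radial g' y s x * (- 2 * (norm (x - y))\<^sup>2 / s ^ 3)) * s ^ ?d - radial g y s x * (real ?d * s ^ (?d - 1))) / (s ^ ?d * s ^ ?d) = \<Phi>' s x"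
    proof -
      have "s ^ ?d = s * s ^ (?d - 1)" using DIM_positive[where 'a='a] by (metis Suc_diff_1 power_Suc)
      then show ?thesis unfolding \<Phi>'_def using s0 by (simp add: field_simps eval_nat_numeral)
    qed
    finally show "((\<lambda>s. complex_of_real (\<Phi> s x)) has_vector_derivative complex_of_real (\<Phi>' s x)) (at s)"
      by (intro has_vector_derivative_of_real) (simp add: has_real_derivative_iff_has_vector_derivative)
  next
    fix s assume "s \<in> {r/2<..<\<rho>}"
    then have "s > 0" using assms(6) by auto
    from cx[OF this] have "continuous_on UNIV (\<lambda>x. complex_of_real (\<Phi> s x))" "continuous_on UNIV (\<lambda>x. complex_of_real (\<Phi>' s x))"
      by (auto intro: continuous_intros)
    then show "(\<lambda>x. complex_of_real (\<Phi> s x)) \<in> borel_measurable M" "(\<lambda>x. complex_of_real (\<Phi>' s x)) \<in> borel_measurable M"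
      unfolding M_def by (auto intro!: borel_measurable_lebesgue_onI borel_measurable_continuous_onI)
  qed (use assms in auto)
  define \<phi> where "\<phi> x = complex_of_real (radial (tail g) y r x)" for x
  have \<phi>: "\<phi> \<in> test_funs \<Omega>"
    unfolding \<phi>_def[abs_def] using assms by (intro radial_test_funs kernel_tail) auto
  have lapl: "laplacian \<phi> x = complex_of_real (2 * ?d / r\<^sup>2 * radial (\<lambda>s. - g s) y r x + 4 * (norm (x - y))\<^sup>2 / r ^ 4 * radial (\<lambda>s. - g' s) y r x)" for x
    unfolding \<phi>_def[abs_def]
    by (rule laplacian_radial) (auto intro!: derivative_eq_intros tail_deriv[OF assms(4)] g'(2))
  have lap: "complex_of_real (\<Phi>' r x) = complex_of_real (r / (2 * r ^ ?d)) * laplacian \<phi> x" for x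
    unfolding lapl of_real_mult[symmetric] of_real_eq_iff \<Phi>'_def radial_def by (simp add: algebra_simps)
  have "(LINT x|M. u x * complex_of_real (\<Phi>' r x)) = (LINT x|lebesgue_on \<Omega>. u x * complex_of_real (\<Phi>' r x))"
    unfolding M_def
  proof (rule LINT_lebesgue_on_mono[symmetric])
    fix x assume "x \<in> \<Omega> - ball y \<rho>"
    then have "x \<notin> ball y r" using assms(7) by auto
    then show "u x * complex_of_real (\<Phi>' r x) = 0"
      unfolding \<Phi>'_def using radial_zero[OF assms(4,6), of x y] radial_zero[OF g'(1) assms(6), of x y] by simp
  qed (use assms ball_subset_cball in auto)
  also have "\<dots> = complex_of_real (r / (2 * r ^ ?d)) * (LINT x|lebesgue_on \<Omega>. u x * laplacian \<phi> x)"
    unfolding lap by (subst integral_mult_right_zero[symmetric]) (simp add: mult_ac)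
  also have "(LINT x|lebesgue_on \<Omega>. u x * laplacian \<phi> x) = (LINT x|lebesgue_on \<Omega>. v x * \<phi> x)"
    using assms(3) \<phi> unfolding has_distr_laplacian_def by simp
  also have "complex_of_real (r / (2 * r ^ ?d)) * \<dots> = complex_of_real (r / 2) * kavg \<Omega> (tail g) v y r"
    unfolding kavg_def \<phi>_def by (subst (1 2) integral_mult_right_zero[symmetric]) (simp add: mult_ac)
  finally have E: "(LINT x|M. u x * complex_of_real (\<Phi>' r x)) = complex_of_real (r / 2) * kavg \<Omega> (tail g) v y r" .
  show ?thesis
  proof (rule has_vector_derivative_transform_within_open[OF D[unfolded E], of "{0<..<\<rho>}"])
    fix s assume "s \<in> {0<..<\<rho>}"
    then show "(LINT x|M. u x * complex_of_real (\<Phi> s x)) = kavg \<Omega> g u y s"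
      using kavg_ball[OF assms(1) _ assms(4), of y \<rho> s u] assms(5) ball_subset_cball
      unfolding M_def \<Phi>_def kavg_def by fastforce
  qed (use assms in auto)
qed

lemma kavg_tendsto:
  fixes u :: "'a::euclidean_space \<Rightarrow> complex"
  assumes "open \<Omega>" "continuous_on \<Omega> u" "kernel g" "y \<in> \<Omega>"
  shows "((\<lambda>r. kavg \<Omega> g u y r) \<longlongrightarrow> complex_of_real (kmass TYPE('a) g) * u y) (at_right 0)"
proof (rule tendstoI)
  fix e :: real assume e: "e > 0"
  obtain B where B: "B \<ge> 0" "\<And>s. s \<ge> 0 \<Longrightarrow> \<bar>g s\<bar> \<le> B" using kernel_bounded[OF assms(3)] by metis
  define V where "V = measure lborel (ball (0::'a) 1)"
  have V: "V \<ge> 0" by (simp add: V_def)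
  \<comment> \<open>The summand 1 keeps the denominator positive when B * V = 0; the factor 2 makes
    the final inequality strict.\<close>
  define \<epsilon> where "\<epsilon> = e / (2 * (B * V + 1))"
  have \<epsilon>: "\<epsilon> > 0" "\<epsilon> * B * V < e"
  proof -
    show "\<epsilon> > 0" using e B V unfolding \<epsilon>_def by (intro divide_pos_pos mult_pos_pos add_nonneg_pos mult_nonneg_nonneg) auto
    have "\<epsilon> * B * V \<le> \<epsilon> * (B * V + 1)" using \<open>\<epsilon> > 0\<close> by (simp add: algebra_simps)
    also have "B * V \<ge> 0" using B V by simp
    then have "\<epsilon> * (B * V + 1) = e / 2" unfolding \<epsilon>_def by (simp add: field_simps)
    finally show "\<epsilon> * B * V < e" using e by simp
  qed
  have "isCont u y" using assms by (simp add: continuous_on_eq_continuous_at)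
  then obtain d1 where d1: "d1 > 0" "\<And>x. dist x y < d1 \<Longrightarrow> dist (u x) (u y) < \<epsilon>"
    using \<epsilon>(1) unfolding continuous_at_eps_delta by (metis)
  obtain d2 where d2: "d2 > 0" "cball y d2 \<subseteq> \<Omega>" using assms open_contains_cball by metis
  have "dist (kavg \<Omega> g u y r) (complex_of_real (kmass TYPE('a) g) * u y) < e" if r: "r \<in> {0<..<min d1 d2}" for r
  proof -
    have sub: "cball y r \<subseteq> \<Omega>" using r d2(2) by auto
    have r0: "r > 0" using r by simp
    have S: "\<Omega> \<in> sets lebesgue" using assms(1) by simp
    have cu: "continuous_on (cball y r) u" using assms(2) sub by (rule continuous_on_subset)
    have "kavg \<Omega> g (\<lambda>_. u y * 1) y r = u y * complex_of_real (kmass TYPE('a) g)"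
      unfolding kavg_cmult kavg_one[OF S sub assms(3) r0] ..
    moreover have "kavg \<Omega> g (\<lambda>x. u x - u y * 1) y r = kavg \<Omega> g u y r - kavg \<Omega> g (\<lambda>_. u y * 1) y r"
      unfolding kavg_def left_diff_distrib
      by (intro Bochner_Integration.integral_diff kavg_integrable S cu sub assms(3) r0 continuous_intros)
    moreover have "norm (kavg \<Omega> g (\<lambda>x. u x - u y * 1) y r) \<le> \<epsilon> * B * V"
      unfolding V_def
    proof (rule kavg_bound[OF S _ sub assms(3) r0])
      show "norm (u x - u y * 1) \<le> \<epsilon>" if "x \<in> ball y r" for x
        using d1(2)[of x] that r by (auto simp: dist_norm norm_minus_commute less_imp_le)
    qed (use B \<epsilon> cu in \<open>auto intro!: continuous_intros\<close>)
    ultimately show ?thesis using \<epsilon>(2) by (simp add: dist_norm mult.commute)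
  qed
  then show "\<forall>\<^sub>F r in at_right 0. dist (kavg \<Omega> g u y r) (complex_of_real (kmass TYPE('a) g) * u y) < e"
    by (rule eventually_at_rightI[of 0 "min d1 d2"]) (use d1(1) d2(1) in auto)
qed

lemma power_law_of_derivative:
  fixes F :: "real \<Rightarrow> complex"
  assumes "\<And>r. 0 < r \<Longrightarrow> r < \<rho> \<Longrightarrow> (F has_vector_derivative complex_of_real (a * r ^ k) * z) (at r)"
    and "(F \<longlongrightarrow> L) (at_right 0)" "0 < r" "r < \<rho>"
  shows "F r = L + complex_of_real (a / real (Suc k) * r ^ Suc k) * z"
proof -
  define H where "H r = F r - complex_of_real (a / real (Suc k) * r ^ Suc k) * z" for r
  have "(H has_vector_derivative 0) (at s)" if "s \<in> {0<..<\<rho>}" for s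
  proof -
    have "((\<lambda>r. a / real (Suc k) * r ^ Suc k) has_real_derivative a * s ^ k) (at s)"
      by (auto intro!: derivative_eq_intros simp del: power_Suc of_nat_Suc)
    then have "((\<lambda>r. complex_of_real (a / real (Suc k) * r ^ Suc k)) has_vector_derivative complex_of_real (a * s ^ k)) (at s)"
      by (intro has_vector_derivative_of_real) (simp add: has_real_derivative_iff_has_vector_derivative)
    from has_vector_derivative_diff[OF assms(1) has_vector_derivative_mult_left[OF this, of z]] that
    show ?thesis unfolding H_def[abs_def] by (auto simp: mult_ac)
  qed
  then have c: "H s = H r" if "s \<in> {0<..<\<rho>}" for s
    by (rule const_of_zero_vector_derivative[of "{0<..<\<rho>}"]) (use that assms in auto)
  have "((\<lambda>s. complex_of_real (a / real (Suc k) * s ^ Suc k) * z) \<longlongrightarrow> complex_of_real (a / real (Suc k) * 0 ^ Suc k) * z) (at_right 0)"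
    by (intro tendsto_intros)
  from tendsto_diff[OF assms(2) this] have "(H \<longlongrightarrow> L) (at_right 0)" unfolding H_def[abs_def] by simp
  moreover have "(H \<longlongrightarrow> H r) (at_right 0)"
    by (intro tendsto_eventually eventually_at_rightI[of 0 \<rho>] c) (use assms(3,4) in auto)
  ultimately have "H r = L" using tendsto_unique[OF trivial_limit_at_right_real] by blast
  then show ?thesis by (simp add: H_def algebra_simps)
qed

section \<open>Local rigidity\<close>

lemma norm_sq_eq_sum_Basis: "(norm x)\<^sup>2 = (\<Sum>b\<in>Basis. (x \<bullet> b)\<^sup>2)"
  unfolding power2_norm_eq_inner by (subst euclidean_inner) (simp add: power2_eq_square)

text \<open>The divergence of the compactly supported field x * \<open>tail g\<close>(|x|^2) is d *
  \<open>tail g\<close> - 2 * |x|^2 * g, where d is the dimension, and its integral is zero. This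
  evaluates the second moment of the identity map, with which the second moments of \<tau> are
  compared.\<close>

lemma kmass_id_times:
  assumes "kernel g"
  shows "kmass TYPE('a::euclidean_space) (\<lambda>s. s * g s) = real DIM('a) / 2 * kmass TYPE('a) (tail g)"
proof -
  let ?T = "\<lambda>x::'a. complex_of_real (radial (tail g) 0 1 x)"
  define \<phi> where "\<phi> b x = complex_of_real (x \<bullet> b) * ?T x" for b x :: 'a
  have T: "?T \<in> test_funs UNIV" by (rule radial_test_funs[OF kernel_tail[OF assms]]) auto
  have k: "kernel (\<lambda>s. s * g s)"
    using assms smooth_mult[OF smooth_id] unfolding kernel_def by auto
  have \<phi>: "\<phi> b \<in> test_funs UNIV" for b
    unfolding \<phi>_def[abs_def] by (rule test_funs_mult[OF T C_k_inner])
  have d: "((\<lambda>x. complex_of_real (x \<bullet> b)) has_derivative (\<lambda>h. complex_of_real (h \<bullet> b))) (at x)" for b x :: 'a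
    by (auto intro!: derivative_eq_intros)
  have dT: "(?T has_derivative (\<lambda>h. complex_of_real (radial (\<lambda>s. - g s) 0 1 x * (2 * ((x - 0) \<bullet> h) / 1\<^sup>2)))) (at x)" for x
    by (rule radial_has_derivative[OF tail_deriv[OF assms]])
  have "pderiv_at b (\<phi> b) x = complex_of_real (x \<bullet> b) * complex_of_real (radial (\<lambda>s. - g s) 0 1 x * (2 * ((x - 0) \<bullet> b) / 1\<^sup>2))
      + complex_of_real (b \<bullet> b) * ?T x" for b x
    unfolding \<phi>_def[abs_def] by (rule pderiv_at_eq[OF has_derivative_mult[OF d dT]])
  then have p: "pderiv_at b (\<phi> b) x = ?T x - complex_of_real (2 * (x \<bullet> b)\<^sup>2 * radial g 0 1 x)" if "b \<in> Basis" for b x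
    using that by (simp add: radial_def power2_eq_square)
  have sum: "(\<Sum>b\<in>Basis. pderiv_at b (\<phi> b) x) = complex_of_real (real DIM('a) * radial (tail g) 0 1 x - 2 * radial (\<lambda>s. s * g s) 0 1 x)" for x
  proof -
    have "(\<Sum>b\<in>Basis. pderiv_at b (\<phi> b) x) = (\<Sum>b\<in>Basis. ?T x - complex_of_real (2 * (x \<bullet> b)\<^sup>2 * radial g 0 1 x))"
      by (rule sum.cong) (auto simp: p)
    also have "\<dots> = of_nat DIM('a) * ?T x - complex_of_real (2 * (norm x)\<^sup>2 * radial g 0 1 x)"
      unfolding norm_sq_eq_sum_Basis by (simp add: sum_subtractf sum_distrib_left sum_distrib_right)
    finally show ?thesis by (simp add: radial_def)
  qed
  have I: "integrable lebesgue (radial h (0::'a) 1)" if "kernel h" for h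
  proof -
    have "integrable (lebesgue_on UNIV) (\<lambda>x::'a. complex_of_real (radial h 0 1 x))"
      by (rule test_funs_integrable[OF radial_test_funs[OF that]]) auto
    from integrable_Re[OF this] show ?thesis by (simp add: lebesgue_on_UNIV_eq)
  qed
  have "0 = (\<Sum>b\<in>Basis. LINT x|lebesgue_on UNIV. pderiv_at b (\<phi> b) x)"
    by (intro sum.neutral[symmetric] ballI LINT_pderiv_test_fun[OF \<phi>]) auto
  also have "\<dots> = (LINT x|lebesgue_on UNIV. (\<Sum>b\<in>Basis. pderiv_at b (\<phi> b) x))"
    by (intro Bochner_Integration.integral_sum[symmetric] test_funs_integrable[OF test_funs_pderiv[OF \<phi>]]) auto
  also have "\<dots> = complex_of_real (LINT x|lebesgue. real DIM('a) * radial (tail g) (0::'a) 1 x - 2 * radial (\<lambda>s. s * g s) 0 1 x)"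
    unfolding sum lebesgue_on_UNIV_eq by (rule integral_complex_of_real)
  also have "(LINT x|lebesgue. real DIM('a) * radial (tail g) (0::'a) 1 x - 2 * radial (\<lambda>s. s * g s) 0 1 x) =
    real DIM('a) * kmass TYPE('a) (tail g) - 2 * kmass TYPE('a) (\<lambda>s. s * g s)"
    unfolding kmass_def using I[OF kernel_tail[OF assms]] I[OF k] by simp
  finally have "complex_of_real (real DIM('a) * kmass TYPE('a) (tail g) - 2 * kmass TYPE('a) (\<lambda>s. s * g s)) = 0"
    by (rule sym)
  then have "real DIM('a) * kmass TYPE('a) (tail g) - 2 * kmass TYPE('a) (\<lambda>s. s * g s) = 0"
    by (simp only: of_real_eq_0_iff)
  then show ?thesis by simp
qed

text \<open>High moments detect the supremum: if q exceeded some \<kappa> > r in absolute value near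
  a point of positive weight, the moments of order 2m would grow like \<kappa>^(2m), faster than
  r^(2m).\<close>

lemma pointwise_bound_of_moments:
  fixes p q :: "'a::euclidean_space \<Rightarrow> real"
  assumes "open S" "continuous_on S p" "continuous_on S q" "\<And>z. z \<in> S \<Longrightarrow> p z \<ge> 0"
    and int: "\<And>m. integrable (lebesgue_on S) (\<lambda>z. p z * q z ^ (2 * m))"
    and mom: "\<And>m. (LINT z|lebesgue_on S. p z * q z ^ (2 * m)) \<le> V * r ^ (2 * m)"
    and x: "x \<in> S" "p x > 0" and "r > 0"
  shows "\<bar>q x\<bar> \<le> r"
proof (rule ccontr)
  assume "\<not> \<bar>q x\<bar> \<le> r"
  then obtain \<kappa> where \<kappa>: "r < \<kappa>" "\<kappa> < \<bar>q x\<bar>" using dense by (metis not_le)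
  \<comment> \<open>A continuous substitute for the indicator of the set where q exceeds \<kappa>,
    so that \<open>continuous_AE_zero\<close> applies. The square is paid for by two powers of q,
    whence the moment of index \<open>Suc m\<close> below.\<close>
  define h where "h z = p z * (max 0 (\<bar>q z\<bar> - \<kappa>))\<^sup>2" for z
  have cont: "continuous_on S h" unfolding h_def[abs_def] using assms(2,3) by (intro continuous_intros)
  have h0: "h z \<ge> 0" if "z \<in> S" for z unfolding h_def using assms(4)[OF that] by simp
  have hb: "h z * \<kappa> ^ (2 * m) \<le> p z * q z ^ (2 * Suc m)" if z: "z \<in> S" for z m
  proof -
    have "(max 0 (\<bar>q z\<bar> - \<kappa>))\<^sup>2 * \<kappa> ^ (2 * m) \<le> \<bar>q z\<bar> ^ (2 * Suc m)"
    proof (cases "\<bar>q z\<bar> \<le> \<kappa>")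
      case False
      then have "(max 0 (\<bar>q z\<bar> - \<kappa>))\<^sup>2 * \<kappa> ^ (2 * m) \<le> \<bar>q z\<bar>\<^sup>2 * \<bar>q z\<bar> ^ (2 * m)"
        using \<kappa> \<open>r > 0\<close> by (intro mult_mono power_mono) auto
      also have "\<dots> = \<bar>q z\<bar> ^ (2 * Suc m)" by (simp only: mult_Suc_right power_add)
      finally show ?thesis .
    qed (simp add: max_def)
    then have "p z * ((max 0 (\<bar>q z\<bar> - \<kappa>))\<^sup>2 * \<kappa> ^ (2 * m)) \<le> p z * \<bar>q z\<bar> ^ (2 * Suc m)"
      using assms(4)[OF z] by (intro mult_left_mono)
    then show ?thesis by (simp add: h_def power_even_abs mult.assoc)
  qed
  have hint: "integrable (lebesgue_on S) h"
  proof (rule Bochner_Integration.integrable_bound[OF int[of 1]])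
    show "h \<in> borel_measurable (lebesgue_on S)"
      using assms(1) by (intro continuous_imp_measurable_on_sets_lebesgue cont) auto
    show "AE z in lebesgue_on S. norm (h z) \<le> norm (p z * q z ^ (2 * 1))"
    proof (rule AE_I2)
      fix z assume "z \<in> space (lebesgue_on S)"
      then have z: "z \<in> S" by simp
      show "norm (h z) \<le> norm (p z * q z ^ (2 * 1))" using hb[OF z, of 0] h0[OF z] by simp
    qed
  qed
  define e where "e = (LINT z|lebesgue_on S. h z)"
  have "e * \<kappa> ^ (2 * m) \<le> V * r ^ (2 * Suc m)" for m
  proof -
    have "e * \<kappa> ^ (2 * m) = (LINT z|lebesgue_on S. h z * \<kappa> ^ (2 * m))" by (simp add: e_def)
    also have "\<dots> \<le> (LINT z|lebesgue_on S. p z * q z ^ (2 * Suc m))"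
      by (rule integral_mono) (use hint int[of "Suc m"] hb in auto)
    also have "\<dots> \<le> V * r ^ (2 * Suc m)" by (rule mom)
    finally show ?thesis .
  qed
  then have "e \<le> V * r\<^sup>2 * ((r / \<kappa>)\<^sup>2) ^ m" for m
    using \<kappa> \<open>r > 0\<close> by (simp add: field_simps power_divide power_mult power2_eq_square)
  moreover have "(\<lambda>m. V * r\<^sup>2 * ((r / \<kappa>)\<^sup>2) ^ m) \<longlonglongrightarrow> V * r\<^sup>2 * 0"
    using \<kappa> \<open>r > 0\<close> by (intro tendsto_intros LIMSEQ_power_zero) (simp add: power_less_one_iff abs_square_less_1)
  ultimately have "e \<le> V * r\<^sup>2 * 0" by (intro LIMSEQ_le_const) auto
  then have "h x = 0"
    using continuous_AE_zero[OF assms(1) cont hint h0 _ x(1)] unfolding e_def by simp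
  then show False unfolding h_def using x(2) \<kappa> by auto
qed

text \<open>Integrates the radial equation for a power: (s/2) * a * s^k has antiderivative a / (2 *
  (k + 2)) * s^(k + 2), and the limit of the mean at radius 0 fixes the constant of
  integration.\<close>

lemma power_ball_law:
  assumes "kernel g" "open \<Omega>" "continuous_on \<Omega> u" "has_distr_laplacian \<Omega> u v" "cball y \<rho> \<subseteq> \<Omega>"
    and "\<And>r. 0 < r \<Longrightarrow> r < \<rho> \<Longrightarrow> kavg \<Omega> (tail g) v y r = complex_of_real (a * r ^ k) * z"
    and "0 < r" "r < \<rho>"
  shows "kavg \<Omega> g u (y::'a::euclidean_space) r = complex_of_real (kmass TYPE('a) g) * u y + complex_of_real (a / (2 * real (k + 2)) * r ^ (k + 2)) * z"
proof -
  have S: "\<Omega> \<in> sets lebesgue" using assms(2) by simp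
  have y: "y \<in> \<Omega>" using assms by auto
  have "kavg \<Omega> g u y r = complex_of_real (kmass TYPE('a) g) * u y + complex_of_real ((a / 2) / real (Suc (Suc k)) * r ^ Suc (Suc k)) * z"
  proof (rule power_law_of_derivative[OF _ kavg_tendsto[OF assms(2,3,1) y] assms(7,8)])
    fix s assume s: "0 < s" "s < \<rho>"
    have e: "complex_of_real (s / 2) * kavg \<Omega> (tail g) v y s = complex_of_real (a / 2 * s ^ Suc k) * z"
      unfolding assms(6)[OF s] by simp
    show "((\<lambda>r. kavg \<Omega> g u y r) has_vector_derivative complex_of_real (a / 2 * s ^ Suc k) * z) (at s)"
      using kavg_has_vector_derivative[OF S assms(3,4,1,5) s] unfolding e .
  qed
  then show ?thesis by (simp add: numeral_2_eq_2)
qed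

text \<open>The profile exp(-1 / (1 - s)) for s < 1, so that \<open>radial bump\<close> is the
  standard mollifier. The argument is written in the affine form expected by
  \<open>smooth_expinv\<close>.\<close>

definition bump :: "real \<Rightarrow> real" where
  "bump s = expinv 1 ((-1) * s + 1)"

lemma kernel_bump: "kernel bump"
proof -
  have "smooth bump" unfolding bump_def[abs_def] by (rule smooth_expinv)
  then show ?thesis unfolding kernel_def by (simp add: bump_def expinv_zero)
qed

lemma radial_bump_pos: "x \<in> ball y r \<Longrightarrow> r > 0 \<Longrightarrow> radial bump y r x > 0"
proof -
  assume "x \<in> ball y r" "r > 0"
  then have "(norm (x - y))\<^sup>2 < r\<^sup>2" by (intro power_strict_mono) (auto simp: dist_norm norm_minus_commute)
  then have "(norm (x - y))\<^sup>2 / r\<^sup>2 < 1" using \<open>r > 0\<close> by simp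
  then show ?thesis unfolding radial_def bump_def by (intro expinv_1_pos) simp
qed

lemma kmass_bump: "kmass TYPE('a::euclidean_space) bump \<noteq> 0"
proof
  assume "kmass TYPE('a) bump = 0"
  moreover have "(LINT x|lebesgue_on (ball 0 1). radial bump (0::'a) 1 x) = (LINT x|lebesgue. radial bump (0::'a) 1 x)"
    by (rule LINT_lebesgue_on_support) (use radial_zero[OF kernel_bump, of 1 _ 0] in auto)
  ultimately have L: "(LINT x|lebesgue_on (ball 0 1). radial bump (0::'a) 1 x) \<le> 0" by (simp add: kmass_def)
  obtain B where B: "\<And>s. s \<ge> 0 \<Longrightarrow> \<bar>bump s\<bar> \<le> B" using kernel_bounded[OF kernel_bump] by metis
  have "radial bump (0::'a) 1 0 = 0"
  proof (rule continuous_AE_zero[OF _ _ _ _ L])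
    show "integrable (lebesgue_on (ball 0 1)) (radial bump (0::'a) 1)"
    proof (rule integrable_lebesgue_on_continuous[where B=B])
      show "norm (radial bump (0::'a) 1 x) \<le> B" for x
        unfolding radial_def real_norm_def by (rule B) simp
    qed (auto intro!: kernel_continuous_on kernel_bump)
    show "radial bump (0::'a) 1 x \<ge> 0" if "x \<in> ball 0 1" for x
      using radial_bump_pos[OF that] by simp
  qed (auto intro!: kernel_continuous_on kernel_bump)
  then show False using radial_bump_pos[of "0::'a" 0 1] by simp
qed

text \<open>The centre of the kernel moves with velocity e. Showing that this derivative vanishes
  makes an integral against a bump constant along a segment; that is how local constancy of the
  weight and the contradiction at the boundary are reached.\<close>

lemma has_vector_derivative_LINT_translate:
  fixes p e :: "'a::euclidean_space" and u :: "'a \<Rightarrow> complex"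
  assumes g: "kernel g" and g': "kernel g'" "\<And>s. (g has_real_derivative g' s) (at s)"
    and u: "integrable (lebesgue_on S) u" and S: "bounded S" and r: "r > 0"
  shows "((\<lambda>t. LINT z|lebesgue_on S. u z * complex_of_real (radial g (p + t *\<^sub>R e) r z)) has_vector_derivative
    (LINT z|lebesgue_on S. u z * complex_of_real (radial g' (p + t *\<^sub>R e) r z * (- 2 * ((z - (p + t *\<^sub>R e)) \<bullet> e) / r\<^sup>2)))) (at t)"
proof -
  obtain B1 where B1: "B1 \<ge> 0" "\<And>s. s \<ge> 0 \<Longrightarrow> \<bar>g s\<bar> \<le> B1" using kernel_bounded[OF g] by metis
  obtain B2 where B2: "B2 \<ge> 0" "\<And>s. s \<ge> 0 \<Longrightarrow> \<bar>g' s\<bar> \<le> B2" using kernel_bounded[OF g'(1)] by metis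
  obtain D where D: "\<And>z. z \<in> S \<Longrightarrow> norm (z - p) \<le> D"
    using bounded_subset_ballD[OF S, of p] by (auto simp: subset_iff dist_norm norm_minus_commute intro: less_imp_le)
  define y where "y t = p + t *\<^sub>R e" for t
  \<comment> \<open>Bounds the distance from points of S to the moving centre for all parameters
    within 1 of t.\<close>
  define K where "K = D + (\<bar>t\<bar> + 1) * norm e"
  define B where "B = max B1 (B2 * (2 * (K * norm e) / r\<^sup>2))"
  have "((\<lambda>t. LINT z|lebesgue_on S. u z * complex_of_real (radial g (y t) r z)) has_vector_derivative
    (LINT z|lebesgue_on S. u z * complex_of_real (radial g' (y t) r z * (- 2 * ((z - y t) \<bullet> e) / r\<^sup>2)))) (at t)"
  proof (rule has_vector_derivative_LINT[where T="{t - 1<..<t + 1}" and B=B, OF u])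
    fix s z assume s: "s \<in> {t - 1<..<t + 1}" and "z \<in> space (lebesgue_on S)"
    then have z: "z \<in> S" by simp
    show "norm (complex_of_real (radial g (y s) r z)) \<le> B"
      unfolding radial_def norm_of_real B_def by (rule max.coboundedI1, rule B1(2)) simp
    have b2: "\<bar>radial g' (y s) r z\<bar> \<le> B2" unfolding radial_def by (rule B2(2)) simp
    have "norm (z - y s) \<le> norm (z - p) + norm (s *\<^sub>R e)"
      using norm_triangle_ineq4[of "z - p" "s *\<^sub>R e"] by (simp add: y_def diff_diff_eq)
    also have "norm (s *\<^sub>R e) \<le> (\<bar>t\<bar> + 1) * norm e"
      unfolding norm_scaleR using s by (intro mult_right_mono) auto
    finally have "norm (z - y s) \<le> K" using D[OF z] by (simp add: K_def)
    then have "\<bar>(z - y s) \<bullet> e\<bar> \<le> K * norm e"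
      using Cauchy_Schwarz_ineq2[of "z - y s" e] by (meson mult_right_mono norm_ge_zero order_trans)
    then have "\<bar>- 2 * ((z - y s) \<bullet> e) / r\<^sup>2\<bar> \<le> 2 * (K * norm e) / r\<^sup>2"
      by (simp add: abs_mult divide_right_mono)
    with b2 have "\<bar>radial g' (y s) r z\<bar> * \<bar>- 2 * ((z - y s) \<bullet> e) / r\<^sup>2\<bar> \<le> B2 * (2 * (K * norm e) / r\<^sup>2)"
      by (intro mult_mono B2(1)) auto
    then show "norm (complex_of_real (radial g' (y s) r z * (- 2 * ((z - y s) \<bullet> e) / r\<^sup>2))) \<le> B"
      unfolding norm_of_real abs_mult B_def by (rule max.coboundedI2)
    have "((\<lambda>t. (norm (z - y t))\<^sup>2 / r\<^sup>2) has_real_derivative (- 2 * ((z - y s) \<bullet> e) / r\<^sup>2)) (at s)"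
    proof -
      have "(norm (z - y t))\<^sup>2 / r\<^sup>2 = ((norm (z - p))\<^sup>2 - 2 * t * ((z - p) \<bullet> e) + t\<^sup>2 * (e \<bullet> e)) / r\<^sup>2" for t
        unfolding y_def power2_norm_eq_inner
        by (simp add: inner_diff_left inner_diff_right inner_add_left inner_add_right inner_commute power2_eq_square algebra_simps)
      moreover have "((\<lambda>t. ((norm (z - p))\<^sup>2 - 2 * t * ((z - p) \<bullet> e) + t\<^sup>2 * (e \<bullet> e)) / r\<^sup>2) has_real_derivative
          (- 2 * ((z - p) \<bullet> e) + 2 * s * (e \<bullet> e)) / r\<^sup>2) (at s)"
        unfolding divide_inverse by (auto intro!: derivative_eq_intros)
      moreover have "- 2 * ((z - p) \<bullet> e) + 2 * s * (e \<bullet> e) = - 2 * ((z - y s) \<bullet> e)"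
        by (simp add: y_def inner_diff_left inner_add_left)
      ultimately show ?thesis by (simp only:)
    qed
    from DERIV_chain2[OF g'(2) this]
    have "((\<lambda>t. radial g (y t) r z) has_real_derivative radial g' (y s) r z * (- 2 * ((z - y s) \<bullet> e) / r\<^sup>2)) (at s)"
      unfolding radial_def .
    then show "((\<lambda>t. complex_of_real (radial g (y t) r z)) has_vector_derivative
        complex_of_real (radial g' (y s) r z * (- 2 * ((z - y s) \<bullet> e) / r\<^sup>2))) (at s)"
      by (intro has_vector_derivative_of_real) (simp only: has_real_derivative_iff_has_vector_derivative)
  next
    fix s
    have c: "continuous_on UNIV (\<lambda>z. complex_of_real (radial g (y s) r z))"
      "continuous_on UNIV (\<lambda>z. complex_of_real (radial g' (y s) r z * (- 2 * ((z - y s) \<bullet> e) / r\<^sup>2)))"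
      by (intro continuous_intros kernel_continuous_on g g'(1), use r in auto)+
    show "(\<lambda>z. complex_of_real (radial g (y s) r z)) \<in> borel_measurable (lebesgue_on S)"
      "(\<lambda>z. complex_of_real (radial g' (y s) r z * (- 2 * ((z - y s) \<bullet> e) / r\<^sup>2))) \<in> borel_measurable (lebesgue_on S)"
      by (rule borel_measurable_lebesgue_onI[OF borel_measurable_continuous_onI[OF c(1)]],
          rule borel_measurable_lebesgue_onI[OF borel_measurable_continuous_onI[OF c(2)]])
  qed auto
  then show ?thesis unfolding y_def .
qed

text \<open>The situation on one small ball, where the cutoff that turns a ridge power into a test
  function is 1 along \<tau>. The free shift s lets the powers be centred at any point. For m = 0
  and m = 1 the exponent m - 2 is truncated to 0, but then the factor m * (m - 1) is 0.
  \<open>pos\<close> replaces positivity of the complex weight.\<close>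

locale intertwined =
  fixes \<Omega> :: "'a::euclidean_space set" and w :: "'a \<Rightarrow> complex" and \<tau> :: "'a \<Rightarrow> 'a"
  assumes open_dom: "open \<Omega>" and cont_w: "continuous_on \<Omega> w" and cont_\<tau>: "continuous_on \<Omega> \<tau>"
    and weak: "\<And>\<xi> s m. has_distr_laplacian \<Omega> (\<lambda>x. w x * complex_of_real ((\<xi> \<bullet> \<tau> x - s) ^ m))
      (\<lambda>x. complex_of_real (real (m * (m - 1)) * (\<xi> \<bullet> \<xi>)) * (w x * complex_of_real ((\<xi> \<bullet> \<tau> x - s) ^ (m - 2))))"
    and pos: "\<And>x y. x \<in> \<Omega> \<Longrightarrow> y \<in> \<Omega> \<Longrightarrow> Re (w x / w y) \<ge> 1/2"
begin

text \<open>If \<open>w x\<close> were 0, then \<open>w x / w x\<close> would be 0 as well, against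
  the lower bound 1/2.\<close>

lemma w_nonzero: "x \<in> \<Omega> \<Longrightarrow> w x \<noteq> 0"
  using pos[of x x] by auto

lemma cont_u: "continuous_on \<Omega> (\<lambda>x. w x * complex_of_real ((\<xi> \<bullet> \<tau> x - s) ^ m))"
  by (intro continuous_intros cont_w cont_\<tau>)

text \<open>For m at most 1 the Laplacian vanishes, so this is the mean value property of
  \<open>w\<close> and of \<open>w\<close> times an affine function of \<tau>.\<close>

lemma kavg_harmonic:
  assumes "kernel g" "cball y \<rho> \<subseteq> \<Omega>" "0 < r" "r < \<rho>" "m \<le> 1"
  shows "kavg \<Omega> g (\<lambda>x. w x * complex_of_real ((\<xi> \<bullet> \<tau> x - s) ^ m)) y r =
    complex_of_real (kmass TYPE('a) g) * (w y * complex_of_real ((\<xi> \<bullet> \<tau> y - s) ^ m))"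
proof -
  have mz: "real (m * (m - 1)) = 0" using assms(5) by auto
  have "kavg \<Omega> (tail g) (\<lambda>x. complex_of_real (real (m * (m - 1)) * (\<xi> \<bullet> \<xi>)) * (w x * complex_of_real ((\<xi> \<bullet> \<tau> x - s) ^ (m - 2)))) y r'
     = complex_of_real (0 * r' ^ 0) * 1" for r'
    unfolding mz by (simp add: kavg_def)
  from power_ball_law[OF assms(1) open_dom cont_u weak assms(2) this assms(3,4)] show ?thesis by simp
qed

lemma kavg_w:
  assumes "kernel g" "cball y \<rho> \<subseteq> \<Omega>" "0 < r" "r < \<rho>"
  shows "kavg \<Omega> g w y r = complex_of_real (kmass TYPE('a) g) * w y"
  using kavg_harmonic[OF assms, of 0] by simp

text \<open>Centring at \<tau> y removes the value at the centre, and the Laplacian is 2 * (\<xi>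
  \<bullet> \<xi>) times \<open>w\<close>, whose means are known from \<open>kavg_w\<close>; one
  integration of the radial equation finishes.\<close>

lemma kavg_square:
  assumes "kernel g" "cball y \<rho> \<subseteq> \<Omega>" "0 < r" "r < \<rho>"
  shows "kavg \<Omega> g (\<lambda>x. w x * complex_of_real ((\<xi> \<bullet> \<tau> x - \<xi> \<bullet> \<tau> y)\<^sup>2)) y r =
    complex_of_real ((\<xi> \<bullet> \<xi>) * kmass TYPE('a) (tail g) / 2 * r\<^sup>2) * w y"
proof -
  have "kavg \<Omega> (tail g) (\<lambda>x. complex_of_real (real (2 * (2 - 1)) * (\<xi> \<bullet> \<xi>)) * (w x * complex_of_real ((\<xi> \<bullet> \<tau> x - \<xi> \<bullet> \<tau> y) ^ (2 - 2)))) y s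
     = complex_of_real ((2 * (\<xi> \<bullet> \<xi>) * kmass TYPE('a) (tail g)) * s ^ 0) * w y" if "0 < s" "s < \<rho>" for s
    unfolding kavg_cmult using kavg_w[OF kernel_tail[OF assms(1)] assms(2) that] by simp
  from power_ball_law[OF assms(1) open_dom cont_u weak assms(2) this assms(3,4)] show ?thesis by (simp add: power2_eq_square)
qed

text \<open>Each integration of the radial equation replaces \<open>g\<close> by its tail. Starting from
  \<open>\<bar>g s\<bar> \<le> B * (1 - s) ^ j\<close>, the factorials gained by iterated tails outweigh those produced by
  differentiating the even powers, so the moments grow no faster than \<open>r ^ (2 * m)\<close>.\<close>

lemma kavg_even_moment:
  assumes "kernel g" "0 \<le> B" "\<And>s. s \<in> {0..1} \<Longrightarrow> \<bar>g s\<bar> \<le> B * (1 - s) ^ j" "\<xi> \<bullet> \<xi> = 1" "y \<in> \<Omega>"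
  shows "\<exists>c. \<bar>c\<bar> \<le> B * measure lborel (ball (0::'a) 1) * (fact m * fact j / fact (m + j)) \<and>
    (\<forall>\<rho> r. cball y \<rho> \<subseteq> \<Omega> \<and> 0 < r \<and> r < \<rho> \<longrightarrow>
      kavg \<Omega> g (\<lambda>x. w x * complex_of_real ((\<xi> \<bullet> \<tau> x - \<xi> \<bullet> \<tau> y) ^ (2 * m))) y r = complex_of_real (c * r ^ (2 * m)) * w y)"
  using assms(1-3)
proof (induction m arbitrary: g B j)
  case 0
  let ?V = "measure lborel (ball (0::'a) 1)"
  have "\<bar>kmass TYPE('a) g\<bar> \<le> B * ?V"
  proof -
    have "norm (kavg UNIV g (\<lambda>_. 1) (0::'a) 1) \<le> 1 * B * ?V"
    proof (rule kavg_bound)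
      show "\<bar>g s\<bar> \<le> B" if "s \<in> {0..1}" for s
      proof -
        have "B * (1 - s) ^ j \<le> B * 1" using that 0(2) by (intro mult_left_mono power_le_one) auto
        then show ?thesis using 0(3)[OF that] by simp
      qed
    qed (use 0 in auto)
    then show ?thesis by (subst (asm) kavg_one) (use 0 in auto)
  qed
  then show ?case
    by (intro exI[of _ "kmass TYPE('a) g"] conjI allI impI) (use kavg_w[OF 0(1)] in auto)
next
  case (Suc m)
  let ?V = "measure lborel (ball (0::'a) 1)"
  \<comment> \<open>The induction hypothesis is used for \<open>tail g\<close>, with the constant
    and the order of vanishing that \<open>tail_bound\<close> provides; hence the generalisation
    over g, B and j.\<close>
  have B: "0 \<le> B / real (Suc j)" using Suc.prems by simp
  have tb: "\<bar>tail g s\<bar> \<le> B / real (Suc j) * (1 - s) ^ Suc j" if "s \<in> {0..1}" for s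
    by (rule tail_bound[OF Suc.prems(1) Suc.prems(3) that])
  obtain c where c: "\<bar>c\<bar> \<le> B / real (Suc j) * ?V * (fact m * fact (Suc j) / fact (m + Suc j))"
    and eq: "\<forall>\<rho> r. cball y \<rho> \<subseteq> \<Omega> \<and> 0 < r \<and> r < \<rho> \<longrightarrow>
      kavg \<Omega> (tail g) (\<lambda>x. w x * complex_of_real ((\<xi> \<bullet> \<tau> x - \<xi> \<bullet> \<tau> y) ^ (2 * m))) y r = complex_of_real (c * r ^ (2 * m)) * w y"
    by (rule exE[OF Suc.IH[OF kernel_tail[OF Suc.prems(1)] B tb]], assumption, elim conjE, rule that)
  \<comment> \<open>The Laplacian contributes (2m + 2) * (2m + 1), and integrating the radial
    equation divides by 2 * (2m + 2). The resulting factor (2m + 1) / 2 is at most m + 1, just what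
    turns \<open>fact m\<close> into \<open>fact (Suc m)\<close>.\<close>
  define c' where "c' = (2 * real m + 1) / 2 * c"
  show ?case
  proof (intro exI[of _ c'] conjI allI impI)
    have "\<bar>c'\<bar> = (2 * real m + 1) / 2 * \<bar>c\<bar>" by (simp add: c'_def abs_mult)
    also have "\<dots> \<le> real (Suc m) * (B / real (Suc j) * ?V * (fact m * fact (Suc j) / fact (m + Suc j)))"
      by (rule mult_mono[OF _ c]) auto
    also have "\<dots> = B * ?V * (fact (Suc m) * fact j / fact (Suc m + j))"
    proof -
      have "M * (B / S * ?V * (x * (S * y) / F)) = B * ?V * (M * x * y / F)" if "S \<noteq> 0" for M S x y F
        using that by simp
      from this[of "real (Suc j)" "real (Suc m)" "fact m" "fact j" "fact (Suc (m + j))"]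
      show ?thesis by (simp only: fact_Suc[of j] fact_Suc[of m] add_Suc_right add_Suc of_nat_0_neq not_False_eq_True simp_thms of_nat_eq_0_iff nat.distinct)
    qed
    finally show "\<bar>c'\<bar> \<le> B * ?V * (fact (Suc m) * fact j / fact (Suc m + j))" .
  next
    fix \<rho> r assume r: "cball y \<rho> \<subseteq> \<Omega> \<and> 0 < r \<and> r < \<rho>"
    define a where "a = real (2 * Suc m * (2 * Suc m - 1)) * c"
    have K: "kavg \<Omega> (tail g) (\<lambda>x. complex_of_real (real (2 * Suc m * (2 * Suc m - 1)) * (\<xi> \<bullet> \<xi>)) *
        (w x * complex_of_real ((\<xi> \<bullet> \<tau> x - \<xi> \<bullet> \<tau> y) ^ (2 * Suc m - 2)))) y s = complex_of_real (a * s ^ (2 * m)) * w y"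
      if "0 < s" "s < \<rho>" for s
      unfolding kavg_cmult using eq[rule_format, of \<rho> s] r that assms(4) by (simp add: a_def mult.assoc)
    from r have r': "cball y \<rho> \<subseteq> \<Omega>" "0 < r" "r < \<rho>" by auto
    from power_ball_law[OF Suc.prems(1) open_dom cont_u weak r'(1) K r'(2,3)]
    have K1: "kavg \<Omega> g (\<lambda>x. w x * complex_of_real ((\<xi> \<bullet> \<tau> x - \<xi> \<bullet> \<tau> y) ^ (2 * Suc m))) y r =
      complex_of_real (a / (2 * real (2 * m + 2)) * r ^ (2 * m + 2)) * w y"
      by (simp del: power_Suc)
    have ac: "a / (2 * real (2 * m + 2)) = c'"
      unfolding a_def c'_def by (simp add: field_simps)
    have e2: "2 * m + 2 = 2 * Suc m" by simp
    show "kavg \<Omega> g (\<lambda>x. w x * complex_of_real ((\<xi> \<bullet> \<tau> x - \<xi> \<bullet> \<tau> y) ^ (2 * Suc m))) y r = complex_of_real (c' * r ^ (2 * Suc m)) * w y"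
      using K1 unfolding ac unfolding e2 .
  qed
qed

text \<open>Dividing by \<open>w y\<close> and taking real parts turns a complex mean into an
  integral against a real weight, which \<open>pos\<close> makes positive for the bump.\<close>

lemma Re_kavg:
  fixes p :: "'a \<Rightarrow> real"
  assumes "kernel g" "cball y r \<subseteq> \<Omega>" "r > 0" "continuous_on \<Omega> p"
  shows "integrable (lebesgue_on (ball y r)) (\<lambda>x. Re (w x / w y) * (radial g y r x / r ^ DIM('a)) * p x)"
    and "(LINT x|lebesgue_on (ball y r). Re (w x / w y) * (radial g y r x / r ^ DIM('a)) * p x) =
      Re (kavg \<Omega> g (\<lambda>x. w x * complex_of_real (p x)) y r / w y)"
proof -
  let ?u = "\<lambda>x. w x * complex_of_real (p x)"
  let ?f = "\<lambda>x. ?u x * complex_of_real (radial g y r x / r ^ DIM('a))"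
  have S: "\<Omega> \<in> sets lebesgue" using open_dom by simp
  have "continuous_on \<Omega> ?u" using assms(4) by (intro continuous_intros cont_w)
  then have "continuous_on (cball y r) ?u" using assms(2) by (rule continuous_on_subset)
  from kavg_integrable[OF S this assms(2,1,3)]
  have "integrable (lebesgue_on (ball y r)) ?f"
    by (rule integrable_lebesgue_on_subset) (use assms ball_subset_cball S in auto)
  then have I: "integrable (lebesgue_on (ball y r)) (\<lambda>x. ?f x / w y)"
    unfolding divide_inverse by (rule integrable_mult_left)
  have eq: "Re (?f x / w y) = Re (w x / w y) * (radial g y r x / r ^ DIM('a)) * p x" for x
  proof -
    have "?f x / w y = complex_of_real (radial g y r x / r ^ DIM('a) * p x) * (w x / w y)" by simp
    moreover have "Re (complex_of_real a * z) = a * Re z" for a z by simp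
    ultimately have "Re (?f x / w y) = (radial g y r x / r ^ DIM('a) * p x) * Re (w x / w y)"
      by (simp only:)
    then show ?thesis by simp
  qed
  show "integrable (lebesgue_on (ball y r)) (\<lambda>x. Re (w x / w y) * (radial g y r x / r ^ DIM('a)) * p x)"
    using integrable_Re[OF I] unfolding eq .
  have "(LINT x|lebesgue_on (ball y r). Re (?f x / w y)) = Re (LINT x|lebesgue_on (ball y r). ?f x / w y)"
    by (rule integral_Re[OF I])
  also have "(LINT x|lebesgue_on (ball y r). ?f x / w y) = kavg (ball y r) g ?u y r / w y"
    unfolding kavg_def by (rule integral_divide_zero)
  also have "kavg (ball y r) g ?u y r = kavg \<Omega> g ?u y r"
    by (rule kavg_ball[symmetric]) (use assms S ball_subset_cball in auto)
  finally show "(LINT x|lebesgue_on (ball y r). Re (w x / w y) * (radial g y r x / r ^ DIM('a)) * p x) =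
      Re (kavg \<Omega> g ?u y r / w y)" unfolding eq .
qed

lemma weight_pos:
  assumes "cball y r \<subseteq> \<Omega>" "r > 0" "x \<in> ball y r"
  shows "Re (w x / w y) * (radial bump y r x / r ^ DIM('a)) > 0"
proof -
  have "x \<in> \<Omega>" "y \<in> \<Omega>" using assms ball_subset_cball by auto
  from pos[OF this] show ?thesis
    using radial_bump_pos[OF assms(3,2)] assms(2) by (intro mult_pos_pos divide_pos_pos) auto
qed

lemma continuous_on_weight:
  assumes "cball y r \<subseteq> \<Omega>" "r > 0"
  shows "continuous_on (ball y r) (\<lambda>x. Re (w x / w y) * (radial bump y r x / r ^ DIM('a)))"
proof -
  have "ball y r \<subseteq> \<Omega>" using assms(1) ball_subset_cball by blast
  then have "continuous_on (ball y r) w" "y \<in> \<Omega>"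
    using continuous_on_subset[OF cont_w] assms(2) by auto
  then show ?thesis using w_nonzero[of y] assms(2)
    by (intro continuous_intros kernel_continuous_on kernel_bump) auto
qed

text \<open>If \<tau> stretched the pair, choose r strictly between the two distances and \<xi> as
  the unit vector along \<tau> x - \<tau> y. The even moments of the \<xi>-component over the ball
  of radius r grow at most like r^(2m), so this component is bounded by r at x, although it equals
  the larger distance.\<close>

lemma contraction:
  assumes "cball y \<rho> \<subseteq> \<Omega>" "x \<in> ball y \<rho>"
  shows "norm (\<tau> x - \<tau> y) \<le> norm (x - y)"
proof (rule ccontr)
  assume "\<not> norm (\<tau> x - \<tau> y) \<le> norm (x - y)"
  moreover have "norm (x - y) < \<rho>" using assms(2) by (simp add: dist_norm norm_minus_commute)
  ultimately obtain r where r: "norm (x - y) < r" "r < min \<rho> (norm (\<tau> x - \<tau> y))"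
    using dense[of "norm (x - y)" "min \<rho> (norm (\<tau> x - \<tau> y))"] by auto
  have r0: "r > 0" using r(1) norm_ge_zero[of "x - y"] by linarith
  have sub: "cball y r \<subseteq> \<Omega>" using assms(1) r(2) by auto
  have y: "y \<in> \<Omega>" using sub r0 by auto
  define \<xi> where "\<xi> = (1 / norm (\<tau> x - \<tau> y)) *\<^sub>R (\<tau> x - \<tau> y)"
  have ne: "norm (\<tau> x - \<tau> y) > 0" using r r0 by auto
  have "norm \<xi> = 1" using ne by (simp add: \<xi>_def)
  then have \<xi>1: "\<xi> \<bullet> \<xi> = 1" by (simp flip: power2_norm_eq_inner)
  have "\<xi> \<bullet> \<tau> x - \<xi> \<bullet> \<tau> y = \<xi> \<bullet> (\<tau> x - \<tau> y)" by (simp add: inner_diff_right)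
  also have "\<dots> = norm (\<tau> x - \<tau> y)"
    unfolding \<xi>_def inner_scaleR_left power2_norm_eq_inner[symmetric] using ne by (simp add: power2_eq_square)
  finally have \<xi>: "\<xi> \<bullet> \<xi> = 1" "\<xi> \<bullet> \<tau> x - \<xi> \<bullet> \<tau> y = norm (\<tau> x - \<tau> y)" using \<xi>1 by auto
  let ?q = "\<lambda>z. \<xi> \<bullet> \<tau> z - \<xi> \<bullet> \<tau> y"
  let ?V = "measure lborel (ball (0::'a) 1)"
  \<comment> \<open>With B = 1 and j = 0 the quotient of factorials in the moment bound is 1, so the
    constant does not depend on m.\<close>
  have "\<bar>bump s\<bar> \<le> 1 * (1 - s) ^ 0" for s
    unfolding bump_def using expinv_1_nonneg expinv_1_le by auto
  note mom = kavg_even_moment[OF kernel_bump _ this \<xi>(1) y]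
  have cq: "continuous_on \<Omega> ?q" by (intro continuous_intros cont_\<tau>)
  have "\<bar>?q x\<bar> \<le> r"
  proof (rule pointwise_bound_of_moments[where S="ball y r" and V="?V" and q="?q" and x=x
      and p="\<lambda>x. Re (w x / w y) * (radial bump y r x / r ^ DIM('a))"])
    show "continuous_on (ball y r) (\<lambda>x. Re (w x / w y) * (radial bump y r x / r ^ DIM('a)))"
      by (rule continuous_on_weight[OF sub r0])
    show "continuous_on (ball y r) ?q"
      using continuous_on_subset[OF cq] sub ball_subset_cball[of y r] by blast
    show "Re (w z / w y) * (radial bump y r z / r ^ DIM('a)) \<ge> 0" if "z \<in> ball y r" for z
      using weight_pos[OF sub r0 that] by simp
    show "Re (w x / w y) * (radial bump y r x / r ^ DIM('a)) > 0"
      by (rule weight_pos[OF sub r0]) (use r in \<open>simp add: dist_norm norm_minus_commute\<close>)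
    fix m
    have cp: "continuous_on \<Omega> (\<lambda>z. ?q z ^ (2 * m))" by (intro continuous_intros cq)
    show "integrable (lebesgue_on (ball y r)) (\<lambda>z. Re (w z / w y) * (radial bump y r z / r ^ DIM('a)) * ?q z ^ (2 * m))"
      by (rule Re_kavg[OF kernel_bump sub r0 cp])
    obtain c where c: "\<bar>c\<bar> \<le> 1 * ?V * (fact m * fact 0 / fact (m + 0))"
      "kavg \<Omega> bump (\<lambda>x. w x * complex_of_real (?q x ^ (2 * m))) y r = complex_of_real (c * r ^ (2 * m)) * w y"
      using mom[of m] assms(1) r0 r(2) by auto
    have "Re (kavg \<Omega> bump (\<lambda>x. w x * complex_of_real (?q x ^ (2 * m))) y r / w y) = c * r ^ (2 * m)"
      unfolding c(2) using w_nonzero[OF y] by simp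
    also have "\<dots> \<le> ?V * r ^ (2 * m)" using c(1) by (intro mult_right_mono) auto
    finally show "(LINT z|lebesgue_on (ball y r). Re (w z / w y) * (radial bump y r z / r ^ DIM('a)) * ?q z ^ (2 * m)) \<le> ?V * r ^ (2 * m)"
      unfolding Re_kavg(2)[OF kernel_bump sub r0 cp] .
  qed (use r r0 in \<open>auto simp: dist_norm norm_minus_commute\<close>)
  then show False using \<xi>(2) r(2) by simp
qed

text \<open>The second moments of \<open>\<tau>\<close> and of the identity agree, so the contraction is an isometry.\<close>

lemma isometry:
  assumes "cball y \<rho> \<subseteq> \<Omega>" "x \<in> ball y \<rho>"
  shows "norm (\<tau> x - \<tau> y) = norm (x - y)"
proof -
  have "norm (x - y) < \<rho>" using assms(2) by (simp add: dist_norm norm_minus_commute)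
  then obtain r where r: "norm (x - y) < r" "r < \<rho>" using dense by blast
  have r0: "r > 0" using r(1) norm_ge_zero[of "x - y"] by linarith
  have sub: "cball y r \<subseteq> \<Omega>" using assms(1) r(2) by auto
  have y: "y \<in> \<Omega>" using sub r0 by auto
  have S: "\<Omega> \<in> sets lebesgue" using open_dom by simp
  let ?W = "\<lambda>z. Re (w z / w y) * (radial bump y r z / r ^ DIM('a))"
  \<comment> \<open>Second moments are known for one direction at a time; summing over an
    orthonormal basis gives the moment of the full squared distance between \<tau> z and \<tau>
    y.\<close>
  define p where "p b z = (b \<bullet> \<tau> z - b \<bullet> \<tau> y)\<^sup>2" for b z
  have cp: "continuous_on \<Omega> (p b)" for b
    unfolding p_def[abs_def] by (intro continuous_intros cont_\<tau>)
  have p_sum: "(\<Sum>b\<in>Basis. p b z) = (norm (\<tau> z - \<tau> y))\<^sup>2" for z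
    unfolding norm_sq_eq_sum_Basis p_def by (intro sum.cong refl) (metis inner_commute inner_diff_left)
  have I1: "integrable (lebesgue_on (ball y r)) (\<lambda>z. ?W z * p b z)" for b
    by (rule Re_kavg(1)[OF kernel_bump sub r0 cp])
  have Lb: "(LINT z|lebesgue_on (ball y r). ?W z * p b z) = kmass TYPE('a) (tail bump) / 2 * r\<^sup>2" if "b \<in> Basis" for b
    unfolding Re_kavg(2)[OF kernel_bump sub r0 cp] unfolding p_def kavg_square[OF kernel_bump assms(1) r0 r(2)]
    using that w_nonzero[OF y] by simp
  have "(\<Sum>b\<in>Basis. LINT z|lebesgue_on (ball y r). ?W z * p b z) = (\<Sum>b::'a\<in>Basis. kmass TYPE('a) (tail bump) / 2 * r\<^sup>2)"
    by (intro sum.cong refl Lb)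
  then have "(\<Sum>b\<in>Basis. LINT z|lebesgue_on (ball y r). ?W z * p b z) = real DIM('a) / 2 * kmass TYPE('a) (tail bump) * r\<^sup>2"
    unfolding sum_constant by (rule trans) simp
  moreover have W_sum: "?W z * (norm (\<tau> z - \<tau> y))\<^sup>2 = (\<Sum>b\<in>Basis. ?W z * p b z)" for z
    by (simp only: p_sum[symmetric] sum_distrib_left)
  ultimately have L1: "(LINT z|lebesgue_on (ball y r). ?W z * (norm (\<tau> z - \<tau> y))\<^sup>2) = real DIM('a) / 2 * kmass TYPE('a) (tail bump) * r\<^sup>2"
    by (simp only: W_sum Bochner_Integration.integral_sum[OF I1])
  have J1: "integrable (lebesgue_on (ball y r)) (\<lambda>z. ?W z * (norm (\<tau> z - \<tau> y))\<^sup>2)"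
    unfolding W_sum by (rule Bochner_Integration.integrable_sum[OF I1])
  \<comment> \<open>With this profile, r^2 times the mean of \<open>w\<close> is the second moment
    of the identity map under the same weight, and \<open>kmass_id_times\<close> evaluates it to the
    value found for \<tau>.\<close>
  define g where "g s = s * bump s" for s
  have kg: "kernel g"
    using kernel_bump smooth_mult[OF smooth_id, of bump] unfolding kernel_def g_def[abs_def] by auto
  have rg: "radial g y r z * r\<^sup>2 = (norm (z - y))\<^sup>2 * radial bump y r z" for z
    using r0 by (simp add: radial_def g_def)
  have c1: "continuous_on \<Omega> (\<lambda>_. 1 :: real)" by simp
  have Wg: "?W z * (norm (z - y))\<^sup>2 = (Re (w z / w y) * (radial g y r z / r ^ DIM('a)) * 1) * r\<^sup>2" for z
    using rg[of z] by (simp add: mult_ac)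
  have J2: "integrable (lebesgue_on (ball y r)) (\<lambda>z. ?W z * (norm (z - y))\<^sup>2)"
    unfolding Wg using Re_kavg(1)[OF kg sub r0 c1] by (rule integrable_mult_left)
  have "(LINT z|lebesgue_on (ball y r). ?W z * (norm (z - y))\<^sup>2) =
    (LINT z|lebesgue_on (ball y r). Re (w z / w y) * (radial g y r z / r ^ DIM('a)) * 1) * r\<^sup>2"
    unfolding Wg by (rule integral_mult_left_zero)
  also have "\<dots> = Re (kavg \<Omega> g (\<lambda>x. w x * complex_of_real 1) y r / w y) * r\<^sup>2"
    by (simp only: Re_kavg(2)[OF kg sub r0 c1])
  also have "(\<lambda>x. w x * complex_of_real 1) = w" by simp
  finally have "(LINT z|lebesgue_on (ball y r). ?W z * (norm (z - y))\<^sup>2) = Re (kavg \<Omega> g w y r / w y) * r\<^sup>2" .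
  also have "\<dots> = kmass TYPE('a) g * r\<^sup>2"
    unfolding kavg_w[OF kg assms(1) r0 r(2)] using w_nonzero[OF y] by simp
  also have "kmass TYPE('a) g = real DIM('a) / 2 * kmass TYPE('a) (tail bump)"
    unfolding g_def[abs_def] by (rule kmass_id_times[OF kernel_bump])
  finally have L2: "(LINT z|lebesgue_on (ball y r). ?W z * (norm (z - y))\<^sup>2) = real DIM('a) / 2 * kmass TYPE('a) (tail bump) * r\<^sup>2" .
  have cancel: "a * b = 0 \<Longrightarrow> a > 0 \<Longrightarrow> b = 0" for a b :: real by simp
  \<comment> \<open>By \<open>contraction\<close> the integrand is nonnegative, and its integral is
    the difference of two equal second moments.\<close>
  have "?W x * ((norm (x - y))\<^sup>2 - (norm (\<tau> x - \<tau> y))\<^sup>2) = 0"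
  proof (rule continuous_AE_zero[of "ball y r" "\<lambda>x. ?W x * ((norm (x - y))\<^sup>2 - (norm (\<tau> x - \<tau> y))\<^sup>2)"])
    have "continuous_on (ball y r) \<tau>" using continuous_on_subset[OF cont_\<tau>] sub ball_subset_cball[of y r] by blast
    then show "continuous_on (ball y r) (\<lambda>x. ?W x * ((norm (x - y))\<^sup>2 - (norm (\<tau> x - \<tau> y))\<^sup>2))"
      by (intro continuous_intros continuous_on_weight[OF sub r0])
    show "integrable (lebesgue_on (ball y r)) (\<lambda>x. ?W x * ((norm (x - y))\<^sup>2 - (norm (\<tau> x - \<tau> y))\<^sup>2))"
      unfolding right_diff_distrib by (rule Bochner_Integration.integrable_diff[OF J2 J1])
    show "(LINT x|lebesgue_on (ball y r). ?W x * ((norm (x - y))\<^sup>2 - (norm (\<tau> x - \<tau> y))\<^sup>2)) \<le> 0"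
      unfolding right_diff_distrib Bochner_Integration.integral_diff[OF J2 J1] L1 L2 by simp
    show "?W z * ((norm (z - y))\<^sup>2 - (norm (\<tau> z - \<tau> y))\<^sup>2) \<ge> 0" if z: "z \<in> ball y r" for z
    proof -
      have "norm (\<tau> z - \<tau> y) \<le> norm (z - y)" using contraction[OF assms(1)] z r(2) by auto
      then have "(norm (\<tau> z - \<tau> y))\<^sup>2 \<le> (norm (z - y))\<^sup>2" by (intro power_mono) auto
      moreover have "0 \<le> ?W z" using weight_pos[OF sub r0 z] by (rule less_imp_le)
      ultimately show ?thesis by (intro mult_nonneg_nonneg[of "?W z"]) auto
    qed
    show "x \<in> ball y r" using r(1) by (simp add: dist_norm norm_minus_commute)
  qed auto
  moreover have "?W x > 0"
    by (rule weight_pos[OF sub r0]) (use r(1) in \<open>simp add: dist_norm norm_minus_commute\<close>)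
  ultimately have "(norm (x - y))\<^sup>2 - (norm (\<tau> x - \<tau> y))\<^sup>2 = 0" by (rule cancel)
  then show ?thesis by (simp add: power2_eq_iff_nonneg)
qed

text \<open>The mean of \<open>w\<close> around y is a fixed multiple of \<open>w y\<close>. Moving
  the centre along e, the derivative of this mean is a first moment of \<open>w\<close> in the
  direction e. Because \<tau> is isometric, the e-component of z - y is a component of \<tau> z -
  \<tau> y, and its weighted mean is 0 by the mean value property for m = 1.\<close>

lemma w_constant:
  assumes iso: "\<And>x y. x \<in> ball p s \<Longrightarrow> y \<in> ball p s \<Longrightarrow> norm (\<tau> x - \<tau> y) = norm (x - y)"
    and sub: "cball p s \<subseteq> \<Omega>" and x: "x \<in> ball p s"
  shows "w x = w p"
proof (cases "x = p")
  case False
  define e where "e = x - p"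
  have e: "norm e > 0" "norm e < s" using False x by (auto simp: e_def dist_norm norm_minus_commute)
  \<comment> \<open>One third of the remaining margin: balls of radius 2 * r, which the mean value
    property needs around means of radius r, stay inside along the whole segment. The parameter
    range extends beyond 1, to k, so that 0 and 1 are interior.\<close>
  define r where "r = (s - norm e) / 3"
  have r: "r > 0" "2 * r + norm e < s" using e by (auto simp: r_def field_simps)
  define k where "k = (s - 2 * r) / norm e"
  have k: "k > 1" "k * norm e = s - 2 * r" using e r by (auto simp: k_def field_simps)
  define y where "y t = p + t *\<^sub>R e" for t
  have y: "cball (y t) (2 * r) \<subseteq> ball p s" if "t \<in> {-k<..<k}" for t
  proof
    fix z assume "z \<in> cball (y t) (2 * r)"
    then have "norm (z - y t) \<le> 2 * r" by (simp add: dist_norm norm_minus_commute)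
    moreover have "norm (t *\<^sub>R e) < s - 2 * r"
    proof -
      have "\<bar>t\<bar> * norm e < k * norm e" using that e(1) by (intro mult_strict_right_mono) auto
      then show ?thesis using k by simp
    qed
    moreover have "norm (z - p) \<le> norm (z - y t) + norm (t *\<^sub>R e)"
      using norm_triangle_ineq[of "z - y t" "t *\<^sub>R e"] by (simp add: y_def)
    ultimately show "z \<in> ball p s" by (simp add: dist_norm norm_minus_commute)
  qed
  have yb: "y t \<in> ball p s" if "t \<in> {-k<..<k}" for t
    using y[OF that] r(1) by (meson centre_in_cball less_imp_le mult_pos_pos subsetD zero_less_numeral)
  have sub': "ball p s \<subseteq> \<Omega>" using sub ball_subset_cball by blast
  have S: "\<Omega> \<in> sets lebesgue" using open_dom by simp
  obtain g' where g': "kernel g'" "\<And>s. (bump has_real_derivative g' s) (at s)"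
    using kernel_deriv[OF kernel_bump] by metis
  define \<xi> where "\<xi> = \<tau> x - \<tau> p"
  \<comment> \<open>The inner product of two differences is a combination of four squared distances,
    so preservation of distances carries over to it.\<close>
  have polar: "\<xi> \<bullet> \<tau> z - \<xi> \<bullet> \<tau> y' = (z - y') \<bullet> e" if "z \<in> ball p s" "y' \<in> ball p s" for z y'
  proof -
    have id: "2 * ((a - b) \<bullet> (c - d)) = (norm (a - d))\<^sup>2 + (norm (b - c))\<^sup>2 - (norm (a - c))\<^sup>2 - (norm (b - d))\<^sup>2" for a b c d :: 'a
      by (simp add: power2_norm_eq_inner inner_diff_left inner_diff_right inner_commute)
    have p: "p \<in> ball p s" using less_trans[OF e] by simp
    have "2 * ((\<tau> z - \<tau> y') \<bullet> (\<tau> x - \<tau> p)) = 2 * ((z - y') \<bullet> (x - p))"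
      unfolding id using iso that x p by simp
    then show ?thesis by (simp add: \<xi>_def e_def inner_diff_left inner_diff_right inner_commute)
  qed
  define M where "M = lebesgue_on (ball p s)"
  have u_int: "integrable M w"
  proof -
    have cu: "continuous_on (cball p s) w" using cont_w sub by (rule continuous_on_subset)
    then have "compact (w ` cball p s)" by (intro compact_continuous_image) auto
    then obtain C where "\<forall>x\<in>cball p s. norm (w x) \<le> C" by (auto dest!: compact_imp_bounded simp: bounded_iff)
    then show ?thesis unfolding M_def
      by (intro integrable_lebesgue_on_continuous[of _ _ C] continuous_on_subset[OF cu]) (auto simp: ball_subset_cball)
  qed
  let ?d = "DIM('a)"
  have loc: "kavg (ball p s) g u (y t) r = kavg \<Omega> g u (y t) r" if "kernel g" "t \<in> {-k<..<k}" for g u t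
  proof -
    have "ball (y t) r \<subseteq> ball p s" using y[OF that(2)] r(1) by force
    then show ?thesis
      using kavg_ball[OF _ _ that(1) r(1) order_refl, of "ball p s" "y t" u] kavg_ball[OF S _ that(1) r(1) order_refl, of "y t" u]
        sub' by auto
  qed
  define F where "F t = (LINT z|M. w z * complex_of_real (radial bump (y t) r z))" for t
  have "(F has_vector_derivative 0) (at t)" if t: "t \<in> {-k<..<k}" for t
  proof -
    have "(F has_vector_derivative (LINT z|M. w z * complex_of_real (radial g' (y t) r z * (- 2 * ((z - y t) \<bullet> e) / r\<^sup>2)))) (at t)"
      unfolding F_def[abs_def] M_def y_def
      by (rule has_vector_derivative_LINT_translate[OF kernel_bump g' u_int[unfolded M_def] _ r(1)]) auto
    also have "(LINT z|M. w z * complex_of_real (radial g' (y t) r z * (- 2 * ((z - y t) \<bullet> e) / r\<^sup>2))) =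
      (LINT z|M. complex_of_real (- 2 / r\<^sup>2 * r ^ ?d) *
        (w z * complex_of_real ((\<xi> \<bullet> \<tau> z - \<xi> \<bullet> \<tau> (y t)) ^ 1) * complex_of_real (radial g' (y t) r z / r ^ ?d)))"
    proof (rule Bochner_Integration.integral_cong)
      fix z assume "z \<in> space M"
      then have z: "z \<in> ball p s" by (simp add: M_def)
      show "w z * complex_of_real (radial g' (y t) r z * (- 2 * ((z - y t) \<bullet> e) / r\<^sup>2)) = complex_of_real (- 2 / r\<^sup>2 * r ^ ?d) *
        (w z * complex_of_real ((\<xi> \<bullet> \<tau> z - \<xi> \<bullet> \<tau> (y t)) ^ 1) * complex_of_real (radial g' (y t) r z / r ^ ?d))"
        unfolding polar[OF z yb[OF t]] using r(1) by simp
    qed simp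
    also have "\<dots> = complex_of_real (- 2 / r\<^sup>2 * r ^ ?d) *
        kavg (ball p s) g' (\<lambda>z. w z * complex_of_real ((\<xi> \<bullet> \<tau> z - \<xi> \<bullet> \<tau> (y t)) ^ 1)) (y t) r"
      unfolding kavg_def M_def by (rule integral_mult_right_zero)
    also have "kavg (ball p s) g' (\<lambda>z. w z * complex_of_real ((\<xi> \<bullet> \<tau> z - \<xi> \<bullet> \<tau> (y t)) ^ 1)) (y t) r = 0"
      unfolding loc[OF g'(1) t]
      by (subst kavg_harmonic[OF g'(1), of _ "2 * r"]) (use y[OF t] sub' r in auto)
    finally show ?thesis by simp
  qed
  then have F10: "F 1 = F 0"
    by (rule const_of_zero_vector_derivative[where T="{-k<..<k}" and F=F]) (use k in auto)
  have F: "F t = complex_of_real (r ^ ?d) * (complex_of_real (kmass TYPE('a) bump) * w (y t))" if t: "t \<in> {-k<..<k}" for t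
  proof -
    have "F t = (LINT z|M. complex_of_real (r ^ ?d) * (w z * complex_of_real (radial bump (y t) r z / r ^ ?d)))"
      unfolding F_def using r(1) by simp
    also have "\<dots> = complex_of_real (r ^ ?d) * kavg (ball p s) bump w (y t) r"
      unfolding kavg_def M_def by (rule integral_mult_right_zero)
    also have "kavg (ball p s) bump w (y t) r = kavg \<Omega> bump w (y t) r" by (rule loc[OF kernel_bump t])
    also have "\<dots> = complex_of_real (kmass TYPE('a) bump) * w (y t)"
      by (rule kavg_w[OF kernel_bump, of _ "2 * r"]) (use y[OF t] sub' r in auto)
    finally show ?thesis .
  qed
  have "w (y 1) = w (y 0)" using F10 k(1) kmass_bump[where 'a='a] r(1) by (simp add: F)
  then show ?thesis by (simp add: y_def e_def)
qed simp

end

text \<open>\<open>isometry\<close> needs a closed ball around one point containing the other.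
  Points of the ball of radius R/3 are less than 2 * R/3 apart, and a ball of radius below 2 * R/3
  around either of them stays within distance R of p.\<close>

lemma intertwined_rigid:
  assumes "intertwined (ball p R) w \<tau>"
  shows "\<And>x y. x \<in> ball p (R / 3) \<Longrightarrow> y \<in> ball p (R / 3) \<Longrightarrow> dist (\<tau> x) (\<tau> y) = dist x y"
    and "\<And>x. x \<in> ball p (R / 3) \<Longrightarrow> w x = w p"
proof -
  interpret intertwined "ball p R" w \<tau> by (rule assms)
  have iso: "norm (\<tau> x - \<tau> y) = norm (x - y)" if "x \<in> ball p (R / 3)" "y \<in> ball p (R / 3)" for x y
  proof -
    have d: "dist p x < R / 3" "dist p y < R / 3" using that by auto
    have "dist x y < 2 * R / 3" using dist_triangle[of x y p] d by (simp add: dist_commute)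
    then obtain \<rho> where \<rho>: "dist x y < \<rho>" "\<rho> < 2 * R / 3" using dense by blast
    show ?thesis
    proof (rule isometry)
      show "cball y \<rho> \<subseteq> ball p R"
      proof
        fix z assume "z \<in> cball y \<rho>"
        then show "z \<in> ball p R" using dist_triangle[of p z y] d(2) \<rho>(2) by simp
      qed
    qed (use \<rho>(1) in \<open>simp add: dist_commute\<close>)
  qed
  then show "\<And>x y. x \<in> ball p (R / 3) \<Longrightarrow> y \<in> ball p (R / 3) \<Longrightarrow> dist (\<tau> x) (\<tau> y) = dist x y"
    by (simp add: dist_norm)
  fix x assume x: "x \<in> ball p (R / 3)"
  then have "R > 0" using zero_le_dist[of p x] by (simp del: zero_le_dist)
  show "w x = w p"
    by (rule w_constant[OF iso _ x]) (use \<open>R > 0\<close> in auto)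
qed

section \<open>Isometries\<close>

definition isometric :: "('a::euclidean_space \<Rightarrow> 'a) \<Rightarrow> bool" where
  "isometric \<sigma> \<longleftrightarrow> (\<forall>x y. dist (\<sigma> x) (\<sigma> y) = dist x y)"

lemma inner_of_dist:
  "2 * ((a - b) \<bullet> (c - d)) = (dist a d)\<^sup>2 + (dist b c)\<^sup>2 - (dist a c)\<^sup>2 - (dist b d)\<^sup>2"
  by (simp add: dist_norm power2_norm_eq_inner inner_diff_left inner_diff_right inner_commute)

lemma isometric_inner:
  assumes "\<And>x y. x \<in> S \<Longrightarrow> y \<in> S \<Longrightarrow> dist (\<tau> x) (\<tau> y) = dist x y" "a \<in> S" "b \<in> S" "c \<in> S" "d \<in> S"
  shows "(\<tau> a - \<tau> b) \<bullet> (\<tau> c - \<tau> d) = (a - b) \<bullet> (c - d)"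
proof -
  have "2 * ((\<tau> a - \<tau> b) \<bullet> (\<tau> c - \<tau> d)) = 2 * ((a - b) \<bullet> (c - d))"
    unfolding inner_of_dist using assms by simp
  then show ?thesis by simp
qed

text \<open>The images of p + h * b, for basis vectors b, determine a linear map L with orthonormal
  images f b. That \<tau> agrees with it on the ball comes from inner products alone, which a
  distance-preserving map keeps.\<close>

lemma isometry_extends:
  assumes "r > 0" "\<And>x y. x \<in> ball p r \<Longrightarrow> y \<in> ball p r \<Longrightarrow> dist (\<tau> x) (\<tau> y) = dist x y"
  shows "\<exists>\<sigma>. isometric \<sigma> \<and> (\<forall>x\<in>ball p r. \<sigma> x = \<tau> x)"
proof -
  define h where "h = r / 2"
  have h: "h > 0" "h < r" using assms(1) by (auto simp: h_def)
  define f where "f b = (1 / h) *\<^sub>R (\<tau> (p + h *\<^sub>R b) - \<tau> p)" for b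
  define L where "L v = (\<Sum>b\<in>Basis. (v \<bullet> b) *\<^sub>R f b)" for v
  define \<sigma> where "\<sigma> x = \<tau> p + L (x - p)" for x
  have pb: "p + h *\<^sub>R b \<in> ball p r" if "b \<in> Basis" for b using that h by (simp add: dist_norm)
  have p: "p \<in> ball p r" using assms(1) by simp
  have I: "(\<tau> a - \<tau> b) \<bullet> (\<tau> c - \<tau> d) = (a - b) \<bullet> (c - d)"
    if "a \<in> ball p r" "b \<in> ball p r" "c \<in> ball p r" "d \<in> ball p r" for a b c d
    by (rule isometric_inner[of "ball p r" \<tau>]) (use assms(2) that in auto)
  have fT: "(\<tau> x - \<tau> p) \<bullet> f b = (x - p) \<bullet> b" if "b \<in> Basis" "x \<in> ball p r" for b x
    using I[OF that(2) p pb[OF that(1)] p] h by (simp add: f_def)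
  have ff: "f b \<bullet> f b' = b \<bullet> b'" if "b \<in> Basis" "b' \<in> Basis" for b b'
    using fT[OF that(2) pb[OF that(1)]] h by (simp add: f_def)
  have LL: "L v \<bullet> L w = v \<bullet> w" for v w
  proof -
    have "L v \<bullet> L w = (\<Sum>b\<in>Basis. \<Sum>b'\<in>Basis. (v \<bullet> b) * ((w \<bullet> b') * (f b \<bullet> f b')))"
      unfolding L_def inner_sum_left
      by (intro sum.cong refl) (simp add: inner_sum_right sum_distrib_left mult_ac)
    also have "\<dots> = (\<Sum>b\<in>Basis. \<Sum>b'\<in>Basis. (v \<bullet> b) * ((w \<bullet> b') * (b \<bullet> b')))"
      by (intro sum.cong refl) (simp add: ff)
    also have "\<dots> = (\<Sum>b\<in>Basis. (v \<bullet> b) *\<^sub>R b) \<bullet> (\<Sum>b\<in>Basis. (w \<bullet> b) *\<^sub>R b)"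
      unfolding inner_sum_left
      by (intro sum.cong refl) (simp add: inner_sum_right sum_distrib_left mult_ac del: euclidean_representation)
    finally show ?thesis by (simp add: euclidean_representation)
  qed
  have Ldiff: "L v - L w = L (v - w)" for v w
    by (simp add: L_def inner_diff_left scaleR_diff_left sum_subtractf)
  have "dist (\<sigma> x) (\<sigma> y) = dist x y" for x y
    using LL[of "x - y" "x - y"] by (simp add: \<sigma>_def dist_norm Ldiff norm_eq_sqrt_inner)
  moreover have "\<sigma> x = \<tau> x" if x: "x \<in> ball p r" for x
  proof -
    define T where "T = \<tau> x - \<tau> p"
    define v where "v = x - p"
    have TT: "T \<bullet> T = v \<bullet> v" unfolding T_def v_def by (rule I[OF x p x p])
    have TL: "T \<bullet> L v = v \<bullet> v"
    proof -
      have "T \<bullet> L v = (\<Sum>b\<in>Basis. (v \<bullet> b) * (v \<bullet> b))"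
        unfolding L_def T_def inner_sum_right inner_scaleR_right
        by (intro sum.cong refl) (simp add: fT[OF _ x] v_def)
      then show ?thesis by (simp add: euclidean_inner[of v v])
    qed
    \<comment> \<open>Expanding the square uses three inner products, all equal to
      \<open>v \<bullet> v\<close>; so the difference is 0 without expanding T in the vectors f
      b.\<close>
    have "(T - L v) \<bullet> (T - L v) = T \<bullet> T - 2 * (T \<bullet> L v) + L v \<bullet> L v"
      by (simp add: inner_diff_left inner_diff_right inner_commute)
    also have "\<dots> = 0" by (simp add: TT TL LL)
    finally have "L (x - p) = \<tau> x - \<tau> p" by (simp add: T_def v_def)
    then show ?thesis by (simp add: \<sigma>_def)
  qed
  ultimately show ?thesis unfolding isometric_def by (intro exI[of _ \<sigma>] conjI allI ballI)
qed

lemma isometric_orthogonal: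
  assumes "isometric \<sigma>" shows "orthogonal_transformation (\<lambda>x. \<sigma> x - \<sigma> 0)"
  using assms unfolding isometric_def orthogonal_transformation_isometry by (simp add: dist_norm)

text \<open>The difference L of the linear parts vanishes on short vectors, because both maps agree
  near p; scaling x - p by t to a short vector extends this to all directions.\<close>

lemma isometric_eq:
  assumes "isometric \<sigma>" "isometric \<sigma>'" "open S" "p \<in> S" "\<And>x. x \<in> S \<Longrightarrow> \<sigma> x = \<sigma>' x"
  shows "\<sigma> = \<sigma>'"
proof
  fix x
  define L where "L v = (\<sigma> v - \<sigma> 0) - (\<sigma>' v - \<sigma>' 0)" for v
  have lin: "linear L"
    unfolding L_def[abs_def]
    by (rule linear_compose_sub[OF orthogonal_transformation_linear[OF isometric_orthogonal[OF assms(1)]]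
        orthogonal_transformation_linear[OF isometric_orthogonal[OF assms(2)]]])
  obtain r where r: "r > 0" "ball p r \<subseteq> S" using assms(3,4) open_contains_ball by metis
  define t where "t = r / (2 * (norm (x - p) + 1))"
  have n: "norm (x - p) + 1 > 0" using norm_ge_zero[of "x - p"] by linarith
  have t: "t > 0" using r(1) n by (simp add: t_def)
  have "t * norm (x - p) < t * (norm (x - p) + 1)" using t by simp
  also have "t * (norm (x - p) + 1) = r / 2" using n by (simp add: t_def field_simps)
  also have "r / 2 < r" using r(1) by simp
  finally have "p + t *\<^sub>R (x - p) \<in> ball p r" using t by (simp add: dist_norm)
  then have "\<sigma> (p + t *\<^sub>R (x - p)) = \<sigma>' (p + t *\<^sub>R (x - p))" "\<sigma> p = \<sigma>' p" using r assms(4,5) by auto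
  then have "L (p + t *\<^sub>R (x - p)) = L p" by (simp add: L_def)
  then have "t *\<^sub>R L (x - p) = 0" by (simp add: linear_add[OF lin] linear_cmul[OF lin])
  then have "L x = L p" using t by (simp add: linear_diff[OF lin])
  then show "\<sigma> x = \<sigma>' x" using \<open>\<sigma> p = \<sigma>' p\<close> by (simp add: L_def algebra_simps)
qed

lemma isometric_inverse:
  assumes "isometric \<sigma>"
  obtains \<kappa> where "isometric \<kappa>" "\<And>x. \<kappa> (\<sigma> x) = x" "\<And>x. \<sigma> (\<kappa> x) = x"
proof -
  have surj0: "surj (\<lambda>x. \<sigma> x - \<sigma> 0)" by (rule orthogonal_transformation_surj[OF isometric_orthogonal[OF assms]])
  have "y \<in> range \<sigma>" for y
  proof -
    obtain x where "y - \<sigma> 0 = \<sigma> x - \<sigma> 0" using surjD[OF surj0, of "y - \<sigma> 0"] by (elim exE) (rule that)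
    then show ?thesis by simp
  qed
  then have s: "surj \<sigma>" by blast
  have i: "inj \<sigma>" using assms unfolding isometric_def by (metis dist_eq_0_iff injI)
  have 1: "inv \<sigma> (\<sigma> x) = x" for x using i by (rule inv_f_f)
  have 2: "\<sigma> (inv \<sigma> x) = x" for x using s by (rule surj_f_inv_f)
  have "isometric (inv \<sigma>)" using assms unfolding isometric_def by (metis 2)
  then show ?thesis using that 1 2 by blast
qed

lemma isometric_continuous: "isometric \<sigma> \<Longrightarrow> continuous_on S \<sigma>"
  unfolding isometric_def by (intro continuous_onI) (auto intro!: exI)

lemma isometric_open_image:
  assumes "isometric \<sigma>" "open S" shows "open (\<sigma> ` S)"
proof -
  obtain \<kappa> where \<kappa>: "isometric \<kappa>" "\<And>x. \<kappa> (\<sigma> x) = x" "\<And>x. \<sigma> (\<kappa> x) = x"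
    using isometric_inverse[OF assms(1)] by metis
  have "\<sigma> ` S = \<kappa> -` S" by (auto simp: \<kappa> image_iff) (metis \<kappa>(3))
  then show ?thesis using open_vimage[OF assms(2) isometric_continuous[OF \<kappa>(1)]] by simp
qed

section \<open>Disjointness preserving operators\<close>

lemma cont_funs_add: "f \<in> cont_funs K \<Longrightarrow> g \<in> cont_funs K \<Longrightarrow> (\<lambda>x. f x + g x) \<in> cont_funs K"
  unfolding cont_funs_def using continuous_on_add[of K f g] by simp

lemma cont_funs_mult: "f \<in> cont_funs K \<Longrightarrow> continuous_on K h \<Longrightarrow> (\<lambda>x. h x * f x) \<in> cont_funs K"
  unfolding cont_funs_def using continuous_on_mult[of K h f] by simp

lemma cont_funs_restrict:
  assumes "continuous_on K h" shows "(\<lambda>x. if x \<in> K then h x else 0) \<in> cont_funs K"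
proof -
  have "continuous_on K (\<lambda>x. if x \<in> K then h x else 0)"
    by (rule continuous_on_eq[OF assms]) simp
  then show ?thesis by (simp add: cont_funs_def)
qed

lemma sup_norm_le: "K \<noteq> {} \<Longrightarrow> (\<And>x. x \<in> K \<Longrightarrow> norm (f x) \<le> c) \<Longrightarrow> sup_norm K f \<le> c"
  unfolding sup_norm_def by (rule cSUP_least)

lemma norm_le_sup_norm:
  assumes "compact K" "f \<in> cont_funs K" "x \<in> K" shows "norm (f x) \<le> sup_norm K f"
  unfolding sup_norm_def
proof (rule cSUP_upper[OF assms(3)])
  have "compact ((\<lambda>x. norm (f x)) ` K)"
    using assms by (intro compact_continuous_image continuous_on_norm) (auto simp: cont_funs_def)
  then show "bdd_above ((\<lambda>x. norm (f x)) ` K)" by (intro bounded_imp_bdd_above compact_imp_bounded)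
qed

text \<open>Suppose l is nonzero on functions supported arbitrarily close to some p. Disjointness
  then makes l vanish on functions that are zero near p, and boundedness extends this to functions
  zero at p, so l is a multiple of evaluation at p. If there is no such p, every point has a
  neighbourhood whose functions are annihilated, and a partition of unity gives l = 0.\<close>

lemma disjointness_preserving_functional:
  fixes l :: "('a::euclidean_space \<Rightarrow> complex) \<Rightarrow> complex"
  assumes K: "compact K" "K \<noteq> {}"
    and add: "\<And>f g. f \<in> cont_funs K \<Longrightarrow> g \<in> cont_funs K \<Longrightarrow> l (\<lambda>x. f x + g x) = l f + l g"
    and cmul: "\<And>f a. f \<in> cont_funs K \<Longrightarrow> l (\<lambda>x. a * f x) = a * l f"
    and bnd: "\<And>f. f \<in> cont_funs K \<Longrightarrow> norm (l f) \<le> B * sup_norm K f"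
    and disj: "\<And>f g. f \<in> cont_funs K \<Longrightarrow> g \<in> cont_funs K \<Longrightarrow> (\<And>x. f x * g x = 0) \<Longrightarrow> l f * l g = 0"
  shows "\<exists>p\<in>K. \<forall>f\<in>cont_funs K. l f = l (\<lambda>x. if x \<in> K then 1 else 0) * f p"
proof (cases "\<exists>p\<in>K. \<forall>\<epsilon>>0. \<exists>f\<in>cont_funs K. (\<forall>x. x \<notin> ball p \<epsilon> \<longrightarrow> f x = 0) \<and> l f \<noteq> 0")
  case True
  then obtain p where p: "p \<in> K"
    and loc: "\<And>\<epsilon>. \<epsilon> > 0 \<Longrightarrow> \<exists>f\<in>cont_funs K. (\<forall>x. x \<notin> ball p \<epsilon> \<longrightarrow> f x = 0) \<and> l f \<noteq> 0" by metis
  have z1: "l g = 0" if g: "g \<in> cont_funs K" and e: "\<epsilon> > 0" and z: "\<And>x. x \<in> ball p \<epsilon> \<Longrightarrow> g x = 0" for g \<epsilon>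
  proof -
    obtain f where f: "f \<in> cont_funs K" "\<forall>x. x \<notin> ball p \<epsilon> \<longrightarrow> f x = 0" "l f \<noteq> 0" using loc[OF e] by metis
    have "l f * l g = 0" by (rule disj[OF f(1) g]) (use f(2) z in \<open>metis mult_zero_left mult_zero_right\<close>)
    then show ?thesis using f(3) by simp
  qed
  have z2: "l g = 0" if g: "g \<in> cont_funs K" and gp: "g p = 0" for g
  proof -
    have le: "norm (l g) \<le> \<bar>B\<bar> * \<epsilon>" if \<epsilon>: "\<epsilon> > 0" for \<epsilon>
    proof -
      have "continuous_on K g" using g by (simp add: cont_funs_def)
      then obtain \<delta> where \<delta>: "\<delta> > 0" "\<And>x. x \<in> K \<Longrightarrow> dist x p < \<delta> \<Longrightarrow> dist (g x) (g p) < \<epsilon>"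
        using p \<epsilon> unfolding continuous_on_iff by metis
      \<comment> \<open>Equal to 0 within \<delta>/2 of p and to 1 beyond \<delta>: the part h * g
        vanishes near p, and the part (1 - h) * g has supremum norm at most \<epsilon>.\<close>
      define h :: "'a \<Rightarrow> real" where "h x = min 1 (max 0 (2 * dist x p / \<delta> - 1))" for x
      have hc: "continuous_on K h" unfolding h_def[abs_def] using \<delta> by (intro continuous_intros) auto
      have h01: "0 \<le> h x" "h x \<le> 1" for x by (auto simp: h_def)
      let ?g1 = "\<lambda>x. complex_of_real (h x) * g x" and ?g2 = "\<lambda>x. complex_of_real (1 - h x) * g x"
      have g12: "?g1 \<in> cont_funs K" "?g2 \<in> cont_funs K"
        by (intro cont_funs_mult g continuous_intros hc)+
      have "l ?g1 = 0"
      proof (rule z1[OF g12(1), of "\<delta> / 2"])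
        fix x assume "x \<in> ball p (\<delta> / 2)"
        then have "2 * dist x p / \<delta> - 1 \<le> 0" using \<delta>(1) by (simp add: dist_commute)
        then have "h x = 0" by (simp add: h_def)
        then show "?g1 x = 0" by simp
      qed (use \<delta> in auto)
      moreover have "norm (l ?g2) \<le> \<bar>B\<bar> * \<epsilon>"
      proof -
        have "sup_norm K ?g2 \<le> \<epsilon>"
        proof (rule sup_norm_le[OF K(2)])
          fix x assume x: "x \<in> K"
          show "norm (?g2 x) \<le> \<epsilon>"
          proof (cases "dist x p < \<delta>")
            case True
            then have "norm (g x) \<le> \<epsilon>" using \<delta>(2)[OF x] gp by (simp add: dist_norm less_imp_le)
            then have "(1 - h x) * norm (g x) \<le> 1 * \<epsilon>" using h01[of x] by (intro mult_mono) auto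
            then show ?thesis using h01[of x] by (simp add: norm_mult del: of_real_diff)
          next
            case False
            then have "2 * dist x p / \<delta> - 1 \<ge> 1" using \<delta>(1) by (simp add: field_simps)
            then have "h x = 1" by (simp add: h_def)
            then show ?thesis using \<epsilon> by simp
          qed
        qed
        moreover have "0 \<le> sup_norm K ?g2"
          using norm_le_sup_norm[OF K(1) g12(2) p] norm_ge_zero[of "?g2 p"] by linarith
        ultimately have "B * sup_norm K ?g2 \<le> \<bar>B\<bar> * \<epsilon>" by (intro mult_mono) auto
        then show ?thesis using bnd[OF g12(2)] by linarith
      qed
      moreover have "l g = l ?g1 + l ?g2"
        using add[OF g12] by (simp add: algebra_simps)
      ultimately show ?thesis by simp
    qed
    have "norm (l g) \<le> 0 + e" if "e > 0" for e
    proof -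
      have "norm (l g) \<le> \<bar>B\<bar> * (e / (\<bar>B\<bar> + 1))" by (rule le) (use that in simp)
      also have "\<dots> \<le> e" using that by (simp add: field_simps)
      finally show ?thesis by simp
    qed
    then have "norm (l g) \<le> 0" by (rule field_le_epsilon)
    then show ?thesis by simp
  qed
  show ?thesis
  proof (intro bexI[OF _ p] ballI)
    fix f assume f: "f \<in> cont_funs K"
    let ?o = "\<lambda>x. if x \<in> K then 1 else (0::complex)"
    have o: "?o \<in> cont_funs K" by (intro cont_funs_restrict continuous_intros)
    \<comment> \<open>Subtracting the constant \<open>f p\<close> yields a function that vanishes at
      p.\<close>
    have g1: "(\<lambda>x. (- f p) * ?o x) \<in> cont_funs K" by (intro cont_funs_mult o continuous_intros)
    have "l (\<lambda>x. f x + (- f p) * ?o x) = 0"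
      by (rule z2[OF cont_funs_add[OF f g1]]) (use p in simp)
    then have "l f + (- f p) * l ?o = 0"
      unfolding add[OF f g1] cmul[OF o] .
    then show "l f = l ?o * f p" by (simp add: mult.commute)
  qed
next
  case False
  then have "\<forall>p\<in>K. \<exists>\<epsilon>>0. \<forall>f\<in>cont_funs K. (\<forall>x. x \<notin> ball p \<epsilon> \<longrightarrow> f x = 0) \<longrightarrow> l f = 0" by metis
  then obtain \<epsilon> where \<epsilon>: "\<And>p. p \<in> K \<Longrightarrow> \<epsilon> p > 0"
    "\<And>p f. p \<in> K \<Longrightarrow> f \<in> cont_funs K \<Longrightarrow> (\<And>x. x \<notin> ball p (\<epsilon> p) \<Longrightarrow> f x = 0) \<Longrightarrow> l f = 0"
    unfolding bchoice_iff by metis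
  have "K \<subseteq> (\<Union>p\<in>K. ball p (\<epsilon> p))" using \<epsilon>(1) by force
  then obtain D where D: "D \<subseteq> K" "finite D" "K \<subseteq> (\<Union>p\<in>D. ball p (\<epsilon> p))"
    by (rule compactE_image[OF K(1), rotated]) auto
  \<comment> \<open>Tent functions of a finite subcover; divided by their sum s they form a
    partition of unity on K. Off K the sum may be 0, but there f is 0 too.\<close>
  define \<phi> where "\<phi> p x = max 0 (\<epsilon> p - dist p x)" for p x
  define s where "s x = (\<Sum>p\<in>D. \<phi> p x)" for x
  have \<phi>c: "continuous_on K (\<phi> p)" for p unfolding \<phi>_def[abs_def] by (intro continuous_intros)
  have sc: "continuous_on K s" unfolding s_def[abs_def] by (intro continuous_intros \<phi>c)
  have s: "s x > 0" if x: "x \<in> K" for x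
  proof -
    obtain p where p: "p \<in> D" "x \<in> ball p (\<epsilon> p)" using D(3) x by blast
    have "0 < \<phi> p x" using p(2) by (simp add: \<phi>_def)
    also have "\<phi> p x \<le> s x" unfolding s_def by (rule member_le_sum[OF p(1) _ D(2)]) (simp add: \<phi>_def)
    finally show ?thesis .
  qed
  have l0: "l f = 0" if f: "f \<in> cont_funs K" for f
  proof -
    define f' where "f' p x = complex_of_real (\<phi> p x / s x) * f x" for p x
    have f': "f' p \<in> cont_funs K" for p
      unfolding f'_def[abs_def]
      by (intro cont_funs_mult f continuous_intros \<phi>c sc) (use s in force)
    have z: "l (\<lambda>x. 0) = 0" using cmul[OF f, of 0] by simp
    have z': "(\<lambda>x. 0) \<in> cont_funs K" by (simp add: cont_funs_def)
    have "(\<lambda>x. \<Sum>p\<in>E. f' p x) \<in> cont_funs K \<and> l (\<lambda>x. \<Sum>p\<in>E. f' p x) = 0" if "finite E" "E \<subseteq> D" for E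
      using that
    proof (induction E rule: finite_induct)
      case (insert p E)
      have "l (f' p) = 0"
        by (rule \<epsilon>(2)[OF _ f', of p]) (use insert.prems D(1) in \<open>auto simp: f'_def \<phi>_def\<close>)
      then show ?case using insert add[OF f'[of p], of "\<lambda>x. \<Sum>p\<in>E. f' p x"] cont_funs_add[OF f'[of p], of "\<lambda>x. \<Sum>p\<in>E. f' p x"] by auto
    qed (simp add: z z')
    from this[OF D(2)] have "l (\<lambda>x. \<Sum>p\<in>D. f' p x) = 0" by simp
    also have "(\<lambda>x. \<Sum>p\<in>D. f' p x) = f"
    proof
      fix x
      have "(\<Sum>p\<in>D. f' p x) = complex_of_real (\<Sum>p\<in>D. \<phi> p x / s x) * f x"
        unfolding f'_def by (simp only: sum_distrib_right of_real_sum)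
      also have "(\<Sum>p\<in>D. \<phi> p x / s x) = s x / s x"
        unfolding s_def by (simp only: sum_divide_distrib)
      finally show "(\<Sum>p\<in>D. f' p x) = f x"
        using s[of x] f by (cases "x \<in> K") (auto simp: cont_funs_def)
    qed
    finally show ?thesis .
  qed
  obtain p where "p \<in> K" using K(2) by blast
  moreover have "(\<lambda>x. if x \<in> K then 1 else 0) \<in> cont_funs K" by (intro cont_funs_restrict continuous_intros)
  ultimately show ?thesis using l0 by auto
qed

text \<open>Each f \<mapsto> U f y is a disjointness preserving functional, hence a multiple of a
  point evaluation; the multiple \<open>w y\<close> is the value of U on the constant 1. For y
  outside L the weight is 0 and \<tau> y is an arbitrary point of K.\<close>

lemma disjointness_preserving_representation:
  fixes U :: "('a::euclidean_space \<Rightarrow> complex) \<Rightarrow> ('a \<Rightarrow> complex)"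
  assumes K: "compact K" "K \<noteq> {}" and L: "compact L"
    and U: "bounded_linear_operator K L U"
    and disj: "\<forall>f\<in>cont_funs K. \<forall>g\<in>cont_funs K. (\<forall>x. f x * g x = 0) \<longrightarrow> (\<forall>y. U f y * U g y = 0)"
  shows "\<exists>w \<tau>. w \<in> cont_funs L \<and> (\<forall>y. \<tau> y \<in> K) \<and>
    (\<forall>f\<in>cont_funs K. \<forall>y. U f y = w y * f (\<tau> y)) \<and> continuous_on {y \<in> L. w y \<noteq> 0} \<tau>"
proof -
  let ?o = "\<lambda>x. if x \<in> K then 1 else (0::complex)"
  have UL: "U f \<in> cont_funs L" if "f \<in> cont_funs K" for f
    using U that unfolding bounded_linear_operator_def by blast
  have Uadd: "U (\<lambda>x. f x + g x) = (\<lambda>y. U f y + U g y)" if "f \<in> cont_funs K" "g \<in> cont_funs K" for f g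
    using U that unfolding bounded_linear_operator_def by blast
  have Ucmul: "U (\<lambda>x. a * f x) = (\<lambda>y. a * U f y)" if "f \<in> cont_funs K" for f a
    using U that unfolding bounded_linear_operator_def by blast
  obtain B where B: "\<forall>f\<in>cont_funs K. sup_norm L (U f) \<le> B * sup_norm K f"
    using U unfolding bounded_linear_operator_def by (elim conjE exE) (rule that)
  define w where "w = U ?o"
  have "\<exists>p. p \<in> K \<and> (\<forall>f\<in>cont_funs K. U f y = w y * f p)" for y
  proof (cases "y \<in> L")
    case True
    have "\<exists>p\<in>K. \<forall>f\<in>cont_funs K. U f y = U ?o y * f p"
    proof (rule disjointness_preserving_functional[OF K])
      fix f g assume f: "f \<in> cont_funs K" and g: "g \<in> cont_funs K"
      show "U (\<lambda>x. f x + g x) y = U f y + U g y" by (simp add: Uadd[OF f g])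
      show "U f y * U g y = 0" if "\<And>x. f x * g x = 0" using disj f g that by blast
    next
      fix f a assume f: "f \<in> cont_funs K"
      show "U (\<lambda>x. a * f x) y = a * U f y" by (simp add: Ucmul[OF f])
      show "norm (U f y) \<le> B * sup_norm K f"
        using norm_le_sup_norm[OF L UL[OF f] True] bspec[OF B f] by linarith
    qed
    then show ?thesis unfolding w_def by blast
  next
    case False
    then have "U f y = 0" if "f \<in> cont_funs K" for f using UL[OF that] by (simp add: cont_funs_def)
    moreover have "?o \<in> cont_funs K" by (intro cont_funs_restrict continuous_intros)
    ultimately show ?thesis using K(2) unfolding w_def by (metis ex_in_conv mult_zero_left)
  qed
  then obtain \<tau> where \<tau>: "\<And>y. \<tau> y \<in> K" "\<And>y f. f \<in> cont_funs K \<Longrightarrow> U f y = w y * f (\<tau> y)"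
    by metis
  have w: "w \<in> cont_funs L" unfolding w_def by (intro UL cont_funs_restrict continuous_intros)
  have "continuous_on {y \<in> L. w y \<noteq> 0} \<tau>"
  proof (subst continuous_on_componentwise, rule ballI)
    \<comment> \<open>Where w is nonzero, a coordinate of \<tau> is U of that coordinate function
      divided by w, a quotient of continuous functions.\<close>
    fix b :: 'a
    let ?f = "\<lambda>x. if x \<in> K then complex_of_real (x \<bullet> b) else 0"
    have f: "?f \<in> cont_funs K" by (intro cont_funs_restrict continuous_intros)
    have "continuous_on {y \<in> L. w y \<noteq> 0} (\<lambda>y. Re (U ?f y / w y))"
      using UL[OF f] w unfolding cont_funs_def
      by (intro continuous_intros) (auto elim: continuous_on_subset)
    moreover have "Re (U ?f y / w y) = \<tau> y \<bullet> b" if "y \<in> {y \<in> L. w y \<noteq> 0}" for y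
      using that \<tau>(1) by (simp add: \<tau>(2)[OF f])
    ultimately show "continuous_on {y \<in> L. w y \<noteq> 0} (\<lambda>y. \<tau> y \<bullet> b)" by (rule continuous_on_eq)
  qed
  then show ?thesis by (intro exI[of _ w] exI[of _ \<tau>] conjI ballI allI w \<tau>)
qed

section \<open>Lipschitz boundaries\<close>

text \<open>\<open>\<psi>\<close> is the height above the boundary, measured in the direction \<open>e\<close>.\<close>

definition boundary_chart :: "'a::euclidean_space set \<Rightarrow> 'a \<Rightarrow> 'a set \<Rightarrow> 'a \<Rightarrow> ('a \<Rightarrow> real) \<Rightarrow> real \<Rightarrow> bool" where
  "boundary_chart \<Omega> z V e \<psi> M \<longleftrightarrow> open V \<and> z \<in> V \<and> norm e = 1 \<and> M > 0 \<and> \<psi> z = 0 \<and>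
    (\<forall>x t. \<psi> (x + t *\<^sub>R e) = \<psi> x + t) \<and> (\<forall>x y. \<bar>\<psi> x - \<psi> y\<bar> \<le> M * norm (x - y)) \<and>
    (\<forall>x\<in>V. x \<in> \<Omega> \<longleftrightarrow> \<psi> x > 0) \<and> (\<forall>x\<in>V \<inter> frontier \<Omega>. \<psi> x = 0)"

text \<open>A frontier point is not in the open set, so its height is not positive; at negative
  height a whole neighbourhood would miss the set.\<close>

lemma frontier_height_zero:
  fixes \<psi> :: "'a::euclidean_space \<Rightarrow> real"
  assumes "open \<Omega>" "open V" "continuous_on UNIV \<psi>" "\<And>x. x \<in> V \<Longrightarrow> x \<in> \<Omega> \<longleftrightarrow> \<psi> x > 0" "x \<in> V" "x \<in> frontier \<Omega>"
  shows "\<psi> x = 0"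
proof (rule ccontr)
  assume "\<psi> x \<noteq> 0"
  have "x \<notin> \<Omega>" using assms(1,6) by (simp add: frontier_def interior_open)
  then have neg: "\<psi> x < 0" using assms(4,5) \<open>\<psi> x \<noteq> 0\<close> by force
  have "open (V \<inter> {x. \<psi> x < 0})"
    by (intro open_Int assms(2) open_Collect_less assms(3) continuous_intros)
  moreover have "V \<inter> {x. \<psi> x < 0} \<inter> \<Omega> = {}" using assms(4) by force
  ultimately have "V \<inter> {x. \<psi> x < 0} \<inter> closure \<Omega> = {}" by (simp add: open_Int_closure_eq_empty)
  moreover have "x \<in> closure \<Omega>" using assms(6) by (simp add: frontier_def)
  ultimately show False using assms(5) neg by blast
qed

lemma lipschitz_boundary_chart:
  assumes "open \<Omega>" "lipschitz_boundary \<Omega>" "z \<in> frontier \<Omega>"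
  shows "\<exists>V e \<psi> M. boundary_chart \<Omega> z V e \<psi> M"
proof -
  from bspec[OF assms(2)[unfolded lipschitz_boundary_def] assms(3)]
  obtain V e \<phi> L where V: "open V" "z \<in> V" and e: "norm e = 1" and lip: "L-lipschitz_on {x. x \<bullet> e = 0} \<phi>"
    and epi: "\<Omega> \<inter> V = {x \<in> V. \<phi> (x - (x \<bullet> e) *\<^sub>R e) < x \<bullet> e}"
    by (elim exE conjE) (rule that)
  define P where "P x = x - (x \<bullet> e) *\<^sub>R e" for x
  \<comment> \<open>P is the orthogonal projection onto the hyperplane, unchanged by moves along e;
    hence \<psi> increases at unit speed along e and has Lipschitz constant 1 + L.\<close>
  define \<psi> where "\<psi> x = x \<bullet> e - \<phi> (P x)" for x
  have ee: "e \<bullet> e = 1" using e by (simp add: norm_eq_1)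
  have PH: "P x \<bullet> e = 0" for x by (simp add: P_def inner_diff_left ee)
  have Pdiff: "norm (P x - P y) \<le> norm (x - y)" for x y
  proof -
    define v where "v = x - y"
    have "P x - P y = v - (v \<bullet> e) *\<^sub>R e" by (simp add: P_def v_def inner_diff_left algebra_simps)
    then have "(norm (P x - P y))\<^sup>2 = (norm v)\<^sup>2 - (v \<bullet> e)\<^sup>2"
      unfolding power2_norm_eq_inner by (simp add: inner_diff_left inner_diff_right inner_commute ee power2_eq_square)
    then have "(norm (P x - P y))\<^sup>2 \<le> (norm v)\<^sup>2" by simp
    then show ?thesis unfolding v_def by (rule power2_le_imp_le) simp
  qed
  have L: "L \<ge> 0" using lip by (simp add: lipschitz_on_def)
  have \<psi>lip: "\<bar>\<psi> x - \<psi> y\<bar> \<le> (1 + L) * norm (x - y)" for x y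
  proof -
    have "\<bar>\<phi> (P x) - \<phi> (P y)\<bar> \<le> L * norm (P x - P y)"
      using lipschitz_onD[OF lip, of "P x" "P y"] PH by (simp add: dist_norm)
    also have "\<dots> \<le> L * norm (x - y)" using L Pdiff by (intro mult_left_mono)
    finally have "\<bar>\<phi> (P x) - \<phi> (P y)\<bar> \<le> L * norm (x - y)" .
    moreover have "\<bar>x \<bullet> e - y \<bullet> e\<bar> \<le> norm (x - y)"
      using Cauchy_Schwarz_ineq2[of "x - y" e] e by (simp add: inner_diff_left)
    ultimately show ?thesis by (simp add: \<psi>_def algebra_simps)
  qed
  have cont: "continuous_on UNIV \<psi>"
    using L by (intro lipschitz_on_continuous_on[of "1 + L"] lipschitz_onI) (use \<psi>lip in \<open>auto simp: dist_norm\<close>)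
  have in\<Omega>: "x \<in> \<Omega> \<longleftrightarrow> \<psi> x > 0" if "x \<in> V" for x
    using epi that unfolding \<psi>_def P_def by auto
  have fr: "\<psi> x = 0" if "x \<in> V" "x \<in> frontier \<Omega>" for x
    by (rule frontier_height_zero[OF assms(1) V(1) cont in\<Omega> that])
  have "\<psi> (x + t *\<^sub>R e) = \<psi> x + t" for x t
  proof -
    have "P (x + t *\<^sub>R e) = P x" by (simp add: P_def inner_add_left ee algebra_simps)
    then show ?thesis by (simp add: \<psi>_def inner_add_left ee)
  qed
  then have "boundary_chart \<Omega> z V e \<psi> (1 + L)"
    unfolding boundary_chart_def using V e L \<psi>lip in\<Omega> fr assms(3) by auto
  then show ?thesis by blast
qed

lemma Basis_DIM_1:
  assumes "DIM('a::euclidean_space) = 1" obtains b where "Basis = {b::'a}"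
  using assms card_1_singletonE by metis

text \<open>In dimension one the height is the signed distance to the endpoint in question, and V is
  the half-line that excludes the other endpoint.\<close>

lemma box_boundary_chart:
  fixes a b z :: "'a::euclidean_space"
  assumes "DIM('a) = 1" "box a b \<noteq> {}" "z \<in> frontier (box a b)"
  shows "\<exists>V e \<psi> M. boundary_chart (box a b) z V e \<psi> M"
proof -
  obtain i :: 'a where i: "Basis = {i}" using Basis_DIM_1[OF assms(1)] by metis
  have "i \<in> Basis" unfolding i by (rule singletonI)
  then have ii: "i \<bullet> i = 1" "norm i = 1" "i \<in> Basis" by auto
  have box: "x \<in> box a b \<longleftrightarrow> a \<bullet> i < x \<bullet> i \<and> x \<bullet> i < b \<bullet> i" for x by (simp add: mem_box i)
  have ab: "a \<bullet> i < b \<bullet> i" using assms(2) box by force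
  have "z \<in> cbox a b" using assms(2,3) by (auto simp: frontier_def)
  moreover have "z \<notin> box a b" using assms(3) by (simp add: frontier_def interior_open[OF open_box])
  ultimately consider "z \<bullet> i = a \<bullet> i" | "z \<bullet> i = b \<bullet> i" by (force simp: mem_box i)
  then show ?thesis
  proof cases
    case 1
    let ?V = "{x. x \<bullet> i < b \<bullet> i}" and ?\<psi> = "\<lambda>x. x \<bullet> i - a \<bullet> i"
    have V: "open ?V" by (intro open_Collect_less continuous_intros)
    have fr: "?\<psi> x = 0" if "x \<in> ?V" "x \<in> frontier (box a b)" for x
      by (rule frontier_height_zero[OF open_box V _ _ that]) (auto simp: box intro!: continuous_intros)
    have "\<bar>?\<psi> x - ?\<psi> y\<bar> \<le> 1 * norm (x - y)" for x y
      using Basis_le_norm[OF ii(3), of "x - y"] by (simp add: inner_diff_left)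
    then have "boundary_chart (box a b) z ?V i ?\<psi> 1"
      unfolding boundary_chart_def using V ii 1 ab fr
      by (auto simp: box inner_add_left)
    then show ?thesis by blast
  next
    case 2
    let ?V = "{x. a \<bullet> i < x \<bullet> i}" and ?\<psi> = "\<lambda>x. b \<bullet> i - x \<bullet> i"
    have V: "open ?V" by (intro open_Collect_less continuous_intros)
    have fr: "?\<psi> x = 0" if "x \<in> ?V" "x \<in> frontier (box a b)" for x
      by (rule frontier_height_zero[OF open_box V _ _ that]) (auto simp: box intro!: continuous_intros)
    have "\<bar>?\<psi> x - ?\<psi> y\<bar> \<le> 1 * norm (x - y)" for x y
      using Basis_le_norm[OF ii(3), of "x - y"] by (simp add: inner_diff_left)
    then have "boundary_chart (box a b) z ?V (- i) ?\<psi> 1"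
      unfolding boundary_chart_def using V ii 2 ab fr
      by (auto simp: box inner_add_left inner_diff_left)
    then show ?thesis by blast
  qed
qed

lemma admissible_domain_basic:
  assumes "admissible_domain \<Omega>"
  shows "open \<Omega>" "bounded \<Omega>" "connected \<Omega>" "\<Omega> \<noteq> {}"
  using assms unfolding admissible_domain_def
  by (auto split: if_splits intro: convex_connected)

lemma admissible_domain_chart:
  fixes \<Omega> :: "'a::euclidean_space set"
  assumes "admissible_domain \<Omega>" "z \<in> frontier \<Omega>"
  shows "\<exists>V e \<psi> M. boundary_chart \<Omega> z V e \<psi> M"
proof (cases "DIM('a) = 1")
  case True
  then obtain a b where "\<Omega> = box a b" "\<Omega> \<noteq> {}" using assms(1) unfolding admissible_domain_def by auto
  then show ?thesis using box_boundary_chart[OF True] assms(2) by metis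
next
  case False
  then show ?thesis using lipschitz_boundary_chart[OF _ _ assms(2)] assms(1) unfolding admissible_domain_def by auto
qed

text \<open>A ball cut by a Lipschitz graph may be disconnected. Pushing its points upward along e
  joins all of them to one ball T above z, and the union of these segments with T is
  connected.\<close>

lemma boundary_connected_neighbourhood:
  assumes "boundary_chart \<Omega> z V e \<psi> M" "ball z \<epsilon> \<subseteq> V" "\<epsilon> > 0"
  obtains \<rho> C where "\<rho> > 0" "connected C" "\<Omega> \<inter> ball z \<rho> \<subseteq> C" "C \<subseteq> \<Omega> \<inter> ball z \<epsilon>"
proof -
  have ch: "norm e = 1" "M > 0" "\<psi> z = 0" "\<And>x t. \<psi> (x + t *\<^sub>R e) = \<psi> x + t" "\<And>x y. \<bar>\<psi> x - \<psi> y\<bar> \<le> M * norm (x - y)"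
    "\<And>x. x \<in> V \<Longrightarrow> x \<in> \<Omega> \<longleftrightarrow> \<psi> x > 0"
    using assms(1) unfolding boundary_chart_def by blast+
  \<comment> \<open>Points of T have height at least h - M * \<rho> = \<rho>, hence lie in \<Omega>,
    and the set reaches at most \<rho> + h = (M + 2) * \<rho> < \<epsilon> from z.\<close>
  define \<rho> where "\<rho> = \<epsilon> / (M + 3)"
  define h where "h = (M + 1) * \<rho>"
  have \<rho>: "\<rho> > 0" "h > 0" "\<rho> + h < \<epsilon>"
  proof -
    show "\<rho> > 0" using assms(3) ch(2) by (simp add: \<rho>_def)
    then show "h > 0" using ch(2) by (simp add: h_def)
    have "\<rho> + h = (M + 3) * \<rho> - \<rho>" by (simp add: h_def algebra_simps)
    also have "(M + 3) * \<rho> = \<epsilon>" using ch(2) by (simp add: \<rho>_def)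
    finally show "\<rho> + h < \<epsilon>" using \<open>\<rho> > 0\<close> by simp
  qed
  define T where "T = ball (z + h *\<^sub>R e) \<rho>"
  define S where "S x = closed_segment x (x + h *\<^sub>R e) \<union> T" for x
  have Tsub: "T \<subseteq> \<Omega> \<inter> ball z \<epsilon>"
  proof
    fix x assume "x \<in> T"
    then have d: "norm (x - (z + h *\<^sub>R e)) < \<rho>" by (simp add: T_def dist_norm norm_minus_commute)
    have "norm (x - z) \<le> norm (x - (z + h *\<^sub>R e)) + norm (h *\<^sub>R e)"
      using norm_triangle_ineq[of "x - (z + h *\<^sub>R e)" "h *\<^sub>R e"] by simp
    then have b: "x \<in> ball z \<epsilon>" using d \<rho> ch(1) by (simp add: dist_norm norm_minus_commute)
    have "\<bar>\<psi> x - \<psi> (z + h *\<^sub>R e)\<bar> \<le> M * norm (x - (z + h *\<^sub>R e))" by (rule ch(5))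
    also have "\<dots> \<le> M * \<rho>" using d ch(2) by (intro mult_left_mono) auto
    finally have "\<psi> x \<ge> h - M * \<rho>" using ch(3) ch(4)[of z h] by simp
    also have "h - M * \<rho> = \<rho>" by (simp add: h_def algebra_simps)
    finally have "\<psi> x > 0" using \<rho> by simp
    then show "x \<in> \<Omega> \<inter> ball z \<epsilon>" using ch(6) b assms(2) by blast
  qed
  have seg: "closed_segment x (x + h *\<^sub>R e) \<subseteq> \<Omega> \<inter> ball z \<epsilon>" if x: "x \<in> \<Omega> \<inter> ball z \<rho>" for x
  proof
    fix y assume "y \<in> closed_segment x (x + h *\<^sub>R e)"
    then obtain u where u: "0 \<le> u" "u \<le> 1" "y = x + (u * h) *\<^sub>R e"
      by (auto simp: closed_segment_def algebra_simps)
    have "norm (y - z) \<le> norm (x - z) + norm ((u * h) *\<^sub>R e)"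
      unfolding u(3) using norm_triangle_ineq[of "x - z" "(u * h) *\<^sub>R e"] by (simp add: algebra_simps)
    also have "norm ((u * h) *\<^sub>R e) \<le> h" using u \<rho> ch(1) by (simp add: mult_left_le_one_le)
    finally have b: "y \<in> ball z \<epsilon>" using x \<rho> by (simp add: dist_norm norm_minus_commute)
    have "x \<in> V" using x \<rho> assms(2) by force
    then have "\<psi> x > 0" using ch(6) x by blast
    then have "\<psi> y > 0" unfolding u(3) ch(4) using u \<rho> by (simp add: add_pos_nonneg)
    then show "y \<in> \<Omega> \<inter> ball z \<epsilon>" using ch(6) b assms(2) by blast
  qed
  show ?thesis
  proof (rule that[OF \<rho>(1), of "T \<union> (\<Union>x\<in>\<Omega> \<inter> ball z \<rho>. S x)"])
    have TS: "connected (S x)" if "x \<in> \<Omega> \<inter> ball z \<rho>" for x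
    proof -
      have "x + h *\<^sub>R e \<in> T" using that by (simp add: T_def dist_norm)
      then show ?thesis unfolding S_def T_def
        by (intro connected_Un) auto
    qed
    have "connected (\<Union> (insert T (S ` (\<Omega> \<inter> ball z \<rho>))))"
    proof (rule connected_Union)
      show "connected s" if "s \<in> insert T (S ` (\<Omega> \<inter> ball z \<rho>))" for s
        using that TS by (auto simp: T_def)
      have "z + h *\<^sub>R e \<in> \<Inter> (insert T (S ` (\<Omega> \<inter> ball z \<rho>)))" using \<rho>(1) by (auto simp: S_def T_def)
      then show "\<Inter> (insert T (S ` (\<Omega> \<inter> ball z \<rho>))) \<noteq> {}" by blast
    qed
    then show "connected (T \<union> (\<Union>x\<in>\<Omega> \<inter> ball z \<rho>. S x))" by simp
    show "\<Omega> \<inter> ball z \<rho> \<subseteq> T \<union> (\<Union>x\<in>\<Omega> \<inter> ball z \<rho>. S x)" by (auto simp: S_def)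
    show "T \<union> (\<Union>x\<in>\<Omega> \<inter> ball z \<rho>. S x) \<subseteq> \<Omega> \<inter> ball z \<epsilon>"
      unfolding S_def using Tsub seg by blast
  qed
qed

text \<open>Points below the graph lie outside the closure, since the region of negative height is
  open and misses \<Omega>. They are where a bump can be moved so that its integral over \<Omega>
  becomes 0.\<close>

lemma boundary_exterior_point:
  assumes "boundary_chart \<Omega> z V e \<psi> M" "\<epsilon> > 0"
  obtains q where "q \<in> ball z \<epsilon>" "q \<notin> closure \<Omega>"
proof -
  have ch: "open V" "z \<in> V" "norm e = 1" "\<psi> z = 0" "\<And>x t. \<psi> (x + t *\<^sub>R e) = \<psi> x + t" "\<And>x y. \<bar>\<psi> x - \<psi> y\<bar> \<le> M * norm (x - y)"
    "M > 0" "\<And>x. x \<in> V \<Longrightarrow> x \<in> \<Omega> \<longleftrightarrow> \<psi> x > 0"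
    using assms(1) unfolding boundary_chart_def by blast+
  obtain d where d: "d > 0" "ball z d \<subseteq> V" using ch(1,2) open_contains_ball by metis
  define t where "t = min \<epsilon> d / 2"
  have t: "t > 0" "t < \<epsilon>" "t < d" using assms(2) d(1) by (auto simp: t_def)
  define q where "q = z + (- t) *\<^sub>R e"
  have q: "dist z q = t" using t ch(3) by (simp add: q_def dist_norm)
  have "continuous_on UNIV \<psi>"
    using ch(7) by (intro lipschitz_on_continuous_on[of M] lipschitz_onI) (use ch(6) in \<open>auto simp: dist_norm\<close>)
  then have "open (V \<inter> {x. \<psi> x < 0})" by (intro open_Int ch(1) open_Collect_less continuous_intros)
  moreover have "V \<inter> {x. \<psi> x < 0} \<inter> \<Omega> = {}" using ch(8) by force
  ultimately have "V \<inter> {x. \<psi> x < 0} \<inter> closure \<Omega> = {}" by (simp add: open_Int_closure_eq_empty)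
  moreover have "q \<in> V" using q t d by (simp add: subset_iff)
  moreover have "\<psi> q < 0" unfolding q_def ch(5) ch(4) using t by simp
  ultimately have "q \<notin> closure \<Omega>" by blast
  moreover have "q \<in> ball z \<epsilon>" using q t by simp
  ultimately show ?thesis using that by blast
qed

subsection \<open>Local finiteness of the surface measure\<close>

lemma hausdorff_content_le:
  assumes "finite I" "A \<subseteq> (\<Union>i\<in>I. c i)" "\<And>i. i \<in> I \<Longrightarrow> bounded (c i) \<and> diameter (c i) \<le> D" "0 \<le> D" "D \<le> \<delta>"
  shows "hausdorff_content k \<delta> A \<le> ennreal (real (card I) * (unit_ball_vol (real k) * (D / 2) ^ k))"
proof -
  obtain f where f: "bij_betw f {..<card I} I"
    using ex_bij_betw_nat_finite[OF assms(1)] by (auto simp: lessThan_atLeast0)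
  \<comment> \<open>The finite cover is padded with empty sets. These count 0 by the definition of
    the content, also for k = 0, where the power of the diameter would be 1.\<close>
  define E where "E i = (if i < card I then c (f i) else {})" for i
  have fI: "f i \<in> I" if "i < card I" for i using f that by (auto simp: bij_betw_def)
  have "A \<subseteq> (\<Union>i. E i)"
  proof
    fix x assume "x \<in> A"
    then obtain j where j: "j \<in> I" "x \<in> c j" using assms(2) by blast
    then obtain i where "i < card I" "f i = j" using f unfolding bij_betw_def by (metis imageE lessThan_iff)
    then have "x \<in> E i" using j by (simp add: E_def)
    then show "x \<in> (\<Union>i. E i)" by blast
  qed
  moreover have "bounded (E i) \<and> diameter (E i) \<le> \<delta>" for i
    using assms(3)[OF fI, of i] assms(4,5) by (auto simp: E_def)
  ultimately have "hausdorff_content k \<delta> A \<le>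
      (\<Sum>i. if E i = {} then 0 else ennreal (unit_ball_vol (real k) * (diameter (E i) / 2) ^ k))"
    unfolding hausdorff_content_def by (intro INF_lower) auto
  also have "\<dots> = (\<Sum>i<card I. if E i = {} then 0 else ennreal (unit_ball_vol (real k) * (diameter (E i) / 2) ^ k))"
    by (rule suminf_finite) (auto simp: E_def)
  also have "\<dots> \<le> (\<Sum>i<card I. ennreal (unit_ball_vol (real k) * (D / 2) ^ k))"
  proof (rule sum_mono)
    fix i assume "i \<in> {..<card I}"
    then have i: "i < card I" by simp
    have b: "bounded (E i)" "diameter (E i) \<le> D" using assms(3)[OF fI[OF i]] i by (auto simp: E_def)
    have "unit_ball_vol (real k) * (diameter (E i) / 2) ^ k \<le> unit_ball_vol (real k) * (D / 2) ^ k"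
      using b diameter_ge_0[OF b(1)] by (intro mult_left_mono power_mono) (auto simp: unit_ball_vol_nonneg)
    then show "(if E i = {} then 0 else ennreal (unit_ball_vol (real k) * (diameter (E i) / 2) ^ k)) \<le> ennreal (unit_ball_vol (real k) * (D / 2) ^ k)"
      by (simp add: ennreal_leI)
  qed
  also have "\<dots> = ennreal (real (card I) * (unit_ball_vol (real k) * (D / 2) ^ k))"
    using assms(4) by (simp add: ennreal_mult unit_ball_vol_nonneg ennreal_of_nat_eq_real_of_nat)
  finally show ?thesis .
qed

text \<open>A point of the hyperplane orthogonal to \<open>e\<close> is determined by its coordinates other than one in
  which \<open>e\<close> does not vanish; this gives a grid of cells indexed by \<open>d - 1\<close> coordinates.\<close>

lemma hausdorff_outer_graph_finite:
  fixes A :: "'a::euclidean_space set"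
  assumes "bounded A" "norm e = 1" "M > 0" "\<And>x t. \<psi> (x + t *\<^sub>R e) = \<psi> x + t"
    "\<And>x y. \<bar>\<psi> x - \<psi> y\<bar> \<le> M * norm (x - y)" "\<And>x. x \<in> A \<Longrightarrow> \<psi> x = 0"
  shows "hausdorff_outer (DIM('a) - 1) A < \<infinity>"
proof -
  have ee: "e \<bullet> e = 1" using assms(2) by (simp add: norm_eq_1)
  then have "\<exists>i\<in>Basis. e \<bullet> i \<noteq> 0" using euclidean_all_zero_iff[of e] by force
  then obtain i where i: "i \<in> Basis" "e \<bullet> i \<noteq> 0" by blast
  define J where "J = Basis - {i}"
  have J: "finite J" "card J = DIM('a) - 1" using i by (auto simp: J_def)
  define P where "P x = x - (x \<bullet> e) *\<^sub>R e" for x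
  have Pe: "P x \<bullet> e = 0" for x by (simp add: P_def inner_diff_left ee)
  obtain D0 where D0: "\<And>x. x \<in> A \<Longrightarrow> norm x \<le> D0" using assms(1) by (auto simp: bounded_iff)
  define D where "D = 2 * (\<bar>D0\<bar> + 1)"
  have D: "D > 0" by (simp add: D_def)
  have PD: "\<bar>P x \<bullet> b\<bar> \<le> D" if "x \<in> A" "b \<in> Basis" for x b
  proof -
    have "\<bar>P x \<bullet> b\<bar> \<le> norm (P x)" by (rule Basis_le_norm[OF that(2)])
    also have "\<dots> \<le> norm x + norm ((x \<bullet> e) *\<^sub>R e)" unfolding P_def by (rule norm_triangle_ineq4)
    also have "norm ((x \<bullet> e) *\<^sub>R e) \<le> norm x" using Cauchy_Schwarz_ineq2[of x e] assms(2) by simp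
    finally show ?thesis using D0[OF that(1)] by (simp add: D_def)
  qed
  \<comment> \<open>Orthogonality to e expresses the i-coordinate through the others; the quotients
    are the coefficients of this relation.\<close>
  define C where "C = (\<Sum>b\<in>J. 1 + \<bar>e \<bullet> b\<bar> / \<bar>e \<bullet> i\<bar>)"
  have C: "C \<ge> 0" by (auto simp: C_def intro!: sum_nonneg)
  have Pclose: "norm (v) \<le> C * t" if "v \<bullet> e = 0" "\<And>b. b \<in> J \<Longrightarrow> \<bar>v \<bullet> b\<bar> \<le> t" for v t
  proof -
    have split: "(\<Sum>b\<in>Basis. f b) = f i + (\<Sum>b\<in>J. f b)" for f :: "'a \<Rightarrow> real"
      unfolding J_def using i by (simp add: sum.remove)
    have "0 = (v \<bullet> i) * (e \<bullet> i) + (\<Sum>b\<in>J. (v \<bullet> b) * (e \<bullet> b))"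
      using that(1) euclidean_inner[of v e] split by simp
    then have vi: "v \<bullet> i = - (\<Sum>b\<in>J. (v \<bullet> b) * (e \<bullet> b)) / (e \<bullet> i)" using i(2) by (simp add: field_simps)
    have "\<bar>v \<bullet> i\<bar> \<le> (\<Sum>b\<in>J. \<bar>v \<bullet> b\<bar> * \<bar>e \<bullet> b\<bar>) / \<bar>e \<bullet> i\<bar>"
      unfolding vi abs_divide abs_minus using sum_abs[of "\<lambda>b. (v \<bullet> b) * (e \<bullet> b)" J]
      by (intro divide_right_mono) (auto simp: abs_mult)
    also have "\<dots> = (\<Sum>b\<in>J. \<bar>v \<bullet> b\<bar> * (\<bar>e \<bullet> b\<bar> / \<bar>e \<bullet> i\<bar>))" by (simp add: sum_divide_distrib)
    also have "\<dots> \<le> (\<Sum>b\<in>J. t * (\<bar>e \<bullet> b\<bar> / \<bar>e \<bullet> i\<bar>))"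
      using that(2) by (intro sum_mono mult_right_mono) auto
    finally have 1: "\<bar>v \<bullet> i\<bar> \<le> (\<Sum>b\<in>J. t * (\<bar>e \<bullet> b\<bar> / \<bar>e \<bullet> i\<bar>))" .
    have "norm v \<le> \<bar>v \<bullet> i\<bar> + (\<Sum>b\<in>J. \<bar>v \<bullet> b\<bar>)" using norm_le_l1[of v] split by simp
    also have "\<dots> \<le> (\<Sum>b\<in>J. t * (\<bar>e \<bullet> b\<bar> / \<bar>e \<bullet> i\<bar>)) + (\<Sum>b\<in>J. t)"
      using 1 that(2) by (intro add_mono sum_mono) auto
    also have "\<dots> = C * t" by (simp add: C_def sum.distrib sum_distrib_left sum_distrib_right algebra_simps)
    finally show ?thesis .
  qed
  have close: "norm (x - y) \<le> (1 + M) * norm (P x - P y)" if "x \<in> A" "y \<in> A" for x y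
  proof -
    have h: "x \<bullet> e = - \<psi> (P x)" if "x \<in> A" for x
    proof -
      have "\<psi> (P x + (x \<bullet> e) *\<^sub>R e) = \<psi> (P x) + x \<bullet> e" by (rule assms(4))
      then show ?thesis using assms(6)[OF that] by (simp add: P_def)
    qed
    have "x - y = (P x - P y) + (x \<bullet> e - y \<bullet> e) *\<^sub>R e" by (simp add: P_def algebra_simps)
    then have "norm (x - y) \<le> norm (P x - P y) + \<bar>x \<bullet> e - y \<bullet> e\<bar>"
      using norm_triangle_ineq[of "P x - P y" "(x \<bullet> e - y \<bullet> e) *\<^sub>R e"] assms(2) by simp
    also have "\<bar>x \<bullet> e - y \<bullet> e\<bar> \<le> M * norm (P x - P y)"
      unfolding h[OF that(1)] h[OF that(2)] using assms(5)[of "P y" "P x"] by (simp add: norm_minus_commute)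
    finally show ?thesis by (simp add: algebra_simps)
  qed
  \<comment> \<open>Projections in one cell of mesh D/N differ by at most C * D/N, and the Lipschitz
    height multiplies distances by at most 1 + M; so cells have diameter at most K/N.\<close>
  define K where "K = (1 + M) * (C * D)"
  have K: "K \<ge> 0" using C D assms(3) by (simp add: K_def)
  let ?k = "DIM('a) - 1"
  have bound: "hausdorff_content ?k \<delta> A \<le> ennreal (unit_ball_vol (real ?k) * (3 * K) ^ ?k)" if \<delta>: "\<delta> > 0" for \<delta>
  proof -
    obtain N0 :: nat where N0: "K / \<delta> < real N0" using reals_Archimedean2 by blast
    define N where "N = N0 + 1"
    have N: "real N \<ge> 1" "K / real N \<le> \<delta>" using N0 \<delta> K by (auto simp: N_def field_simps)
    define I where "I = (\<Pi>\<^sub>E b\<in>J. {- int N..int N})"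
    have I: "finite I" "card I = (2 * N + 1) ^ ?k"
      unfolding I_def using J by (auto intro: finite_PiE simp: card_PiE nat_add_distrib nat_mult_distrib)
    define idx where "idx x = (\<lambda>b\<in>J. \<lfloor>real N * (P x \<bullet> b) / D\<rfloor>)" for x
    define c where "c k = {x \<in> A. idx x = k}" for k
    have cover: "A \<subseteq> (\<Union>k\<in>I. c k)"
    proof
      fix x assume x: "x \<in> A"
      have "\<lfloor>real N * (P x \<bullet> b) / D\<rfloor> \<in> {- int N..int N}" if b: "b \<in> J" for b
      proof -
        have "\<bar>P x \<bullet> b\<bar> \<le> D" using PD[OF x] b by (simp add: J_def)
        then have "\<bar>(P x \<bullet> b) / D\<bar> \<le> 1" using D by (simp add: abs_divide)
        then have "real N * \<bar>(P x \<bullet> b) / D\<bar> \<le> real N * 1" by (intro mult_left_mono) auto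
        then have "\<bar>real N * (P x \<bullet> b) / D\<bar> \<le> real N" by (simp add: abs_mult)
        then have "- real N \<le> real N * (P x \<bullet> b) / D \<and> real N * (P x \<bullet> b) / D \<le> real N"
          unfolding abs_le_iff by linarith
        then show ?thesis by (auto simp: le_floor_iff floor_le_iff simp del: times_divide_eq_left)
      qed
      then have "idx x \<in> I" unfolding I_def idx_def by auto
      then show "x \<in> (\<Union>k\<in>I. c k)" using x by (auto simp: c_def)
    qed
    have cells: "bounded (c k) \<and> diameter (c k) \<le> K / real N" for k
    proof
      show "bounded (c k)" by (rule bounded_subset[OF assms(1)]) (auto simp: c_def)
      show "diameter (c k) \<le> K / real N"
      proof (rule diameter_le)
        fix x y assume xy: "x \<in> c k" "y \<in> c k"
        have "\<bar>(P x - P y) \<bullet> b\<bar> \<le> D / real N" if b: "b \<in> J" for b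
        proof -
          have "idx x b = idx y b" using xy by (simp add: c_def)
          then have "\<lfloor>real N * (P x \<bullet> b) / D\<rfloor> = \<lfloor>real N * (P y \<bullet> b) / D\<rfloor>" using b by (simp add: idx_def)
          then have "\<bar>real N * (P x \<bullet> b) / D - real N * (P y \<bullet> b) / D\<bar> < 1" by linarith
          also have "real N * (P x \<bullet> b) / D - real N * (P y \<bullet> b) / D = (real N / D) * ((P x - P y) \<bullet> b)"
            using D by (simp add: inner_diff_left field_simps)
          finally have "(real N / D) * \<bar>(P x - P y) \<bullet> b\<bar> < 1" using D by (simp add: abs_mult)
          then show ?thesis using D N(1) by (simp add: field_simps)
        qed
        then have "norm (P x - P y) \<le> C * (D / real N)"
          by (intro Pclose) (auto simp: inner_diff_left Pe)
        then have "(1 + M) * norm (P x - P y) \<le> (1 + M) * (C * (D / real N))"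
          using assms(3) by (intro mult_left_mono) auto
        then show "norm (x - y) \<le> K / real N"
          using close[of x y] xy by (simp add: c_def K_def)
      qed (use K in simp)
    qed
    have "hausdorff_content ?k \<delta> A \<le> ennreal (real (card I) * (unit_ball_vol (real ?k) * (K / real N / 2) ^ ?k))"
      by (rule hausdorff_content_le[OF I(1) cover cells]) (use K N in auto)
    also have "\<dots> \<le> ennreal (unit_ball_vol (real ?k) * (3 * K) ^ ?k)"
    proof (rule ennreal_leI)
      \<comment> \<open>The number of cells grows like the k-th power of 2N + 1 while each
        contributes the k-th power of K/(2N); the product is bounded independently of N, thus of
        \<delta>.\<close>
      have "real (card I) * (K / real N / 2) ^ ?k = ((2 * real N + 1) * (K / real N / 2)) ^ ?k"
        by (simp only: I(2) of_nat_power power_mult_distrib of_nat_add of_nat_mult of_nat_numeral of_nat_1)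
      also have "\<dots> \<le> (3 * K) ^ ?k"
      proof (rule power_mono)
        have "(2 * real N + 1) * (K / real N / 2) \<le> (6 * real N) * (K / real N / 2)"
          using K N by (intro mult_right_mono) auto
        also have "\<dots> = 3 * K" using N by simp
        finally show "(2 * real N + 1) * (K / real N / 2) \<le> 3 * K" .
      qed (use K in auto)
      finally show "real (card I) * (unit_ball_vol (real ?k) * (K / real N / 2) ^ ?k) \<le> unit_ball_vol (real ?k) * (3 * K) ^ ?k"
        using mult_left_mono[of _ _ "unit_ball_vol (real ?k)"] unit_ball_vol_nonneg[of "real ?k"] by (simp add: mult.left_commute)
    qed
    finally show ?thesis .
  qed
  have "hausdorff_outer ?k A \<le> ennreal (unit_ball_vol (real ?k) * (3 * K) ^ ?k)"
    unfolding hausdorff_outer_def by (rule SUP_least) (use bound in auto)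
  also have "\<dots> < \<infinity>" by simp
  finally show ?thesis .
qed

lemma sets_measure_of_sets_borel [simp]: "sets (measure_of UNIV (sets borel) \<mu>) = sets borel"
proof -
  have "sets (measure_of UNIV (sets borel) \<mu>) = sigma_sets UNIV (sets borel)"
    by (rule sets_measure_of) simp
  also have "\<dots> = sets borel" using sets.sigma_sets_eq[of borel] by simp
  finally show ?thesis .
qed

lemma borel_measurable_surface_measure:
  "f \<in> borel_measurable borel \<Longrightarrow> f \<in> borel_measurable (surface_measure \<Omega>)"
  unfolding surface_measure_def
  by (auto intro!: measurable_restrict_space1 simp: measurable_cong_sets[OF sets_measure_of_sets_borel refl])

lemma space_surface_measure: "space (surface_measure \<Omega>) = frontier \<Omega>"
  by (simp add: surface_measure_def space_restrict_space space_measure_of_conv)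

lemma surface_measure_locally_finite:
  fixes \<Omega> :: "'a::euclidean_space set"
  assumes "admissible_domain \<Omega>" "boundary_chart \<Omega> z V e \<psi> M" "A \<subseteq> V \<inter> frontier \<Omega>" "bounded A"
  shows "emeasure (surface_measure \<Omega>) A < \<infinity>"
proof (cases "DIM('a) = 1")
  case True
  obtain a b where \<Omega>: "\<Omega> = box a b" "\<Omega> \<noteq> {}" using assms(1) True unfolding admissible_domain_def by auto
  obtain i :: 'a where i: "Basis = {i}" using Basis_DIM_1[OF True] by metis
  have "frontier \<Omega> \<subseteq> {a, b}"
  proof
    fix x assume "x \<in> frontier \<Omega>"
    then have f: "x \<in> frontier (box a b)" by (simp add: \<Omega>(1))
    have "x \<in> cbox a b" using f \<Omega> by (auto simp: frontier_def)
    moreover have "x \<notin> box a b" using f by (simp add: frontier_def interior_open[OF open_box])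
    ultimately have "x \<bullet> i = a \<bullet> i \<or> x \<bullet> i = b \<bullet> i" by (force simp: mem_box i)
    moreover have "x = c" if "x \<bullet> i = c \<bullet> i" for c
      by (rule euclidean_eqI) (simp add: i that)
    ultimately show "x \<in> {a, b}" by blast
  qed
  then have "finite A" "A \<subseteq> frontier \<Omega>" using assms(3) by (auto intro: finite_subset)
  then show ?thesis using True by (simp add: surface_measure_def emeasure_count_space ennreal_of_nat_eq_real_of_nat)
next
  case False
  let ?N = "measure_of UNIV (sets borel) (hausdorff_outer (DIM('a) - 1)) :: 'a measure"
  have "emeasure (surface_measure \<Omega>) A = emeasure ?N A"
    unfolding surface_measure_def using False assms(3)
    by (simp add: emeasure_restrict_space sets_measure_of_sets_borel)
  \<comment> \<open>\<open>measure_of\<close> returns either the given set function or 0, so the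
    outer measure is an upper bound in both cases.\<close>
  also have "\<dots> \<le> hausdorff_outer (DIM('a) - 1) A"
  proof -
    have "(if Q then x else 0) \<le> x" for Q and x :: ennreal by simp
    then show ?thesis unfolding emeasure_measure_of_conv .
  qed
  also have "\<dots> < \<infinity>"
    by (rule hausdorff_outer_graph_finite[OF assms(4), of e M \<psi>])
      (use assms(2,3) in \<open>auto simp: boundary_chart_def\<close>)
  finally show ?thesis .
qed

section \<open>Robin functions that are affine near a boundary point\<close>

definition smooth_exhaustion :: "'a::euclidean_space set \<Rightarrow> (nat \<Rightarrow> 'a \<Rightarrow> real) \<Rightarrow> bool" where
  "smooth_exhaustion \<Omega> \<eta> \<longleftrightarrow> (\<forall>n. (\<lambda>x. complex_of_real (\<eta> n x)) \<in> test_funs \<Omega>) \<and>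
    (\<forall>n x. 0 \<le> \<eta> n x \<and> \<eta> n x \<le> 1) \<and> (\<forall>x\<in>\<Omega>. \<forall>\<^sub>F n in sequentially. \<eta> n x = 1)"

text \<open>Countably many balls on which some cutoff equals 1 cover \<Omega>, by the Lindelof
  property. Combining the first n cutoffs smoothly gives a function that is 1 wherever one of them
  is.\<close>

lemma ex_smooth_exhaustion:
  fixes \<Omega> :: "'a::euclidean_space set"
  assumes "open \<Omega>"
  shows "\<exists>\<eta>. smooth_exhaustion \<Omega> \<eta>"
proof (cases "\<Omega> = {}")
  case True
  show ?thesis
    by (rule exI[of _ "\<lambda>_ _. 0"]) (simp add: smooth_exhaustion_def True test_funs_0)
next
  case False
  obtain F where F: "smooth F" "\<And>s. s \<le> 1/2 \<Longrightarrow> F s = 1" "\<And>s. s \<ge> 1 \<Longrightarrow> F s = 0" "\<And>s. 0 \<le> F s \<and> F s \<le> 1"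
    using ex_smooth_cutoff by metis
  have kF: "kernel F" using F(1,3) by (simp add: kernel_def)
  have "\<forall>x\<in>\<Omega>. \<exists>r>0. cball x r \<subseteq> \<Omega>" using assms open_contains_cball by metis
  then obtain r where r: "\<And>x. x \<in> \<Omega> \<Longrightarrow> r x > 0" "\<And>x. x \<in> \<Omega> \<Longrightarrow> cball x (r x) \<subseteq> \<Omega>" by metis
  let ?b = "\<lambda>x. ball x (r x / 2)"
  have "open S" if "S \<in> ?b ` \<Omega>" for S using that by auto
  from Lindelof[OF this]
  obtain \<F> where \<F>: "\<F> \<subseteq> ?b ` \<Omega>" "countable \<F>" "\<Union>\<F> = \<Union>(?b ` \<Omega>)" .
  then have "\<exists>C. countable C \<and> C \<subseteq> \<Omega> \<and> \<F> = ?b ` C"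
    using countable_subset_image[of \<F> ?b \<Omega>] by simp
  then obtain C where C: "countable C" "C \<subseteq> \<Omega>" "\<F> = ?b ` C" by (elim exE conjE) (rule that)
  have cover: "\<Omega> \<subseteq> (\<Union>x\<in>C. ?b x)"
    using \<F>(3) r(1) unfolding C(3) by force
  have Cne: "C \<noteq> {}" using cover False by auto
  define c where "c = from_nat_into C"
  have c: "range c = C" unfolding c_def by (rule range_from_nat_into[OF Cne C(1)])
  have c\<Omega>: "c n \<in> \<Omega>" for n using c C(2) by blast
  define \<kappa> where "\<kappa> n = radial F (c n) (r (c n))" for n
  \<comment> \<open>The recursion says that 1 - \<eta> is the product of the factors 1 - \<kappa>:
    the values stay in [0, 1], and once the value 1 is reached it is kept.\<close>
  define \<eta> where "\<eta> = rec_nat (\<lambda>_. 0) (\<lambda>n h x. h x + \<kappa> n x + (- h x) * \<kappa> n x)"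
  have \<eta>0: "\<eta> 0 x = 0" and \<eta>S: "\<eta> (Suc n) x = \<eta> n x + \<kappa> n x + (- \<eta> n x) * \<kappa> n x" for n x
    by (simp_all add: \<eta>_def)
  have \<kappa>t: "(\<lambda>x. complex_of_real (\<kappa> n x)) \<in> test_funs \<Omega>" for n
    unfolding \<kappa>_def by (rule radial_test_funs[OF kF r(1)[OF c\<Omega>] r(2)[OF c\<Omega>]])
  have \<kappa>01: "0 \<le> \<kappa> n x" "\<kappa> n x \<le> 1" for n x using F(4) by (auto simp: \<kappa>_def radial_def)
  have t: "(\<lambda>x. complex_of_real (\<eta> n x)) \<in> test_funs \<Omega>" for n
  proof (induction n)
    case 0
    then show ?case by (simp add: \<eta>0 test_funs_0)
  next
    case (Suc n)
    have "C_k k (\<lambda>x. - complex_of_real (\<eta> n x))" for k by (rule C_k_minus[OF test_funsD(1)[OF Suc]])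
    from test_funs_add[OF test_funs_add[OF Suc \<kappa>t[of n]] test_funs_mult[OF \<kappa>t[of n] this]]
    show ?case by (simp add: \<eta>S)
  qed
  have e01: "0 \<le> \<eta> n x \<and> \<eta> n x \<le> 1" for n x
  proof (induction n)
    case (Suc n)
    have "\<eta> (Suc n) x = 1 - (1 - \<eta> n x) * (1 - \<kappa> n x)" by (simp add: \<eta>S algebra_simps)
    moreover have "0 \<le> (1 - \<eta> n x) * (1 - \<kappa> n x)" using Suc \<kappa>01[of n x] by (intro mult_nonneg_nonneg) auto
    moreover have "(1 - \<eta> n x) * (1 - \<kappa> n x) \<le> 1" using Suc \<kappa>01[of n x] by (intro mult_le_one) auto
    ultimately show ?case by simp
  qed (simp add: \<eta>0)
  have ev: "\<forall>\<^sub>F n in sequentially. \<eta> n x = 1" if x: "x \<in> \<Omega>" for x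
  proof -
    obtain p where p: "p \<in> C" "x \<in> ball p (r p / 2)" using cover x by blast
    then obtain n where n: "p = c n" using c by blast
    have r0: "r p > 0" using r(1) p C(2) by blast
    have "(norm (x - p))\<^sup>2 \<le> (r p / 2)\<^sup>2" using p(2) by (intro power_mono) (auto simp: dist_norm norm_minus_commute)
    then have "(norm (x - p))\<^sup>2 \<le> (r p)\<^sup>2 / 4" by (simp add: power_divide)
    then have "(norm (x - p))\<^sup>2 \<le> 1/2 * (r p)\<^sup>2" using zero_le_power2[of "r p"] by linarith
    then have "(norm (x - p))\<^sup>2 / (r p)\<^sup>2 \<le> 1/2" using r0 by (simp add: pos_divide_le_eq)
    then have "\<kappa> n x = 1" unfolding \<kappa>_def radial_def n[symmetric] by (rule F(2))
    then have "\<eta> (Suc n) x = 1" by (simp add: \<eta>S)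
    then have "\<eta> (Suc n + k) x = 1" for k by (induction k) (auto simp: \<eta>S)
    then have "\<eta> m x = 1" if "m \<ge> Suc n" for m using that le_Suc_ex by metis
    then show ?thesis unfolding eventually_sequentially by blast
  qed
  show ?thesis by (rule exI[of _ \<eta>]) (simp add: smooth_exhaustion_def t e01 ev)
qed

section \<open>Weak identities tested up to the boundary\<close>

lemma L2_integrable:
  fixes f :: "'a::euclidean_space \<Rightarrow> complex"
  assumes "f \<in> L2 (lebesgue_on S)" "S \<in> lmeasurable"
  shows "integrable (lebesgue_on S) f"
proof -
  interpret finite_measure "lebesgue_on S" by (rule finite_measure_lebesgue_on[OF assms(2)])
  have "integrable (lebesgue_on S) (\<lambda>x. 1 + (norm (f x))\<^sup>2)"
    using assms(1) by (simp add: L2_def)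
  then show ?thesis
  proof (rule Bochner_Integration.integrable_bound)
    show "f \<in> borel_measurable (lebesgue_on S)" using assms(1) by (simp add: L2_def)
    have "norm (f x) \<le> 1 + (norm (f x))\<^sup>2" for x
    proof -
      have "2 * norm (f x) \<le> 1 + (norm (f x))\<^sup>2" using sum_squares_bound[of "norm (f x)" 1] by simp
      then show ?thesis using norm_ge_zero[of "f x"] by linarith
    qed
    then show "AE x in lebesgue_on S. norm (f x) \<le> norm (1 + (norm (f x))\<^sup>2)" by simp
  qed
qed

lemma integrable_mult_test_fun:
  assumes "integrable (lebesgue_on S) f" "\<psi> \<in> test_funs A"
  shows "integrable (lebesgue_on S) (\<lambda>x. f x * \<psi> x)"
proof -
  obtain B where B: "B \<ge> 0" "\<And>x. norm (\<psi> x) \<le> B" using test_funs_bounded[OF assms(2)] by metis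
  have m: "\<psi> \<in> borel_measurable (lebesgue_on S)"
    by (rule borel_measurable_lebesgue_onI[OF test_funs_measurable[OF assms(2)]])
  have bound: "norm (f x * \<psi> x) \<le> norm (B * norm (f x))" for x
    using mult_left_mono[OF B(2)[of x] norm_ge_zero[of "f x"]] B(1) by (simp add: norm_mult abs_mult mult.commute)
  show ?thesis
  proof (rule Bochner_Integration.integrable_bound[where f="\<lambda>x. B * norm (f x)"])
    show "integrable (lebesgue_on S) (\<lambda>x. B * norm (f x))"
      by (intro integrable_mult_right integrable_norm assms(1))
    show "(\<lambda>x. f x * \<psi> x) \<in> borel_measurable (lebesgue_on S)"
      by (intro borel_measurable_times borel_measurable_integrable[OF assms(1)] m)
  qed (rule AE_I2, rule bound)
qed

lemma LINT_exhaustion: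
  fixes \<eta> :: "nat \<Rightarrow> 'a::euclidean_space \<Rightarrow> real" and f :: "'a \<Rightarrow> complex"
  assumes "integrable (lebesgue_on \<Omega>) f" "\<psi> \<in> test_funs A" "smooth_exhaustion \<Omega> \<eta>"
  shows "(\<lambda>n. LINT x|lebesgue_on \<Omega>. f x * (complex_of_real (\<eta> n x) * \<psi> x)) \<longlonglongrightarrow> (LINT x|lebesgue_on \<Omega>. f x * \<psi> x)"
proof (rule integral_dominated_convergence[where w="\<lambda>x. norm (f x * \<psi> x)"])
  note I = integrable_mult_test_fun[OF assms(1,2)]
  have \<eta>: "(\<lambda>x. complex_of_real (\<eta> n x)) \<in> test_funs \<Omega>" "0 \<le> \<eta> n x" "\<eta> n x \<le> 1" for n x
    using assms(3) by (simp_all add: smooth_exhaustion_def)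
  show "(\<lambda>x. f x * \<psi> x) \<in> borel_measurable (lebesgue_on \<Omega>)" using I by (rule borel_measurable_integrable)
  show "integrable (lebesgue_on \<Omega>) (\<lambda>x. norm (f x * \<psi> x))" using I by (rule integrable_norm)
  fix n
  have "integrable (lebesgue_on \<Omega>) (\<lambda>x. f x * \<psi> x * complex_of_real (\<eta> n x))"
    by (rule integrable_mult_test_fun[OF I \<eta>(1)])
  then show "(\<lambda>x. f x * (complex_of_real (\<eta> n x) * \<psi> x)) \<in> borel_measurable (lebesgue_on \<Omega>)"
    by (simp add: borel_measurable_integrable mult_ac)
  have "norm (f x * (complex_of_real (\<eta> n x) * \<psi> x)) \<le> norm (f x * \<psi> x)" for x
  proof -
    have "\<eta> n x * norm (f x * \<psi> x) \<le> 1 * norm (f x * \<psi> x)" using \<eta>(3)[of n x] by (intro mult_right_mono) auto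
    then show ?thesis using \<eta>(2)[of n x] by (simp add: norm_mult mult_ac)
  qed
  then show "AE x in lebesgue_on \<Omega>. norm (f x * (complex_of_real (\<eta> n x) * \<psi> x)) \<le> norm (f x * \<psi> x)" by simp
next
  show "AE x in lebesgue_on \<Omega>. (\<lambda>n. f x * (complex_of_real (\<eta> n x) * \<psi> x)) \<longlonglongrightarrow> f x * \<psi> x"
  proof (rule AE_I2)
    fix x assume "x \<in> space (lebesgue_on \<Omega>)"
    then have "\<forall>\<^sub>F n in sequentially. \<eta> n x = 1" using assms(3) by (simp add: smooth_exhaustion_def)
    then show "(\<lambda>n. f x * (complex_of_real (\<eta> n x) * \<psi> x)) \<longlonglongrightarrow> f x * \<psi> x"
      by (intro tendsto_eventually) (auto elim: eventually_mono)
  qed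
qed

text \<open>Test functions of \<open>B\<close> need not vanish on the boundary of \<open>\<Omega>\<close>; the exhaustion makes the weak
  identities available for them wherever \<open>u\<close> is smooth up to the boundary.\<close>

lemma weak_gradient_smooth:
  fixes \<Omega> :: "'a::euclidean_space set"
  assumes \<Omega>: "open \<Omega>" "bounded \<Omega>" and grad: "has_weak_gradient \<Omega> u Du"
    and l: "\<And>k. C_k k l" "\<And>x. x \<in> \<Omega> \<inter> B \<Longrightarrow> u x = l x" and \<psi>: "\<psi> \<in> test_funs B" and b: "b \<in> Basis"
  shows "(LINT x|lebesgue_on \<Omega>. Du b x * \<psi> x) = (LINT x|lebesgue_on \<Omega>. pderiv_at b l x * \<psi> x)"
proof -
  have S: "\<Omega> \<in> sets lebesgue" "\<Omega> \<in> lmeasurable" using \<Omega> by (auto intro: bounded_set_imp_lmeasurable)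
  obtain \<eta> where \<eta>: "smooth_exhaustion \<Omega> \<eta>" using ex_smooth_exhaustion[OF \<Omega>(1)] ..
  then have \<eta>t: "(\<lambda>x. complex_of_real (\<eta> n x)) \<in> test_funs \<Omega>" for n
    by (simp add: smooth_exhaustion_def)
  have l': "C_k k (pderiv_at b l)" for k using l(1)[of "Suc k"] b by simp
  have Du: "integrable (lebesgue_on \<Omega>) (Du b)"
    by (rule L2_integrable[OF _ S(2)]) (use grad b in \<open>simp add: has_weak_gradient_def\<close>)
  have Dl: "integrable (lebesgue_on \<Omega>) (pderiv_at b l)"
  proof -
    have "compact (pderiv_at b l ` closure \<Omega>)"
      using \<Omega>(2) by (intro compact_continuous_image C_k_continuous[OF l'[of 0]]) (simp add: compact_closure)
    then obtain C where "\<forall>x\<in>closure \<Omega>. norm (pderiv_at b l x) \<le> C" by (auto dest!: compact_imp_bounded simp: bounded_iff)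
    then show ?thesis
      using closure_subset by (intro integrable_lebesgue_on_continuous[OF \<Omega>, of _ C] C_k_continuous[OF l'[of 0]]) blast
  qed
  have eq: "(LINT x|lebesgue_on \<Omega>. Du b x * (complex_of_real (\<eta> n x) * \<psi> x)) =
    (LINT x|lebesgue_on \<Omega>. pderiv_at b l x * (complex_of_real (\<eta> n x) * \<psi> x))" for n
  proof -
    define \<psi>n where "\<psi>n x = complex_of_real (\<eta> n x) * \<psi> x" for x
    \<comment> \<open>The product is supported in both sets: in \<Omega>, so the weak identity
      applies, and in B, where u may be replaced by l.\<close>
    have t: "\<psi>n \<in> test_funs (\<Omega> \<inter> B)" unfolding \<psi>n_def[abs_def] by (rule test_funs_inter[OF \<eta>t \<psi>])
    then have t\<Omega>: "\<psi>n \<in> test_funs \<Omega>" using test_funs_mono[of "\<Omega> \<inter> B" \<Omega>] by blast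
    have "(LINT x|lebesgue_on \<Omega>. Du b x * \<psi>n x) = - (LINT x|lebesgue_on \<Omega>. u x * pderiv_at b \<psi>n x)"
      using grad b t\<Omega> unfolding has_weak_gradient_def by simp
    also have "(LINT x|lebesgue_on \<Omega>. u x * pderiv_at b \<psi>n x) = (LINT x|lebesgue_on \<Omega>. l x * pderiv_at b \<psi>n x)"
    proof (rule Bochner_Integration.integral_cong[OF refl])
      fix x assume "x \<in> space (lebesgue_on \<Omega>)"
      then show "u x * pderiv_at b \<psi>n x = l x * pderiv_at b \<psi>n x"
        using l(2)[of x] test_funsD(4)[OF test_funs_pderiv[OF t b], of x] by (cases "x \<in> B") auto
    qed
    also have "\<dots> = - (LINT x|lebesgue_on \<Omega>. pderiv_at b l x * \<psi>n x)"
      by (rule integration_by_parts[OF l(1) t\<Omega> S(1) b])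
    finally show ?thesis unfolding \<psi>n_def by simp
  qed
  show ?thesis
    using LINT_exhaustion[OF Du \<psi> \<eta>] LINT_exhaustion[OF Dl \<psi> \<eta>] unfolding eq by (rule LIMSEQ_unique)
qed

text \<open>For the truncated test functions two integrations by parts leave the integral of a
  derivative of a test function, which is 0. The limit is taken only in the integral of w, so the
  derivatives of the exhaustion, which blow up near the boundary, need no estimate.\<close>

lemma distr_laplacian_affine:
  fixes \<Omega> :: "'a::euclidean_space set"
  assumes \<Omega>: "open \<Omega>" "bounded \<Omega>" and w: "w \<in> L2 (lebesgue_on \<Omega>)" "has_distr_laplacian \<Omega> u w"
    and l: "\<And>k. C_k k l" "\<And>x. x \<in> \<Omega> \<inter> B \<Longrightarrow> u x = l x" "\<And>b x. b \<in> Basis \<Longrightarrow> pderiv_at b l x = D b"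
    and \<psi>: "\<psi> \<in> test_funs B"
  shows "(LINT x|lebesgue_on \<Omega>. w x * \<psi> x) = 0"
proof -
  have S: "\<Omega> \<in> sets lebesgue" "\<Omega> \<in> lmeasurable" using \<Omega> by (auto intro: bounded_set_imp_lmeasurable)
  obtain \<eta> where \<eta>: "smooth_exhaustion \<Omega> \<eta>" using ex_smooth_exhaustion[OF \<Omega>(1)] ..
  then have \<eta>t: "(\<lambda>x. complex_of_real (\<eta> n x)) \<in> test_funs \<Omega>" for n
    by (simp add: smooth_exhaustion_def)
  have eq: "(LINT x|lebesgue_on \<Omega>. w x * (complex_of_real (\<eta> n x) * \<psi> x)) = 0" for n
  proof -
    define \<psi>n where "\<psi>n x = complex_of_real (\<eta> n x) * \<psi> x" for x
    have t: "\<psi>n \<in> test_funs (\<Omega> \<inter> B)" unfolding \<psi>n_def[abs_def] by (rule test_funs_inter[OF \<eta>t \<psi>])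
    then have t\<Omega>: "\<psi>n \<in> test_funs \<Omega>" using test_funs_mono[of "\<Omega> \<inter> B" \<Omega>] by blast
    have tt: "pderiv_at b (pderiv_at b \<psi>n) \<in> test_funs \<Omega>" if "b \<in> Basis" for b
      by (intro test_funs_pderiv t\<Omega> that)
    have "(LINT x|lebesgue_on \<Omega>. w x * \<psi>n x) = (LINT x|lebesgue_on \<Omega>. u x * laplacian \<psi>n x)"
      using w(2) t\<Omega> unfolding has_distr_laplacian_def by simp
    also have "\<dots> = (LINT x|lebesgue_on \<Omega>. l x * laplacian \<psi>n x)"
    proof (rule Bochner_Integration.integral_cong[OF refl])
      fix x assume "x \<in> space (lebesgue_on \<Omega>)"
      then show "u x * laplacian \<psi>n x = l x * laplacian \<psi>n x"
        using l(2)[of x] test_funsD(4)[OF test_funs_laplacian[OF t], of x] by (cases "x \<in> B") auto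
    qed
    also have "\<dots> = (\<Sum>b\<in>Basis. LINT x|lebesgue_on \<Omega>. l x * pderiv_at b (pderiv_at b \<psi>n) x)"
      unfolding laplacian_def sum_distrib_left
      by (intro Bochner_Integration.integral_sum test_funs_integrable[OF test_funs_mult[OF tt l(1)] S(1)])
    also have "\<dots> = (\<Sum>b\<in>(Basis :: 'a set). 0)"
    proof (intro sum.cong refl)
      fix b :: 'a assume b: "b \<in> Basis"
      have "(LINT x|lebesgue_on \<Omega>. l x * pderiv_at b (pderiv_at b \<psi>n) x) = - (LINT x|lebesgue_on \<Omega>. D b * pderiv_at b \<psi>n x)"
        using integration_by_parts[OF l(1) test_funs_pderiv[OF t\<Omega> b] S(1) b] by (simp add: l(3)[OF b])
      also have "(LINT x|lebesgue_on \<Omega>. D b * pderiv_at b \<psi>n x) = 0"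
        using LINT_pderiv_test_fun[OF t\<Omega> S(1) b] by simp
      finally show "(LINT x|lebesgue_on \<Omega>. l x * pderiv_at b (pderiv_at b \<psi>n) x) = 0" by simp
    qed
    finally show ?thesis unfolding \<psi>n_def by simp
  qed
  have "(\<lambda>n. 0) \<longlonglongrightarrow> (LINT x|lebesgue_on \<Omega>. w x * \<psi> x)"
    using LINT_exhaustion[OF L2_integrable[OF w(1) S(2)] \<psi> \<eta>] unfolding eq .
  then show ?thesis using LIMSEQ_unique[OF tendsto_const] by metis
qed

lemma test_funs_L2:
  assumes "v \<in> test_funs A" "S \<in> lmeasurable"
  shows "v \<in> L2 (lebesgue_on S)"
proof -
  obtain B where B: "B \<ge> 0" "\<And>x. norm (v x) \<le> B" using test_funs_bounded[OF assms(1)] by metis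
  have m: "v \<in> borel_measurable (lebesgue_on S)"
    by (rule borel_measurable_lebesgue_onI[OF test_funs_measurable[OF assms(1)]])
  have "integrable (lebesgue_on S) (\<lambda>x. (norm (v x))\<^sup>2)"
  proof (rule integrable_lebesgue_on_bounded[OF assms(2)])
    show "norm ((norm (v x))\<^sup>2) \<le> B\<^sup>2" for x using B by (simp add: power_mono)
  qed (use m in measurable)
  then show ?thesis using m by (simp add: L2_def)
qed

lemma test_funs_H1:
  fixes \<Omega> :: "'a::euclidean_space set"
  assumes "v \<in> test_funs A" "open \<Omega>" "bounded \<Omega>"
  shows "has_weak_gradient \<Omega> v (\<lambda>b. pderiv_at b v)" "v \<in> H1 \<Omega>"
proof -
  have S: "\<Omega> \<in> sets lebesgue" "\<Omega> \<in> lmeasurable" using assms by (auto intro: bounded_set_imp_lmeasurable)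
  show g: "has_weak_gradient \<Omega> v (\<lambda>b. pderiv_at b v)"
    unfolding has_weak_gradient_def
    using test_funs_L2[OF test_funs_pderiv[OF assms(1)] S(2)] integration_by_parts[OF test_funsD(1)[OF assms(1)] _ S(1)]
    by blast
  show "v \<in> H1 \<Omega>" unfolding H1_def using g test_funs_L2[OF assms(1) S(2)] by blast
qed

text \<open>The constant sequence v approximates itself; local finiteness of the surface measure
  provides square integrability on the boundary.\<close>

lemma test_funs_has_trace:
  fixes \<Omega> :: "'a::euclidean_space set"
  assumes v: "v \<in> test_funs (ball z \<rho>)" and \<Omega>: "open \<Omega>" "bounded \<Omega>"
    and fin: "emeasure (surface_measure \<Omega>) (ball z \<rho> \<inter> frontier \<Omega>) < \<infinity>"
  shows "has_trace \<Omega> v v"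
proof -
  obtain B where B: "B \<ge> 0" "\<And>x. norm (v x) \<le> B" using test_funs_bounded[OF v] by metis
  have m: "v \<in> borel_measurable (surface_measure \<Omega>)"
    by (rule borel_measurable_surface_measure[OF test_funs_measurable[OF v]])
  have "(indicator (ball z \<rho>) :: 'a \<Rightarrow> real) \<in> borel_measurable (surface_measure \<Omega>)"
    by (intro borel_measurable_surface_measure borel_measurable_indicator) simp
  then have sb: "ball z \<rho> \<inter> frontier \<Omega> \<in> sets (surface_measure \<Omega>)"
    by (simp add: borel_measurable_indicator_iff space_surface_measure)
  have "integrable (surface_measure \<Omega>) (\<lambda>x. B\<^sup>2 * indicator (ball z \<rho> \<inter> frontier \<Omega>) x :: real)"
    using sb fin by (intro integrable_mult_right integrable_real_indicator)
  then have "integrable (surface_measure \<Omega>) (\<lambda>x. (norm (v x))\<^sup>2)"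
  proof (rule Bochner_Integration.integrable_bound)
    show "AE x in surface_measure \<Omega>. norm ((norm (v x))\<^sup>2) \<le> norm (B\<^sup>2 * indicator (ball z \<rho> \<inter> frontier \<Omega>) x :: real)"
    proof (rule AE_I2)
      fix x assume "x \<in> space (surface_measure \<Omega>)"
      then show "norm ((norm (v x))\<^sup>2) \<le> norm (B\<^sup>2 * indicator (ball z \<rho> \<inter> frontier \<Omega>) x :: real)"
        using B test_funsD(4)[OF v, of x] by (cases "x \<in> ball z \<rho>") (auto simp: space_surface_measure power_mono)
    qed
  qed (use m in measurable)
  then have vL: "v \<in> L2 (surface_measure \<Omega>)" using m by (simp add: L2_def)
  note g = test_funs_H1[OF v \<Omega>]
  show ?thesis
    unfolding has_trace_def
    using g vL C_k_continuous[OF test_funsD(1)[OF v, of 0], of "closure \<Omega>"]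
    by (intro conjI exI[of _ "\<lambda>_. v"] exI[of _ "\<lambda>_ b. pderiv_at b v"] exI[of _ "\<lambda>b. pderiv_at b v"]) auto
qed

text \<open>In Green's formula against a test function supported near z, the weak gradient may be
  replaced by the constant gradient D and the Laplacian term vanishes; what remains links D and
  \<beta>.\<close>

lemma robin_affine_near_boundary:
  fixes \<Omega> :: "'a::euclidean_space set"
  assumes \<Omega>: "open \<Omega>" "bounded \<Omega>"
    and fin: "emeasure (surface_measure \<Omega>) (ball z \<rho> \<inter> frontier \<Omega>) < \<infinity>"
    and u: "u \<in> robin_domain \<Omega> \<beta>"
    and l: "\<And>k. C_k k l" "\<And>x. x \<in> closure \<Omega> \<inter> ball z \<rho> \<Longrightarrow> u x = l x" "\<And>b x. b \<in> Basis \<Longrightarrow> pderiv_at b l x = D b"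
    and v: "v \<in> test_funs (ball z \<rho>)"
  shows "(\<Sum>b\<in>Basis. D b * (LINT x|lebesgue_on \<Omega>. cnj (pderiv_at b v x))) =
    (LINT x|surface_measure \<Omega>. - complex_of_real (\<beta> x) * l x * cnj (v x))"
proof -
  have S: "\<Omega> \<in> sets lebesgue" "\<Omega> \<in> lmeasurable" using \<Omega> by (auto intro: bounded_set_imp_lmeasurable)
  have uH: "u \<in> H1 \<Omega>" and nd: "has_normal_derivative \<Omega> u (\<lambda>z. - complex_of_real (\<beta> z) * u z)"
    using u by (auto simp: robin_domain_def)
  from uH obtain Du where Du: "has_weak_gradient \<Omega> u Du" unfolding H1_def by blast
  from nd obtain w where w: "w \<in> L2 (lebesgue_on \<Omega>)" "has_distr_laplacian \<Omega> u w"
    and green: "\<forall>v\<in>H1 \<Omega>. \<forall>Du Dv g. has_weak_gradient \<Omega> u Du \<and> has_weak_gradient \<Omega> v Dv \<and> has_trace \<Omega> v g \<longrightarrow>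
      (LINT x|lebesgue_on \<Omega>. (\<Sum>b\<in>Basis. Du b x * cnj (Dv b x)) + w x * cnj (v x))
          = (LINT z|surface_measure \<Omega>. - complex_of_real (\<beta> z) * u z * cnj (g z))"
    unfolding has_normal_derivative_def by (elim conjE bexE) (rule that)
  have lu: "u x = l x" if "x \<in> \<Omega> \<inter> ball z \<rho>" for x using l(2) that closure_subset by blast
  have vc: "(\<lambda>x. cnj (v x)) \<in> test_funs (ball z \<rho>)" by (rule test_funs_cnj[OF v])
  have dc: "(\<lambda>x. cnj (pderiv_at b v x)) \<in> test_funs (ball z \<rho>)" if "b \<in> Basis" for b
    by (rule test_funs_cnj[OF test_funs_pderiv[OF v that]])
  have DuI: "integrable (lebesgue_on \<Omega>) (Du b)" if "b \<in> Basis" for b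
    by (rule L2_integrable[OF _ S(2)]) (use Du that in \<open>simp add: has_weak_gradient_def\<close>)
  have I: "integrable (lebesgue_on \<Omega>) (\<lambda>x. Du b x * cnj (pderiv_at b v x))" if "b \<in> Basis" for b
    by (rule integrable_mult_test_fun[OF DuI[OF that] dc[OF that]])
  have Iw: "integrable (lebesgue_on \<Omega>) (\<lambda>x. w x * cnj (v x))"
    by (rule integrable_mult_test_fun[OF L2_integrable[OF w(1) S(2)] vc])
  have "(\<Sum>b\<in>Basis. D b * (LINT x|lebesgue_on \<Omega>. cnj (pderiv_at b v x))) =
    (\<Sum>b\<in>Basis. LINT x|lebesgue_on \<Omega>. Du b x * cnj (pderiv_at b v x))"
  proof (intro sum.cong refl)
    fix b :: 'a assume b: "b \<in> Basis"
    have "(LINT x|lebesgue_on \<Omega>. Du b x * cnj (pderiv_at b v x)) = (LINT x|lebesgue_on \<Omega>. pderiv_at b l x * cnj (pderiv_at b v x))"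
      by (rule weak_gradient_smooth[OF \<Omega> Du l(1) lu dc[OF b] b])
    then show "D b * (LINT x|lebesgue_on \<Omega>. cnj (pderiv_at b v x)) = (LINT x|lebesgue_on \<Omega>. Du b x * cnj (pderiv_at b v x))"
      by (simp add: l(3)[OF b])
  qed
  also have "\<dots> = (LINT x|lebesgue_on \<Omega>. (\<Sum>b\<in>Basis. Du b x * cnj (pderiv_at b v x)))"
    by (rule Bochner_Integration.integral_sum[OF I, symmetric])
  also have "\<dots> = (LINT x|lebesgue_on \<Omega>. (\<Sum>b\<in>Basis. Du b x * cnj (pderiv_at b v x)) + w x * cnj (v x))"
  proof -
    have "integrable (lebesgue_on \<Omega>) (\<lambda>x. \<Sum>b\<in>Basis. Du b x * cnj (pderiv_at b v x))"
      by (rule Bochner_Integration.integrable_sum[OF I])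
    from Bochner_Integration.integral_add[OF this Iw] show ?thesis
      by (simp only: distr_laplacian_affine[OF \<Omega> w l(1) lu l(3) vc] add_0_right)
  qed
  also have "\<dots> = (LINT x|surface_measure \<Omega>. - complex_of_real (\<beta> x) * u x * cnj (v x))"
    using green[rule_format, OF test_funs_H1(2)[OF v \<Omega>], of Du "\<lambda>b. pderiv_at b v" v] Du test_funs_H1(1)[OF v \<Omega>]
      test_funs_has_trace[OF v \<Omega> fin] by blast
  also have "\<dots> = (LINT x|surface_measure \<Omega>. - complex_of_real (\<beta> x) * l x * cnj (v x))"
  proof (rule Bochner_Integration.integral_cong[OF refl])
    fix x assume "x \<in> space (surface_measure \<Omega>)"
    then have "x \<in> closure \<Omega>" by (simp add: space_surface_measure frontier_def)
    then show "- complex_of_real (\<beta> x) * u x * cnj (v x) = - complex_of_real (\<beta> x) * l x * cnj (v x)"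
      using l(2)[of x] test_funsD(4)[OF v, of x] by (cases "x \<in> ball z \<rho>") auto
  qed
  finally show ?thesis .
qed

lemma affine_pderiv:
  "pderiv_at b (\<lambda>x. c * complex_of_real (x \<bullet> e - s)) x = c * complex_of_real (b \<bullet> e)"
  by (rule pderiv_at_eq) (auto intro!: derivative_eq_intros)

lemma C_k_affine: "C_k k (\<lambda>x. c * complex_of_real (x \<bullet> e - s))"
  unfolding of_real_diff by (intro C_k_mult C_k_diff C_k_inner C_k_const)

text \<open>The constant function shows that \<beta> has zero boundary integral against every test
  function near z. In the identity for an affine function the affine factor can be moved into the
  test function, so its boundary term vanishes as well, and every partial derivative of a test
  function near z integrates to 0 over \<Omega>. Hence the integral of a bump over \<Omega> is
  constant as the bump moves from an exterior point q to an interior point a, although it is 0 at q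
  and positive at a.\<close>

lemma no_robin_affine_functions:
  fixes \<Omega> :: "'a::euclidean_space set"
  assumes adm: "admissible_domain \<Omega>" and z: "z \<in> frontier \<Omega>" and \<rho>: "\<rho> > 0" and c: "c \<noteq> 0"
    and u0: "u0 \<in> robin_domain \<Omega> \<beta>" "\<And>x. x \<in> closure \<Omega> \<inter> ball z \<rho> \<Longrightarrow> u0 x = c"
    and ue: "\<And>e. \<exists>u s. u \<in> robin_domain \<Omega> \<beta> \<and> (\<forall>x\<in>closure \<Omega> \<inter> ball z \<rho>. u x = c * complex_of_real (x \<bullet> e - s))"
  shows False
proof -
  note \<Omega> = admissible_domain_basic(1,2)[OF adm]
  have S: "\<Omega> \<in> sets lebesgue" using \<Omega> by simp
  obtain V e0 \<psi> M where chart: "boundary_chart \<Omega> z V e0 \<psi> M" using admissible_domain_chart[OF adm z] by metis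
  then have "open V" "z \<in> V" by (auto simp: boundary_chart_def)
  then obtain d where d: "d > 0" "ball z d \<subseteq> V" using open_contains_ball by metis
  define R where "R = min \<rho> d"
  have R: "R > 0" "R \<le> \<rho>" "ball z R \<subseteq> V" using \<rho> d by (auto simp: R_def)
  have fin: "emeasure (surface_measure \<Omega>) (ball z R \<inter> frontier \<Omega>) < \<infinity>"
    by (rule surface_measure_locally_finite[OF adm chart]) (use R(3) in auto)
  have sub: "closure \<Omega> \<inter> ball z R \<subseteq> closure \<Omega> \<inter> ball z \<rho>" using R(2) by auto
  have bdry0: "(LINT x|surface_measure \<Omega>. - complex_of_real (\<beta> x) * c * cnj (v x)) = 0" if "v \<in> test_funs (ball z R)" for v
  proof -
    have "(\<Sum>b\<in>Basis. 0 * (LINT x|lebesgue_on \<Omega>. cnj (pderiv_at b v x))) =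
      (LINT x|surface_measure \<Omega>. - complex_of_real (\<beta> x) * c * cnj (v x))"
      by (rule robin_affine_near_boundary[OF \<Omega> fin u0(1) _ _ _ that])
        (use u0(2) sub pderiv_at_eq[OF has_derivative_const] in auto)
    then show ?thesis by simp
  qed
  have grad0: "(LINT x|lebesgue_on \<Omega>. pderiv_at b v x) = 0" if v: "v \<in> test_funs (ball z R)" and b: "b \<in> Basis" for v b
  proof -
    obtain u s where u: "u \<in> robin_domain \<Omega> \<beta>" "\<forall>x\<in>closure \<Omega> \<inter> ball z \<rho>. u x = c * complex_of_real (x \<bullet> b - s)"
      using ue[of b] by metis
    \<comment> \<open>The affine factor is real, so it passes through the conjugation and can be
      absorbed into the test function.\<close>
    have v': "(\<lambda>x. complex_of_real (x \<bullet> b - s) * v x) \<in> test_funs (ball z R)"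
      using test_funs_mult[OF v C_k_affine[of _ 1 b s]] by simp
    have "(\<Sum>b'\<in>Basis. c * complex_of_real (b' \<bullet> b) * (LINT x|lebesgue_on \<Omega>. cnj (pderiv_at b' v x))) =
      (LINT x|surface_measure \<Omega>. - complex_of_real (\<beta> x) * (c * complex_of_real (x \<bullet> b - s)) * cnj (v x))"
      by (rule robin_affine_near_boundary[OF \<Omega> fin u(1) C_k_affine _ affine_pderiv v]) (use u(2) sub in blast)
    also have "\<dots> = (LINT x|surface_measure \<Omega>. - complex_of_real (\<beta> x) * c * cnj (complex_of_real (x \<bullet> b - s) * v x))"
      by (intro Bochner_Integration.integral_cong refl) simp
    also have "\<dots> = 0" by (rule bdry0[OF v'])
    finally have "(\<Sum>b'\<in>Basis. c * complex_of_real (b' \<bullet> b) * (LINT x|lebesgue_on \<Omega>. cnj (pderiv_at b' v x))) = 0" .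
    moreover have "(\<Sum>b'\<in>Basis. c * complex_of_real (b' \<bullet> b) * (LINT x|lebesgue_on \<Omega>. cnj (pderiv_at b' v x))) =
      (\<Sum>b'\<in>Basis. if b' = b then c * (LINT x|lebesgue_on \<Omega>. cnj (pderiv_at b v x)) else 0)"
      by (intro sum.cong refl) (use b in \<open>auto simp: inner_Basis\<close>)
    ultimately have "(LINT x|lebesgue_on \<Omega>. cnj (pderiv_at b v x)) = 0" using b c by simp
    then show ?thesis by simp
  qed
  obtain q where q: "q \<in> ball z R" "q \<notin> closure \<Omega>" using boundary_exterior_point[OF chart R(1)] by metis
  obtain a where a: "a \<in> ball z R" "a \<in> \<Omega>"
  proof -
    have "z \<in> closure \<Omega>" using z by (simp add: frontier_def)
    then show ?thesis using R(1) that unfolding closure_approachable by (metis dist_commute mem_ball)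
  qed
  define M0 where "M0 = max (dist z a) (dist z q)"
  have M0: "M0 < R" using a(1) q(1) by (simp add: M0_def)
  obtain r1 where r1: "r1 > 0" "cball a r1 \<subseteq> \<Omega>" using a(2) \<Omega>(1) open_contains_cball by metis
  obtain r2 where r2: "r2 > 0" "cball q r2 \<inter> closure \<Omega> = {}"
  proof -
    have "open (- closure \<Omega>)" "q \<in> - closure \<Omega>" using q(2) by auto
    then obtain r2 where "r2 > 0" "cball q r2 \<subseteq> - closure \<Omega>" using open_contains_cball by metis
    then show ?thesis by (intro that) auto
  qed
  \<comment> \<open>The bump must lie in \<Omega> when centred at a and miss the closure when
    centred at q. The third of the margin leaves room for its radius and for the overshoot of the
    path beyond both ends.\<close>
  define r where "r = min (min r1 r2) ((R - M0) / 3)"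
  have r: "r > 0" "r \<le> r1" "r \<le> r2" "3 * r \<le> R - M0"
  proof -
    show "r > 0" "r \<le> r1" "r \<le> r2" using r1 r2 M0 by (auto simp: r_def)
    have "r \<le> (R - M0) / 3" unfolding r_def by (rule min.cobounded2)
    then show "3 * r \<le> R - M0" by simp
  qed
  define e where "e = a - q"
  \<comment> \<open>The path overshoots by at most r at either end, so that the parameters 0 and 1
    are interior to the interval of differentiation.\<close>
  define k where "k = r / (norm e + 1)"
  have n1: "norm e + 1 > 0" using norm_ge_zero[of e] by linarith
  have k: "k > 0" "k * norm e \<le> r"
  proof -
    show "k > 0" using r n1 by (simp add: k_def)
    then have "k * norm e \<le> k * (norm e + 1)" by simp
    also have "\<dots> = r" using n1 by (simp add: k_def)
    finally show "k * norm e \<le> r" .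
  qed
  define y where "y t = q + t *\<^sub>R e" for t
  have ysub: "cball (y t) r \<subseteq> ball z R" if t: "t \<in> {-k<..<1 + k}" for t
  proof
    fix x assume x: "x \<in> cball (y t) r"
    \<comment> \<open>The nearest parameter of the segment proper, which by convexity stays within
      M0 of z.\<close>
    define t' where "t' = min 1 (max 0 t)"
    have t': "t' \<in> {0..1}" "\<bar>t - t'\<bar> \<le> k" using t k(1) by (auto simp: t'_def min_def max_def)
    have "y t' \<in> closed_segment q a"
      unfolding closed_segment_def y_def e_def using t'(1) by (auto intro!: exI[of _ t'] simp: algebra_simps)
    also have "closed_segment q a \<subseteq> cball z M0" by (rule closed_segment_subset) (auto simp: M0_def)
    finally have 1: "dist z (y t') \<le> M0" by simp
    have "y t' - y t = (t' - t) *\<^sub>R e" by (simp add: y_def algebra_simps)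
    then have "dist (y t') (y t) = \<bar>t - t'\<bar> * norm e" by (simp add: dist_norm abs_minus_commute)
    also have "\<dots> \<le> k * norm e" using t'(2) by (intro mult_right_mono) auto
    finally have 2: "dist (y t') (y t) \<le> r" using k(2) by simp
    have "dist z x \<le> dist z (y t') + dist (y t') (y t) + dist (y t) x"
      using dist_triangle[of z x "y t'"] dist_triangle[of "y t'" x "y t"] by linarith
    also have "\<dots> \<le> M0 + r + r" using 1 2 x by auto
    also have "\<dots> < R" using r by simp
    finally show "x \<in> ball z R" by simp
  qed
  obtain g' where g': "kernel g'" "\<And>s. (bump has_real_derivative g' s) (at s)"
    using kernel_deriv[OF kernel_bump] by metis
  define F where "F t = (LINT x|lebesgue_on \<Omega>. 1 * complex_of_real (radial bump (y t) r x))" for t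
  have "(F has_vector_derivative 0) (at t)" if t: "t \<in> {-k<..<1 + k}" for t
  proof -
    have I1: "integrable (lebesgue_on \<Omega>) (\<lambda>_. 1 :: complex)"
      by (rule integrable_lebesgue_on_continuous[OF \<Omega>, of _ 1]) auto
    have "(F has_vector_derivative (LINT x|lebesgue_on \<Omega>. 1 * complex_of_real (radial g' (y t) r x * (- 2 * ((x - y t) \<bullet> e) / r\<^sup>2)))) (at t)"
      unfolding F_def[abs_def] y_def
      by (rule has_vector_derivative_LINT_translate[OF kernel_bump g' I1 \<Omega>(2) r(1)])
    also have "(LINT x|lebesgue_on \<Omega>. 1 * complex_of_real (radial g' (y t) r x * (- 2 * ((x - y t) \<bullet> e) / r\<^sup>2))) = 0"
    proof -
      let ?v = "\<lambda>x. complex_of_real (radial bump (y t) r x)"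
      have v: "?v \<in> test_funs (ball z R)" by (rule radial_test_funs[OF kernel_bump r(1) ysub[OF t]])
      have p: "pderiv_at b ?v x = complex_of_real (radial g' (y t) r x * (2 * ((x - y t) \<bullet> b) / r\<^sup>2))" for b x
        by (rule pderiv_at_eq[OF radial_has_derivative[OF g'(2)]])
      have "1 * complex_of_real (radial g' (y t) r x * (- 2 * ((x - y t) \<bullet> e) / r\<^sup>2)) =
        (\<Sum>b\<in>Basis. complex_of_real (- (e \<bullet> b)) * pderiv_at b ?v x)" for x
      proof -
        have "(x - y t) \<bullet> e = (\<Sum>b\<in>Basis. ((x - y t) \<bullet> b) * (e \<bullet> b))" by (rule euclidean_inner)
        then have "radial g' (y t) r x * (- 2 * ((x - y t) \<bullet> e) / r\<^sup>2) =
          (\<Sum>b\<in>Basis. - (e \<bullet> b) * (radial g' (y t) r x * (2 * ((x - y t) \<bullet> b) / r\<^sup>2)))"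
          by (simp add: sum_distrib_left sum_divide_distrib sum_negf mult_ac)
        then show ?thesis unfolding p by (simp only: mult_1 of_real_mult[symmetric] of_real_sum[symmetric])
      qed
      then have "(LINT x|lebesgue_on \<Omega>. 1 * complex_of_real (radial g' (y t) r x * (- 2 * ((x - y t) \<bullet> e) / r\<^sup>2))) =
        (LINT x|lebesgue_on \<Omega>. (\<Sum>b\<in>Basis. complex_of_real (- (e \<bullet> b)) * pderiv_at b ?v x))" by (simp only:)
      also have "\<dots> = (\<Sum>b\<in>Basis. LINT x|lebesgue_on \<Omega>. complex_of_real (- (e \<bullet> b)) * pderiv_at b ?v x)"
        by (intro Bochner_Integration.integral_sum integrable_mult_right test_funs_integrable[OF test_funs_pderiv[OF v] S])
      also have "\<dots> = (\<Sum>b\<in>Basis. complex_of_real (- (e \<bullet> b)) * (LINT x|lebesgue_on \<Omega>. pderiv_at b ?v x))"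
        by (simp only: integral_mult_right_zero)
      also have "\<dots> = (\<Sum>b\<in>(Basis :: 'a set). 0)"
        by (intro sum.cong refl) (simp only: grad0[OF v] mult_zero_right)
      finally show ?thesis by simp
    qed
    finally show ?thesis .
  qed
  then have "F 1 = F 0"
    by (rule const_of_zero_vector_derivative[where T="{-k<..<1 + k}" and F=F]) (use k in auto)
  moreover have "F 0 = 0"
  proof -
    have "F 0 = (LINT x|lebesgue_on \<Omega>. 0)"
      unfolding F_def
    proof (rule Bochner_Integration.integral_cong[OF refl])
      fix x assume "x \<in> space (lebesgue_on \<Omega>)"
      then have "x \<in> closure \<Omega>" using closure_subset by auto
      then have "x \<notin> cball q r2" using r2(2) by blast
      then have "x \<notin> ball (y 0) r" using r(3) by (auto simp: y_def)
      then show "1 * complex_of_real (radial bump (y 0) r x) = 0"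
        using radial_zero[OF kernel_bump r(1), of x "y 0"] by simp
    qed
    then show ?thesis by simp
  qed
  ultimately have "(LINT x|lebesgue_on \<Omega>. complex_of_real (radial bump a r x)) = 0"
    unfolding F_def by (simp add: y_def e_def)
  then have L0: "(LINT x|lebesgue_on \<Omega>. radial bump a r x) \<le> 0"
    by (simp add: integral_complex_of_real)
  have asub: "cball a r \<subseteq> \<Omega>" using r1(2) r(2) by auto
  have "integrable (lebesgue_on \<Omega>) (\<lambda>x. complex_of_real (radial bump a r x))"
    by (rule test_funs_integrable[OF radial_test_funs[OF kernel_bump r(1) asub] S])
  from integrable_Re[OF this] have I: "integrable (lebesgue_on \<Omega>) (radial bump a r)" by simp
  have "radial bump a r a = 0"
  proof (rule continuous_AE_zero[OF \<Omega>(1) kernel_continuous_on[OF kernel_bump] I _ L0 a(2)])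
    show "radial bump a r x \<ge> 0" for x by (simp add: radial_def bump_def expinv_1_nonneg)
  qed
  then show False using radial_bump_pos[of a a r] r(1) by simp
qed

section \<open>Weighted compositions intertwining the Laplacians\<close>

lemma has_distr_laplacian_local:
  assumes "has_distr_laplacian \<Omega> u v" "\<Omega> \<in> sets lebesgue" "B \<in> sets lebesgue" "B \<subseteq> \<Omega>"
    "\<And>x. x \<in> B \<Longrightarrow> u x = u' x" "\<And>x. x \<in> B \<Longrightarrow> v x = v' x"
  shows "has_distr_laplacian B u' v'"
  unfolding has_distr_laplacian_def
proof
  fix \<phi> assume \<phi>: "\<phi> \<in> test_funs B"
  have eq: "(LINT x|lebesgue_on B. h' x * \<psi> x) = (LINT x|lebesgue_on \<Omega>. h x * \<psi> x)"
    if "\<psi> \<in> test_funs B" "\<And>x. x \<in> B \<Longrightarrow> h x = h' x" for h h' \<psi>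
  proof -
    have "(LINT x|lebesgue_on B. h' x * \<psi> x) = (LINT x|lebesgue_on B. h x * \<psi> x)"
      by (rule Bochner_Integration.integral_cong[OF refl]) (use that(2) in simp)
    also have "\<dots> = (LINT x|lebesgue_on \<Omega>. h x * \<psi> x)"
      by (rule LINT_lebesgue_on_mono[symmetric, OF assms(3,2,4)]) (use test_funsD(4)[OF that(1)] in simp)
    finally show ?thesis .
  qed
  have "(LINT x|lebesgue_on B. u' x * laplacian \<phi> x) = (LINT x|lebesgue_on \<Omega>. u x * laplacian \<phi> x)"
    by (rule eq[OF test_funs_laplacian[OF \<phi>] assms(5)])
  also have "\<dots> = (LINT x|lebesgue_on \<Omega>. v x * \<phi> x)"
    using assms(1) \<phi> test_funs_mono[OF assms(4)] unfolding has_distr_laplacian_def by blast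
  also have "\<dots> = (LINT x|lebesgue_on B. v' x * \<phi> x)"
    by (rule eq[OF \<phi> assms(6), symmetric])
  finally show "(LINT x|lebesgue_on B. u' x * laplacian \<phi> x) = (LINT x|lebesgue_on B. v' x * \<phi> x)" .
qed

text \<open>Differentiating twice along b brings out the square of \<open>\<xi> \<bullet> b\<close>,
  and these squares sum to \<open>\<xi> \<bullet> \<xi>\<close>. For m at most 1 the factor m * (m -
  1) is 0, which covers the truncated exponent.\<close>

lemma laplacian_ridge:
  "laplacian (\<lambda>x. complex_of_real ((\<xi> \<bullet> x - s) ^ m)) x =
    complex_of_real (real (m * (m - 1)) * (\<xi> \<bullet> \<xi>)) * complex_of_real ((\<xi> \<bullet> x - s) ^ (m - 2))"
proof -
  have d: "((\<lambda>x. complex_of_real ((\<xi> \<bullet> x - s) ^ k)) has_derivative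
      (\<lambda>h. complex_of_real (real k * (\<xi> \<bullet> h) * (\<xi> \<bullet> x - s) ^ (k - 1)))) (at x)" for k x
    by (auto intro!: derivative_eq_intros simp: mult_ac)
  have p: "pderiv_at b (\<lambda>x. complex_of_real ((\<xi> \<bullet> x - s) ^ k)) =
      (\<lambda>x. complex_of_real (real k * (\<xi> \<bullet> b)) * complex_of_real ((\<xi> \<bullet> x - s) ^ (k - 1)))" for k b
    by (rule ext, subst pderiv_at_eq[OF d]) simp
  have pp: "pderiv_at b (pderiv_at b (\<lambda>x. complex_of_real ((\<xi> \<bullet> x - s) ^ m))) x =
      complex_of_real (real (m * (m - 1)) * (\<xi> \<bullet> b)\<^sup>2 * (\<xi> \<bullet> x - s) ^ (m - 2))" for b
  proof -
    have "pderiv_at b (pderiv_at b (\<lambda>x. complex_of_real ((\<xi> \<bullet> x - s) ^ m))) x =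
      complex_of_real (real m * (\<xi> \<bullet> b)) * complex_of_real (real (m - 1) * (\<xi> \<bullet> b) * (\<xi> \<bullet> x - s) ^ (m - 1 - 1))"
      unfolding p by (rule pderiv_at_eq[OF has_derivative_mult_right[OF d]])
    then show ?thesis by (simp add: power2_eq_square numeral_2_eq_2)
  qed
  have "(\<Sum>b\<in>Basis. (\<xi> \<bullet> b)\<^sup>2) = \<xi> \<bullet> \<xi>"
    by (simp add: norm_sq_eq_sum_Basis[symmetric] power2_norm_eq_inner)
  then have "(\<Sum>b\<in>Basis. real (m * (m - 1)) * (\<xi> \<bullet> b)\<^sup>2 * (\<xi> \<bullet> x - s) ^ (m - 2)) =
      real (m * (m - 1)) * (\<xi> \<bullet> \<xi>) * (\<xi> \<bullet> x - s) ^ (m - 2)"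
    by (simp only: sum_distrib_left[symmetric] sum_distrib_right[symmetric])
  then show ?thesis
    unfolding laplacian_def pp of_real_sum[symmetric] by (simp only: of_real_mult)
qed

lemma ex_test_fun_one_on_ball:
  fixes p :: "'a::euclidean_space"
  assumes "\<delta> > 0" "cball p \<delta> \<subseteq> \<Omega>"
  shows "\<exists>\<theta>\<in>test_funs \<Omega>. \<forall>x\<in>ball p (\<delta> / 2). \<theta> x = 1"
proof -
  obtain F where F: "smooth F" "\<And>s. s \<le> 1/2 \<Longrightarrow> F s = 1" "\<And>s. s \<ge> 1 \<Longrightarrow> F s = 0" "\<And>s. 0 \<le> F s \<and> F s \<le> 1"
    using ex_smooth_cutoff by metis
  have kF: "kernel F" using F(1,3) by (simp add: kernel_def)
  let ?\<theta> = "\<lambda>x. complex_of_real (radial F p \<delta> x)"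
  have t: "?\<theta> \<in> test_funs \<Omega>" by (rule radial_test_funs[OF kF assms])
  have "?\<theta> x = 1" if x: "x \<in> ball p (\<delta> / 2)" for x
  proof -
    have "(norm (x - p))\<^sup>2 \<le> (\<delta> / 2)\<^sup>2" using x by (intro power_mono) (auto simp: dist_norm norm_minus_commute)
    then have "(norm (x - p))\<^sup>2 \<le> \<delta>\<^sup>2 / 4" by (simp add: power_divide)
    then have "(norm (x - p))\<^sup>2 \<le> 1/2 * \<delta>\<^sup>2" using zero_le_power2[of "\<delta>"] by linarith
    then have "(norm (x - p))\<^sup>2 / \<delta>\<^sup>2 \<le> 1/2" using assms(1) by (simp add: pos_divide_le_eq)
    then show ?thesis unfolding radial_def by (simp add: F(2))
  qed
  then show ?thesis using t by (intro bexI[of _ ?\<theta>] ballI)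
qed

locale intertwining_composition =
  fixes \<Omega>1 \<Omega>2 :: "'a::euclidean_space set" and w :: "'a \<Rightarrow> complex" and \<tau> :: "'a \<Rightarrow> 'a" and \<beta> :: "'a \<Rightarrow> real"
  assumes adm1: "admissible_domain \<Omega>1" and adm2: "admissible_domain \<Omega>2"
    and w: "w \<in> cont_funs (closure \<Omega>2)" and \<tau>_in: "\<And>y. \<tau> y \<in> closure \<Omega>1"
    and \<tau>_cont: "continuous_on {y \<in> closure \<Omega>2. w y \<noteq> 0} \<tau>"
    and robin: "\<And>f. f \<in> test_funs \<Omega>1 \<Longrightarrow> (\<lambda>y. w y * f (\<tau> y)) \<in> robin_domain \<Omega>2 \<beta>"
    and intertwining: "\<And>f. f \<in> test_funs \<Omega>1 \<Longrightarrow>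
      has_distr_laplacian \<Omega>2 (\<lambda>y. w y * f (\<tau> y)) (\<lambda>y. w y * laplacian f (\<tau> y))"
    and nondegenerate: "\<And>\<omega>. open \<omega> \<Longrightarrow> \<omega> \<subseteq> \<Omega>2 \<Longrightarrow>
      (\<And>f y. f \<in> test_funs \<Omega>1 \<Longrightarrow> y \<in> \<omega> \<Longrightarrow> w y * f (\<tau> y) = 0) \<Longrightarrow> \<omega> = {}"
begin

lemmas dom1 = admissible_domain_basic[OF adm1]
lemmas dom2 = admissible_domain_basic[OF adm2]

lemma w_cont: "continuous_on (closure \<Omega>2) w" using w by (simp add: cont_funs_def)

definition W where "W = {y \<in> \<Omega>2. w y \<noteq> 0 \<and> \<tau> y \<in> \<Omega>1}"

lemma near:
  assumes "p \<in> closure \<Omega>2" "w p \<noteq> 0" "\<delta> > 0" "\<delta>' > 0"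
  obtains \<epsilon> where "\<epsilon> > 0" "\<And>x. x \<in> closure \<Omega>2 \<Longrightarrow> x \<in> ball p \<epsilon> \<Longrightarrow> w x \<noteq> 0 \<and> norm (w x - w p) < \<delta>' \<and> \<tau> x \<in> ball (\<tau> p) \<delta>"
proof -
  have "min \<delta>' (norm (w p)) > 0" using assms by simp
  then obtain e1 where e1: "e1 > 0" "\<And>x. x \<in> closure \<Omega>2 \<Longrightarrow> dist x p < e1 \<Longrightarrow> dist (w x) (w p) < min \<delta>' (norm (w p))"
    using w_cont assms(1) unfolding continuous_on_iff by metis
  obtain e2 where e2: "e2 > 0" "\<And>x. x \<in> {y \<in> closure \<Omega>2. w y \<noteq> 0} \<Longrightarrow> dist x p < e2 \<Longrightarrow> dist (\<tau> x) (\<tau> p) < \<delta>"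
    using \<tau>_cont assms(1,2,3) unfolding continuous_on_iff by (metis (mono_tags, lifting) mem_Collect_eq)
  show ?thesis
  proof (rule that[of "min e1 e2"])
    fix x assume x: "x \<in> closure \<Omega>2" "x \<in> ball p (min e1 e2)"
    then have d: "dist x p < e1" "dist x p < e2" by (auto simp: dist_commute)
    have 1: "dist (w x) (w p) < min \<delta>' (norm (w p))" by (rule e1(2)[OF x(1) d(1)])
    then have nz: "w x \<noteq> 0" by (auto simp: dist_norm)
    then show "w x \<noteq> 0 \<and> norm (w x - w p) < \<delta>' \<and> \<tau> x \<in> ball (\<tau> p) \<delta>"
      using 1 e2(2)[OF _ d(2)] x(1) by (simp add: dist_norm norm_minus_commute)
  qed (use e1 e2 in auto)
qed

lemma open_W: "open W"
  unfolding open_contains_ball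
proof
  fix p assume "p \<in> W"
  then have p: "p \<in> \<Omega>2" "w p \<noteq> 0" "\<tau> p \<in> \<Omega>1" by (auto simp: W_def)
  obtain \<delta> where \<delta>: "\<delta> > 0" "ball (\<tau> p) \<delta> \<subseteq> \<Omega>1" using p(3) dom1(1) open_contains_ball by metis
  obtain d where d: "d > 0" "ball p d \<subseteq> \<Omega>2" using p(1) dom2(1) open_contains_ball by metis
  have "p \<in> closure \<Omega>2" using p(1) closure_subset by blast
  then obtain \<epsilon> where \<epsilon>: "\<epsilon> > 0" "\<And>x. x \<in> closure \<Omega>2 \<Longrightarrow> x \<in> ball p \<epsilon> \<Longrightarrow> w x \<noteq> 0 \<and> norm (w x - w p) < 1 \<and> \<tau> x \<in> ball (\<tau> p) \<delta>"
    using near[of p \<delta> 1] p(2) \<delta>(1) by (metis zero_less_one)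
  have "ball p (min d \<epsilon>) \<subseteq> W"
  proof
    fix x assume x: "x \<in> ball p (min d \<epsilon>)"
    then have "x \<in> \<Omega>2" "x \<in> ball p \<epsilon>" using d(2) by auto
    moreover have "x \<in> closure \<Omega>2" using \<open>x \<in> \<Omega>2\<close> closure_subset by blast
    ultimately show "x \<in> W" using \<epsilon>(2)[of x] \<delta>(2) by (auto simp: W_def)
  qed
  then show "\<exists>e>0. ball p e \<subseteq> W" using d(1) \<epsilon>(1) by (intro exI[of _ "min d \<epsilon>"]) auto
qed

text \<open>Off W either the weight is 0 or \<tau> lies outside \<Omega>1, where test functions
  vanish; so all images vanish on the open complement of the closure, and nondegeneracy
  applies.\<close>

lemma dense_W: "\<Omega>2 \<subseteq> closure W"
proof -
  have "\<Omega>2 - closure W = {}"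
  proof (rule nondegenerate)
    show "open (\<Omega>2 - closure W)" using dom2(1) by (intro open_Diff) auto
    fix f y assume f: "f \<in> test_funs \<Omega>1" and y: "y \<in> \<Omega>2 - closure W"
    then have "y \<notin> W" using closure_subset by blast
    then have "w y = 0 \<or> \<tau> y \<notin> \<Omega>1" using y by (simp add: W_def)
    then show "w y * f (\<tau> y) = 0" using test_funsD(4)[OF f, of "\<tau> y"] by auto
  qed auto
  then show ?thesis by blast
qed

text \<open>Ridge powers have no compact support; multiplied by a cutoff that is 1 near \<tau> p
  they become test functions, and on a ball that \<tau> maps into this region the cutoff is
  invisible to the function and to its Laplacian.\<close>

lemma ex_local_isometry:
  assumes "p \<in> W"
  shows "\<exists>r \<sigma>. r > 0 \<and> ball p r \<subseteq> W \<and> isometric \<sigma> \<and> (\<forall>x\<in>ball p r. \<tau> x = \<sigma> x \<and> w x = w p)"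
proof -
  have p: "p \<in> \<Omega>2" "w p \<noteq> 0" "\<tau> p \<in> \<Omega>1" using assms by (auto simp: W_def)
  obtain \<delta> where \<delta>: "\<delta> > 0" "cball (\<tau> p) \<delta> \<subseteq> \<Omega>1" using p(3) dom1(1) open_contains_cball by metis
  obtain d where d: "d > 0" "ball p d \<subseteq> W" using assms open_W open_contains_ball by metis
  have "p \<in> closure \<Omega>2" using p(1) closure_subset by blast
  \<comment> \<open>The fraction 1/5 bounds w x - w y by 2/5 and w y from below by 4/5 of the norm
    of w p, so w x / w y differs from 1 by at most 1/2.\<close>
  then obtain \<epsilon> where \<epsilon>: "\<epsilon> > 0"
    "\<And>x. x \<in> closure \<Omega>2 \<Longrightarrow> x \<in> ball p \<epsilon> \<Longrightarrow> w x \<noteq> 0 \<and> norm (w x - w p) < norm (w p) / 5 \<and> \<tau> x \<in> ball (\<tau> p) (\<delta> / 2)"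
    using near[of p "\<delta> / 2" "norm (w p) / 5"] p(2) \<delta>(1) by (metis divide_pos_pos zero_less_norm_iff zero_less_numeral)
  define R where "R = min d \<epsilon>"
  have R: "R > 0" "ball p R \<subseteq> W" "ball p R \<subseteq> ball p \<epsilon>" using d \<epsilon>(1) by (auto simp: R_def)
  have W2: "W \<subseteq> \<Omega>2" "W \<subseteq> closure \<Omega>2" using closure_subset by (auto simp: W_def)
  have nr: "w x \<noteq> 0" "norm (w x - w p) < norm (w p) / 5" "\<tau> x \<in> ball (\<tau> p) (\<delta> / 2)" if "x \<in> ball p R" for x
    using \<epsilon>(2)[of x] that R W2 by blast+
  obtain \<theta> where \<theta>t: "\<theta> \<in> test_funs \<Omega>1" and \<theta>1: "\<forall>x\<in>ball (\<tau> p) (\<delta> / 2). \<theta> x = 1"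
    using ex_test_fun_one_on_ball[OF \<delta>] ..
  note \<theta> = test_funs_mult[OF \<theta>t] bspec[OF \<theta>1]
  have "intertwined (ball p R) w \<tau>"
  proof
    show "continuous_on (ball p R) w"
      by (rule continuous_on_subset[OF w_cont]) (use R(2) W2 in blast)
    show "continuous_on (ball p R) \<tau>"
      by (rule continuous_on_subset[OF \<tau>_cont]) (use R(2) W2 nr(1) in blast)
    fix \<xi> :: 'a and s m
    let ?P = "\<lambda>x. complex_of_real ((\<xi> \<bullet> x - s) ^ m)"
    have "C_k k ?P" for k
      using C_k_power[OF C_k_diff[OF C_k_inner[of k \<xi>] C_k_const[of k "complex_of_real s"]], of m]
      by (simp add: inner_commute)
    then have f: "(\<lambda>x. ?P x * \<theta> x) \<in> test_funs \<Omega>1" by (rule \<theta>(1))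
    show "has_distr_laplacian (ball p R) (\<lambda>x. w x * complex_of_real ((\<xi> \<bullet> \<tau> x - s) ^ m))
      (\<lambda>x. complex_of_real (real (m * (m - 1)) * (\<xi> \<bullet> \<xi>)) * (w x * complex_of_real ((\<xi> \<bullet> \<tau> x - s) ^ (m - 2))))"
    proof (rule has_distr_laplacian_local[OF intertwining[OF f]])
      show "\<Omega>2 \<in> sets lebesgue" using dom2(1) by simp
      show "ball p R \<subseteq> \<Omega>2" using R(2) W2 by blast
      fix x assume x: "x \<in> ball p R"
      show "w x * (?P (\<tau> x) * \<theta> (\<tau> x)) = w x * complex_of_real ((\<xi> \<bullet> \<tau> x - s) ^ m)"
        by (simp add: \<theta>(2)[OF nr(3)[OF x]])
      have "laplacian (\<lambda>x. ?P x * \<theta> x) (\<tau> x) = laplacian ?P (\<tau> x)"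
        by (rule laplacian_cong[OF open_ball nr(3)[OF x]]) (simp add: \<theta>(2))
      then show "w x * laplacian (\<lambda>x. ?P x * \<theta> x) (\<tau> x) =
          complex_of_real (real (m * (m - 1)) * (\<xi> \<bullet> \<xi>)) * (w x * complex_of_real ((\<xi> \<bullet> \<tau> x - s) ^ (m - 2)))"
        unfolding laplacian_ridge by (simp only: mult.left_commute)
    qed simp
  next
    fix x y assume xy: "x \<in> ball p R" "y \<in> ball p R"
    have "norm (w x - w y) \<le> norm (w x - w p) + norm (w y - w p)"
      using norm_triangle_ineq4[of "w x - w p" "w y - w p"] by simp
    then have 1: "norm (w x - w y) \<le> 2 / 5 * norm (w p)" using nr(2)[OF xy(1)] nr(2)[OF xy(2)] by simp
    have "norm (w p) \<le> norm (w y) + norm (w y - w p)"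
      using norm_triangle_ineq4[of "w y" "w y - w p"] by simp
    then have 2: "4 / 5 * norm (w p) \<le> norm (w y)" using nr(2)[OF xy(2)] by simp
    have "norm (w x / w y - 1) = norm (w x - w y) / norm (w y)"
      using nr(1)[OF xy(2)] by (simp add: norm_divide[symmetric] diff_divide_distrib)
    also have "\<dots> \<le> 1 / 2" using 1 2 nr(1)[OF xy(2)] by (simp add: divide_le_eq)
    finally have "\<bar>Re (w x / w y - 1)\<bar> \<le> 1 / 2" using abs_Re_le_cmod order_trans by blast
    then show "Re (w x / w y) \<ge> 1 / 2" unfolding minus_complex.sel one_complex.sel by linarith
  qed simp
  note rigid = intertwined_rigid[OF this]
  have R3: "R / 3 > 0" using R(1) by simp
  have "\<exists>\<sigma>. isometric \<sigma> \<and> (\<forall>x\<in>ball p (R / 3). \<sigma> x = \<tau> x)"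
    by (rule isometry_extends[OF R3 rigid(1)]) assumption+
  then obtain \<sigma> where \<sigma>: "isometric \<sigma>" "\<forall>x\<in>ball p (R / 3). \<sigma> x = \<tau> x" by (elim exE conjE)
  have "ball p (R / 3) \<subseteq> ball p R" using R(1) by (intro subset_ball) simp
  then have sub: "ball p (R / 3) \<subseteq> W" using R(2) by (rule subset_trans)
  have "\<tau> x = \<sigma> x \<and> w x = w p" if "x \<in> ball p (R / 3)" for x
    using rigid(2)[OF that] bspec[OF \<sigma>(2) that] by simp
  then show ?thesis by (intro exI[of _ "R / 3"] exI[of _ \<sigma>] conjI ballI R3 sub \<sigma>(1)) blast+
qed

section \<open>Isometric pieces and their images\<close>

definition piece :: "'a set \<Rightarrow> ('a \<Rightarrow> 'a) \<Rightarrow> complex \<Rightarrow> bool" where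
  "piece \<omega> \<sigma> c \<longleftrightarrow> isometric \<sigma> \<and> c \<noteq> 0 \<and> (\<forall>x\<in>\<omega>. \<tau> x = \<sigma> x \<and> w x = c)"

text \<open>Local isometries chosen at nearby points agree on an open overlap, hence everywhere; so
  the choice is locally constant and, on a connected set, constant.\<close>

lemma component_isometry:
  assumes "\<omega> \<in> components W"
  shows "\<exists>\<sigma> c. piece \<omega> \<sigma> c"
proof -
  have sub: "\<omega> \<subseteq> W" by (rule in_components_subset[OF assms])
  have con: "connected \<omega>" by (rule in_components_connected[OF assms])
  obtain a where a: "a \<in> \<omega>" using in_components_nonempty[OF assms] by blast
  have "\<forall>p\<in>W. \<exists>q. fst q > 0 \<and> ball p (fst q) \<subseteq> W \<and> isometric (snd q) \<and> (\<forall>x\<in>ball p (fst q). \<tau> x = snd q x \<and> w x = w p)"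
    using ex_local_isometry by (metis fst_conv snd_conv)
  from bchoice[OF this] obtain q where q: "\<forall>p\<in>W. fst (q p) > 0 \<and> ball p (fst (q p)) \<subseteq> W \<and> isometric (snd (q p)) \<and>
      (\<forall>x\<in>ball p (fst (q p)). \<tau> x = snd (q p) x \<and> w x = w p)" ..
  define r where "r p = fst (q p)" for p
  define \<sigma> where "\<sigma> p = snd (q p)" for p
  have all: "r p > 0 \<and> ball p (r p) \<subseteq> W \<and> isometric (\<sigma> p) \<and> (\<forall>x\<in>ball p (r p). \<tau> x = \<sigma> p x \<and> w x = w p)"
    if "p \<in> W" for p
    unfolding r_def \<sigma>_def by (rule bspec[OF q that])
  note loc = all[THEN conjunct1] all[THEN conjunct2, THEN conjunct1] all[THEN conjunct2, THEN conjunct2, THEN conjunct1]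
    bspec[OF all[THEN conjunct2, THEN conjunct2, THEN conjunct2], THEN conjunct1]
    bspec[OF all[THEN conjunct2, THEN conjunct2, THEN conjunct2], THEN conjunct2]
  have step: "\<sigma> p = \<sigma> x \<and> w p = w x" if p: "p \<in> W" and x: "x \<in> ball p (r p)" for p x
  proof
    have xW: "x \<in> W" using loc(2)[OF p] x by blast
    show "w p = w x" using loc(5)[OF p x] by simp
    show "\<sigma> p = \<sigma> x"
    proof (rule isometric_eq[OF loc(3)[OF p] loc(3)[OF xW], of "ball p (r p) \<inter> ball x (r x)" x])
      show "x \<in> ball p (r p) \<inter> ball x (r x)" using x loc(1)[OF xW] by simp
      show "\<sigma> p z = \<sigma> x z" if "z \<in> ball p (r p) \<inter> ball x (r x)" for z
        using loc(4)[OF p, of z] loc(4)[OF xW, of z] that by simp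
    qed auto
  qed
  have const: "\<sigma> a = \<sigma> b \<and> w a = w b" if b: "b \<in> \<omega>" for b
  proof (rule connected_equivalence_relation[OF con a b, of "\<lambda>x y. \<sigma> x = \<sigma> y \<and> w x = w y"])
    fix p assume p: "p \<in> \<omega>"
    then have pW: "p \<in> W" using sub by blast
    show "\<exists>T. openin (top_of_set \<omega>) T \<and> p \<in> T \<and> (\<forall>x\<in>T. \<sigma> p = \<sigma> x \<and> w p = w x)"
      using p loc(1)[OF pW] step[OF pW] by (intro exI[of _ "\<omega> \<inter> ball p (r p)"]) (auto intro: openin_open_Int)
  qed auto
  have aW: "a \<in> W" using a sub by blast
  have "\<tau> x = \<sigma> a x \<and> w x = w a" if x: "x \<in> \<omega>" for x
  proof -
    have xW: "x \<in> W" using x sub by blast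
    have "\<tau> x = \<sigma> x x" by (rule loc(4)[OF xW]) (simp add: loc(1)[OF xW])
    then show ?thesis using const[OF x] by simp
  qed
  then have "piece \<omega> (\<sigma> a) (w a)"
    using loc(3)[OF aW] aW by (simp add: piece_def W_def)
  then show ?thesis by blast
qed

text \<open>The order matters: \<tau> is continuous only where w is nonzero, so w = c has to be
  carried to the closure before the equality of \<tau> and \<sigma> can follow.\<close>

lemma component_closure:
  assumes "\<omega> \<subseteq> W" and piece: "piece \<omega> \<sigma> c" and y_in: "y \<in> closure \<omega>"
  shows "w y = c" "\<tau> y = \<sigma> y" "y \<in> closure \<Omega>2"
proof -
  have \<sigma>: "isometric \<sigma>" "c \<noteq> 0" "\<And>x. x \<in> \<omega> \<Longrightarrow> \<tau> x = \<sigma> x" "\<And>x. x \<in> \<omega> \<Longrightarrow> w x = c"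
    using piece by (simp_all add: piece_def)
  have \<omega>2: "\<omega> \<subseteq> \<Omega>2" using assms(1) by (auto simp: W_def)
  then have cl: "closure \<omega> \<subseteq> closure \<Omega>2" by (rule closure_mono)
  then show y: "y \<in> closure \<Omega>2" using y_in by blast
  have "continuous_on (closure \<omega>) w" by (rule continuous_on_subset[OF w_cont cl])
  from continuous_constant_on_closure[OF this \<sigma>(4)] have wc: "w x = c" if "x \<in> closure \<omega>" for x
    using that by blast
  then show "w y = c" using y_in by blast
  have "continuous_on (closure \<omega>) \<tau>"
    by (rule continuous_on_subset[OF \<tau>_cont]) (use wc cl \<sigma>(2) in auto)
  from continuous_on_diff[OF this isometric_continuous[OF \<sigma>(1)]]
  have "continuous_on (closure \<omega>) (\<lambda>x. \<tau> x - \<sigma> x)" .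
  from continuous_constant_on_closure[OF this, of 0] have "\<tau> y - \<sigma> y = 0" using \<sigma>(3) y_in by simp
  then show "\<tau> y = \<sigma> y" by simp
qed

text \<open>If \<open>\<tau>\<close> mapped a boundary point of \<open>\<Omega>2\<close> into \<open>\<Omega>1\<close>, then the range of \<open>U\<close> would contain functions that
  near this point are constant or equal to an arbitrary affine function.\<close>

lemma closure_point_in_component:
  assumes \<omega>: "\<omega> \<in> components W" and piece: "piece \<omega> \<sigma> c"
    and y: "y \<in> closure \<omega>" "\<sigma> y \<in> \<Omega>1"
  shows "y \<in> \<omega>"
proof -
  have sub: "\<omega> \<subseteq> W" by (rule in_components_subset[OF \<omega>])
  note cl = component_closure[OF sub piece]
  have \<sigma>: "isometric \<sigma>" "c \<noteq> 0" using piece by (simp_all add: piece_def)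
  have "y \<in> \<Omega>2"
  proof (rule ccontr)
    assume "y \<notin> \<Omega>2"
    then have fr: "y \<in> frontier \<Omega>2" using cl(3)[OF y(1)] dom2(1) by (simp add: frontier_def interior_open)
    have \<tau>y: "\<tau> y \<in> \<Omega>1" using cl(2)[OF y(1)] y(2) by simp
    obtain \<delta> where \<delta>: "\<delta> > 0" "cball (\<tau> y) \<delta> \<subseteq> \<Omega>1" using \<tau>y dom1(1) open_contains_cball by metis
    have wy: "w y \<noteq> 0" using cl(1)[OF y(1)] \<sigma>(2) by simp
    obtain \<epsilon>1 where \<epsilon>1: "\<epsilon>1 > 0"
      "\<And>x. x \<in> closure \<Omega>2 \<Longrightarrow> x \<in> ball y \<epsilon>1 \<Longrightarrow> w x \<noteq> 0 \<and> norm (w x - w y) < 1 \<and> \<tau> x \<in> ball (\<tau> y) (\<delta> / 2)"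
      using near[OF cl(3)[OF y(1)] wy, of "\<delta> / 2" 1] \<delta>(1) by (metis half_gt_zero zero_less_one)
    obtain V e \<psi> M where chart: "boundary_chart \<Omega>2 y V e \<psi> M" using admissible_domain_chart[OF adm2 fr] by metis
    then have "open V" "y \<in> V" by (auto simp: boundary_chart_def)
    then obtain d where d: "d > 0" "ball y d \<subseteq> V" using open_contains_ball by metis
    define \<epsilon> where "\<epsilon> = min \<epsilon>1 d"
    have \<epsilon>: "\<epsilon> > 0" "ball y \<epsilon> \<subseteq> V" "ball y \<epsilon> \<subseteq> ball y \<epsilon>1" using \<epsilon>1(1) d by (auto simp: \<epsilon>_def)
    have inW: "\<Omega>2 \<inter> ball y \<epsilon> \<subseteq> W"
    proof
      fix x assume x: "x \<in> \<Omega>2 \<inter> ball y \<epsilon>"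
      then have "x \<in> closure \<Omega>2" "x \<in> ball y \<epsilon>1" using closure_subset \<epsilon>(3) by blast+
      from \<epsilon>1(2)[OF this] have "w x \<noteq> 0" "\<tau> x \<in> cball (\<tau> y) \<delta>" using \<delta>(1) by auto
      then show "x \<in> W" using x \<delta>(2) by (auto simp: W_def)
    qed
    \<comment> \<open>C is a connected subset of W that meets the component, hence lies inside it.
      So near y the whole of \<Omega>2 belongs to one component, and a single isometry describes
      \<tau> there.\<close>
    obtain \<rho> C where C: "\<rho> > 0" "connected C" "\<Omega>2 \<inter> ball y \<rho> \<subseteq> C" "C \<subseteq> \<Omega>2 \<inter> ball y \<epsilon>"
      using boundary_connected_neighbourhood[OF chart \<epsilon>(2,1)] by metis
    obtain x where "x \<in> \<omega>" "dist x y < \<rho>" using y(1) C(1) unfolding closure_approachable by blast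
    then have "x \<in> \<omega> \<inter> C" using C(3) sub by (auto simp: W_def dist_commute)
    then have "C \<subseteq> \<omega>" using components_maximal[OF \<omega> C(2)] C(4) inW by blast
    then have in\<omega>: "\<Omega>2 \<inter> ball y \<rho> \<subseteq> \<omega>" using C(3) by blast
    define R where "R = min \<rho> \<epsilon>"
    have R: "R > 0" "ball y R \<subseteq> ball y \<rho>" "ball y R \<subseteq> ball y \<epsilon>1" using C(1) \<epsilon> by (auto simp: R_def)
    have cl\<omega>: "x \<in> closure \<omega>" "\<tau> x \<in> ball (\<tau> y) (\<delta> / 2)" if x: "x \<in> closure \<Omega>2 \<inter> ball y R" for x
    proof -
      have "x \<in> closure (ball y \<rho> \<inter> \<Omega>2)"
        using open_Int_closure_subset[OF open_ball, of y \<rho> \<Omega>2] x R(2) by blast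
      also have "closure (ball y \<rho> \<inter> \<Omega>2) \<subseteq> closure \<omega>" by (rule closure_mono) (use in\<omega> in blast)
      finally show "x \<in> closure \<omega>" .
      show "\<tau> x \<in> ball (\<tau> y) (\<delta> / 2)" using \<epsilon>1(2)[of x] x R(3) by blast
    qed
    obtain \<theta> where \<theta>t: "\<theta> \<in> test_funs \<Omega>1" and \<theta>1: "\<forall>x\<in>ball (\<tau> y) (\<delta> / 2). \<theta> x = 1"
      using ex_test_fun_one_on_ball[OF \<delta>] ..
    note \<theta> = test_funs_mult[OF \<theta>t] bspec[OF \<theta>1]
    show False
    proof (rule no_robin_affine_functions[OF adm2 fr R(1) \<sigma>(2)])
      show "(\<lambda>y. w y * (1 * \<theta> (\<tau> y))) \<in> robin_domain \<Omega>2 \<beta>" by (intro robin \<theta>(1)) simp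
      show "w x * (1 * \<theta> (\<tau> x)) = c" if "x \<in> closure \<Omega>2 \<inter> ball y R" for x
        using cl(1)[OF cl\<omega>(1)[OF that]] \<theta>(2)[OF cl\<omega>(2)[OF that]] by simp
      fix e
      \<comment> \<open>The linear part of \<sigma> applied to e. As it is orthogonal, the
        \<xi>-component of \<sigma> x is the e-component of x up to a constant, so every slope e is
        obtained.\<close>
      define \<xi> where "\<xi> = \<sigma> e - \<sigma> 0"
      have aff: "\<sigma> x \<bullet> \<xi> = x \<bullet> e - (- (\<sigma> 0 \<bullet> \<xi>))" for x
      proof -
        have "(\<sigma> x - \<sigma> 0) \<bullet> (\<sigma> e - \<sigma> 0) = (x - 0) \<bullet> (e - 0)"
          by (rule isometric_inner[of UNIV]) (use \<sigma>(1) in \<open>auto simp: isometric_def\<close>)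
        then show ?thesis by (simp add: \<xi>_def inner_diff_left)
      qed
      have "(\<lambda>y. w y * (complex_of_real (\<tau> y \<bullet> \<xi>) * \<theta> (\<tau> y))) \<in> robin_domain \<Omega>2 \<beta>" by (intro robin \<theta>(1) C_k_inner)
      moreover have "w x * (complex_of_real (\<tau> x \<bullet> \<xi>) * \<theta> (\<tau> x)) = c * complex_of_real (x \<bullet> e - (- (\<sigma> 0 \<bullet> \<xi>)))"
        if "x \<in> closure \<Omega>2 \<inter> ball y R" for x
      proof -
        note x = cl\<omega>(1)[OF that]
        have "\<tau> x \<bullet> \<xi> = x \<bullet> e - (- (\<sigma> 0 \<bullet> \<xi>))" unfolding cl(2)[OF x] by (rule aff)
        then show ?thesis by (simp only: cl(1)[OF x] \<theta>(2)[OF cl\<omega>(2)[OF that]] mult_1_right)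
      qed
      ultimately show "\<exists>u s. u \<in> robin_domain \<Omega>2 \<beta> \<and> (\<forall>x\<in>closure \<Omega>2 \<inter> ball y R. u x = c * complex_of_real (x \<bullet> e - s))"
        by (intro exI[of _ "\<lambda>y. w y * (complex_of_real (\<tau> y \<bullet> \<xi>) * \<theta> (\<tau> y))"] exI[of _ "- (\<sigma> 0 \<bullet> \<xi>)"]) blast
    qed
  qed
  then have yW: "y \<in> W" using cl(1,2)[OF y(1)] \<sigma>(2) y(2) by (simp add: W_def)
  \<comment> \<open>A connected set stays connected when a point of its closure is added; since y
    lies in W, maximality of the component gives the claim.\<close>
  have "connected (insert y \<omega>)"
    by (rule connected_intermediate_closure[OF in_components_connected[OF \<omega>]]) (use y(1) closure_subset in blast)+
  then have "insert y \<omega> \<subseteq> \<omega>"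
    using in_components_nonempty[OF \<omega>] yW sub by (intro components_maximal[OF \<omega>]) auto
  then show ?thesis by blast
qed

text \<open>The image is open because isometries of the space are homeomorphisms, and relatively
  closed in \<Omega>1 by \<open>closure_point_in_component\<close>; \<Omega>1 is connected.\<close>

lemma component_image:
  assumes \<omega>: "\<omega> \<in> components W" and piece: "piece \<omega> \<sigma> c"
  shows "\<sigma> ` \<omega> = \<Omega>1"
proof -
  have \<sigma>: "isometric \<sigma>" "\<And>x. x \<in> \<omega> \<Longrightarrow> \<tau> x = \<sigma> x" using piece by (simp_all add: piece_def)
  have sub: "\<omega> \<subseteq> W" by (rule in_components_subset[OF \<omega>])
  obtain \<kappa> where \<kappa>: "isometric \<kappa>" "\<And>x. \<kappa> (\<sigma> x) = x" "\<And>x. \<sigma> (\<kappa> x) = x"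
    using isometric_inverse[OF \<sigma>(1)] by metis
  have s1: "\<sigma> ` \<omega> \<subseteq> \<Omega>1" using sub \<sigma>(2) by (force simp: W_def)
  have "open \<omega>" by (rule open_components[OF open_W \<omega>])
  then have op: "open (\<sigma> ` \<omega>)" by (rule isometric_open_image[OF \<sigma>(1)])
  have "\<Omega>1 \<inter> closure (\<sigma> ` \<omega>) \<subseteq> \<sigma> ` \<omega>"
  proof
    fix x assume x: "x \<in> \<Omega>1 \<inter> closure (\<sigma> ` \<omega>)"
    have "\<kappa> ` closure (\<sigma> ` \<omega>) \<subseteq> closure (\<kappa> ` \<sigma> ` \<omega>)"
      by (rule image_closure_subset[OF isometric_continuous[OF \<kappa>(1)]]) (auto simp: closure_subset)
    then have "\<kappa> x \<in> closure \<omega>" using x by (auto simp: image_image \<kappa>(2))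
    then have "\<kappa> x \<in> \<omega>" by (rule closure_point_in_component[OF \<omega> piece]) (use x \<kappa>(3) in simp)
    then show "x \<in> \<sigma> ` \<omega>" using \<kappa>(3)[of x] by (metis imageI)
  qed
  then have "\<Omega>1 \<inter> closure (\<sigma> ` \<omega>) = \<sigma> ` \<omega>" using s1 closure_subset[of "\<sigma> ` \<omega>"] by (intro equalityI Int_greatest)
  then have "closedin (top_of_set \<Omega>1) (\<sigma> ` \<omega>)" by (metis closed_closure closedin_closed_Int)
  moreover have "openin (top_of_set \<Omega>1) (\<sigma> ` \<omega>)" using op s1 by (simp add: open_subset)
  ultimately have "\<sigma> ` \<omega> = {} \<or> \<sigma> ` \<omega> = \<Omega>1"
    using dom1(3) unfolding connected_clopen by blast
  then show ?thesis using in_components_nonempty[OF \<omega>] by blast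
qed

lemma finite_components_W: "finite (components W)"
proof (rule ccontr)
  assume inf: "infinite (components W)"
  obtain p where "p \<in> \<Omega>1" using dom1(4) by blast
  then obtain r where r: "r > 0" "ball p r \<subseteq> \<Omega>1" using dom1(1) open_contains_ball by metis
  have "\<forall>\<omega>\<in>components W. \<exists>q. ball q r \<subseteq> \<omega>"
  proof
    fix \<omega> assume \<omega>: "\<omega> \<in> components W"
    obtain \<sigma> c where piece: "piece \<omega> \<sigma> c" using component_isometry[OF \<omega>] by blast
    then have \<sigma>: "isometric \<sigma>" by (simp add: piece_def)
    have im: "\<sigma> ` \<omega> = \<Omega>1" by (rule component_image[OF \<omega> piece])
    obtain \<kappa> where \<kappa>: "\<And>x. \<kappa> (\<sigma> x) = x" "\<And>x. \<sigma> (\<kappa> x) = x" using isometric_inverse[OF \<sigma>] by metis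
    have "ball (\<kappa> p) r \<subseteq> \<omega>"
    proof
      fix z assume "z \<in> ball (\<kappa> p) r"
      then have "dist (\<sigma> (\<kappa> p)) (\<sigma> z) < r" using \<sigma> by (simp add: isometric_def)
      then have "\<sigma> z \<in> \<sigma> ` \<omega>" using r(2) unfolding im \<kappa>(2) by auto
      then show "z \<in> \<omega>" using \<kappa>(1) by (metis imageE)
    qed
    then show "\<exists>q. ball q r \<subseteq> \<omega>" by blast
  qed
  then obtain q where q: "\<And>\<omega>. \<omega> \<in> components W \<Longrightarrow> ball (q \<omega>) r \<subseteq> \<omega>" by metis
  \<comment> \<open>Centres belonging to different components are at least r apart, which excludes
    an accumulation point of the bounded set of centres.\<close>
  have same: "\<omega> = \<omega>'" if "\<omega> \<in> components W" "\<omega>' \<in> components W" "dist (q \<omega>) (q \<omega>') < r" for \<omega> \<omega>'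
  proof -
    have "q \<omega>' \<in> \<omega>" using q[OF that(1)] that(3) by auto
    moreover have "q \<omega>' \<in> \<omega>'" using q[OF that(2)] r(1) by auto
    ultimately show ?thesis using components_nonoverlap[OF that(1,2)] by blast
  qed
  have "inj_on q (components W)" by (rule inj_onI) (use same r(1) in auto)
  then have "infinite (q ` components W)" using inf by (simp add: finite_image_iff)
  moreover have "bounded (q ` components W)"
  proof (rule bounded_subset[OF dom2(2)])
    show "q ` components W \<subseteq> \<Omega>2"
    proof
      fix x assume "x \<in> q ` components W"
      then obtain \<omega> where \<omega>: "\<omega> \<in> components W" "x = q \<omega>" by blast
      have "x \<in> \<omega>" using q[OF \<omega>(1)] r(1) \<omega>(2) by auto
      then show "x \<in> \<Omega>2" using in_components_subset[OF \<omega>(1)] by (auto simp: W_def)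
    qed
  qed
  ultimately obtain l where l: "l islimpt (q ` components W)" using bounded_infinite_imp_islimpt by blast
  obtain x1 where x1: "x1 \<in> q ` components W" "x1 \<noteq> l" "dist x1 l < r / 2"
    using l r(1) unfolding islimpt_approachable by (metis half_gt_zero)
  \<comment> \<open>Choosing the second centre strictly closer to l than the first makes the two
    different.\<close>
  have "min (r / 2) (dist x1 l) > 0" using r(1) x1(2) by simp
  then obtain x2 where x2: "x2 \<in> q ` components W" "x2 \<noteq> l" "dist x2 l < min (r / 2) (dist x1 l)"
    using l unfolding islimpt_approachable by metis
  obtain \<omega> \<omega>' where o: "\<omega> \<in> components W" "x1 = q \<omega>" "\<omega>' \<in> components W" "x2 = q \<omega>'" using x1(1) x2(1) by blast
  have "dist x1 x2 < r" using dist_triangle2[of x1 x2 l] x1(3) x2(3) by simp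
  then have "\<omega> = \<omega>'" using same[OF o(1,3)] o(2,4) by simp
  then show False using o x2(3) by simp
qed

text \<open>For finitely many components the closure of the union is the union of the closures. So w
  takes finitely many nonzero values on all of \<Omega>2, including the points between
  components.\<close>

lemma w_constant_on: "\<exists>c. c \<noteq> 0 \<and> (\<forall>y\<in>closure \<Omega>2. w y = c)"
proof -
  have "\<forall>\<omega>\<in>components W. \<exists>c. c \<noteq> 0 \<and> (\<forall>x\<in>closure \<omega>. w x = c)"
  proof
    fix \<omega> assume \<omega>: "\<omega> \<in> components W"
    obtain \<sigma> c where piece: "piece \<omega> \<sigma> c" using component_isometry[OF \<omega>] by blast
    then have "c \<noteq> 0" by (simp add: piece_def)
    then show "\<exists>c. c \<noteq> 0 \<and> (\<forall>x\<in>closure \<omega>. w x = c)"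
      using component_closure(1)[OF in_components_subset[OF \<omega>] piece] by blast
  qed
  from bchoice[OF this] obtain c where "\<forall>\<omega>\<in>components W. c \<omega> \<noteq> 0 \<and> (\<forall>x\<in>closure \<omega>. w x = c \<omega>)" ..
  then have c: "c \<omega> \<noteq> 0" "\<And>x. x \<in> closure \<omega> \<Longrightarrow> w x = c \<omega>" if "\<omega> \<in> components W" for \<omega> using that by auto
  have "closure W = (\<Union>\<omega>\<in>components W. closure \<omega>)"
  proof -
    have "closure (\<Union>\<C>) = (\<Union>\<omega>\<in>\<C>. closure \<omega>)" if "finite \<C>" for \<C> :: "'a set set"
      using that by induction auto
    from this[OF finite_components_W] show ?thesis using Union_components[of W] by simp
  qed
  then have cov: "\<Omega>2 \<subseteq> (\<Union>\<omega>\<in>components W. closure \<omega>)" using dense_W by simp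
  have "w ` \<Omega>2 \<subseteq> c ` components W"
  proof
    fix v assume "v \<in> w ` \<Omega>2"
    then obtain x where x: "x \<in> \<Omega>2" "v = w x" by blast
    then obtain \<omega> where "\<omega> \<in> components W" "x \<in> closure \<omega>" using cov by blast
    then show "v \<in> c ` components W" using c(2) x(2) by blast
  qed
  then have fin: "finite (w ` \<Omega>2)" using finite_components_W by (meson finite_imageI finite_subset)
  have cont: "continuous_on \<Omega>2 w" using w_cont closure_subset by (rule continuous_on_subset)
  have "w constant_on \<Omega>2" by (rule continuous_finite_range_constant[OF dom2(3) cont fin])
  then obtain c0 where c0: "\<forall>x\<in>\<Omega>2. w x = c0" unfolding constant_on_def by blast
  obtain x where x: "x \<in> \<Omega>2" using dom2(4) by blast
  then obtain \<omega> where "\<omega> \<in> components W" "x \<in> closure \<omega>" using cov by blast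
  then have "c0 \<noteq> 0" using c c0 x by metis
  moreover have "w y = c0" if "y \<in> closure \<Omega>2" for y
    using continuous_constant_on_closure[OF w_cont _ that, of c0] c0 by blast
  ultimately show ?thesis by blast
qed

lemma decomposition:
  "\<exists>c. c \<noteq> 0 \<and> (\<exists>(n::nat) \<omega> \<sigma>. n \<ge> 1 \<and>
    (\<forall>i<n. open (\<omega> i) \<and> connected (\<omega> i) \<and> \<omega> i \<noteq> {} \<and> \<omega> i \<subseteq> \<Omega>2) \<and>
    disjoint_family_on \<omega> {..<n} \<and> (\<forall>i<n. isometric (\<sigma> i)) \<and> (\<forall>i<n. \<sigma> i ` \<omega> i = \<Omega>1) \<and>
    \<Omega>2 \<subseteq> closure (\<Union>i<n. \<omega> i) \<and> (\<forall>i<n. \<forall>y\<in>closure (\<omega> i). w y = c \<and> \<tau> y = \<sigma> i y))"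
proof -
  obtain c where c: "c \<noteq> 0" "\<forall>y\<in>closure \<Omega>2. w y = c" using w_constant_on by blast
  define n where "n = card (components W)"
  obtain \<omega> where \<omega>: "bij_betw \<omega> {..<n} (components W)"
    using ex_bij_betw_nat_finite[OF finite_components_W] by (auto simp: n_def lessThan_atLeast0)
  have comp: "\<omega> i \<in> components W" if "i < n" for i using \<omega> that by (auto simp: bij_betw_def)
  have wc: "w x = c" if "x \<in> W" for x
    using c(2) that closure_subset by (auto simp: W_def)
  have "\<forall>i\<in>{..<n}. \<exists>\<sigma>. piece (\<omega> i) \<sigma> c"
  proof
    fix i assume "i \<in> {..<n}"
    then have i: "\<omega> i \<in> components W" using comp by simp
    obtain \<sigma> c' where p: "piece (\<omega> i) \<sigma> c'" using component_isometry[OF i] by blast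
    then have p': "isometric \<sigma>" "\<forall>x\<in>\<omega> i. \<tau> x = \<sigma> x" by (simp_all add: piece_def)
    have "\<forall>x\<in>\<omega> i. w x = c" using wc in_components_subset[OF i] by blast
    with p' c(1) have "piece (\<omega> i) \<sigma> c" by (simp add: piece_def)
    then show "\<exists>\<sigma>. piece (\<omega> i) \<sigma> c" by blast
  qed
  from bchoice[OF this] obtain \<sigma> where "\<forall>i\<in>{..<n}. piece (\<omega> i) (\<sigma> i) c" ..
  then have piece: "piece (\<omega> i) (\<sigma> i) c" if "i < n" for i using that by blast
  then have \<sigma>: "isometric (\<sigma> i)" if "i < n" for i using that by (simp add: piece_def)
  have Un: "(\<Union>i<n. \<omega> i) = W"
    using Union_components[of W] \<omega> by (simp add: bij_betw_def)
  have "W \<noteq> {}" using dense_W dom2(4) by auto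
  then have n1: "n \<ge> 1" using Un by (cases n) auto
  have sets: "\<forall>i<n. open (\<omega> i) \<and> connected (\<omega> i) \<and> \<omega> i \<noteq> {} \<and> \<omega> i \<subseteq> \<Omega>2"
  proof (intro allI impI conjI)
    fix i assume "i < n"
    note i = comp[OF this]
    show "open (\<omega> i)" by (rule open_components[OF open_W i])
    show "connected (\<omega> i)" by (rule in_components_connected[OF i])
    show "\<omega> i \<noteq> {}" by (rule in_components_nonempty[OF i])
    show "\<omega> i \<subseteq> \<Omega>2" using in_components_subset[OF i] by (auto simp: W_def)
  qed
  have disj: "disjoint_family_on \<omega> {..<n}"
    unfolding disjoint_family_on_def
  proof (intro ballI impI)
    fix i j assume ij: "i \<in> {..<n}" "j \<in> {..<n}" "i \<noteq> j"
    then have "\<omega> i \<noteq> \<omega> j" using \<omega> by (auto simp: bij_betw_def inj_on_def)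
    then show "\<omega> i \<inter> \<omega> j = {}" using components_nonoverlap[OF comp comp] ij by simp
  qed
  have image: "\<forall>i<n. \<sigma> i ` \<omega> i = \<Omega>1" using component_image[OF comp piece] by simp
  have dense: "\<Omega>2 \<subseteq> closure (\<Union>i<n. \<omega> i)" unfolding Un by (rule dense_W)
  have vals: "\<forall>i<n. \<forall>y\<in>closure (\<omega> i). w y = c \<and> \<tau> y = \<sigma> i y"
    using component_closure(1,2)[OF in_components_subset[OF comp] piece] by simp
  have iso: "\<forall>i<n. isometric (\<sigma> i)" using \<sigma> by simp
  show ?thesis
    by (intro exI[of _ c] exI[of _ n] exI[of _ \<omega>] exI[of _ \<sigma>] conjI c(1) n1 sets disj iso image dense vals)
qed

end

section \<open>From weighted compositions back to operators\<close>

lemma test_funs_cont_funs: "f \<in> test_funs \<Omega> \<Longrightarrow> f \<in> cont_funs (closure \<Omega>)"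
  unfolding cont_funs_def
  using C_k_continuous[OF test_funsD(1)[of f \<Omega> 0]] test_funsD(4)[of f \<Omega>] closure_subset[of \<Omega>] by blast

theorem theorem5p5:
  fixes \<Omega>1 \<Omega>2 :: "'a::euclidean_space set"
    and U :: "('a \<Rightarrow> complex) \<Rightarrow> ('a \<Rightarrow> complex)"
  assumes "admissible_domain \<Omega>1" and "admissible_domain \<Omega>2"
    and "bounded_linear_operator (closure \<Omega>1) (closure \<Omega>2) U"
    and disjointness_preserving:
      "\<forall>f\<in>cont_funs (closure \<Omega>1). \<forall>g\<in>cont_funs (closure \<Omega>1).
         (\<forall>x. f x * g x = 0) \<longrightarrow> (\<forall>y. U f y * U g y = 0)"
    and robin:
      "\<exists>\<beta> :: 'a \<Rightarrow> real. continuous_on (frontier \<Omega>2) \<beta> \<and> U ` test_funs \<Omega>1 \<subseteq> robin_domain \<Omega>2 \<beta>"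
    and intertwining:
      "\<forall>f\<in>test_funs \<Omega>1. has_distr_laplacian \<Omega>2 (U f) (U (laplacian f))"
    and nondegenerate:
      "\<forall>\<omega>. open \<omega> \<and> \<omega> \<subseteq> \<Omega>2 \<and> (\<forall>f\<in>test_funs \<Omega>1. \<forall>y\<in>\<omega>. U f y = 0) \<longrightarrow> \<omega> = {}"
  shows "\<exists>c :: complex. c \<noteq> 0 \<and>
    (\<exists>(n::nat) (\<omega> :: nat \<Rightarrow> 'a set) (\<tau> :: nat \<Rightarrow> 'a \<Rightarrow> 'a). n \<ge> 1 \<and>
      (\<forall>i<n. open (\<omega> i) \<and> connected (\<omega> i) \<and> \<omega> i \<noteq> {} \<and> \<omega> i \<subseteq> \<Omega>2) \<and>
      disjoint_family_on \<omega> {..<n} \<and>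
      (\<forall>i<n. \<forall>x y. dist (\<tau> i x) (\<tau> i y) = dist x y) \<and>
      (\<forall>i<n. \<tau> i ` \<omega> i = \<Omega>1) \<and>
      \<Omega>2 \<subseteq> closure (\<Union>i<n. \<omega> i) \<and>
      (\<forall>f\<in>cont_funs (closure \<Omega>1). \<forall>i<n. \<forall>y\<in>closure (\<omega> i). U f y = c * f (\<tau> i y)))"
proof -
  note dom1 = admissible_domain_basic[OF assms(1)] and dom2 = admissible_domain_basic[OF assms(2)]
  have K: "compact (closure \<Omega>1)" "closure \<Omega>1 \<noteq> {}" and L: "compact (closure \<Omega>2)"
    using dom1 dom2 by (simp_all add: compact_closure)
  from disjointness_preserving_representation[OF K L assms(3) disjointness_preserving]
  obtain w \<tau> where w: "w \<in> cont_funs (closure \<Omega>2)" and \<tau>: "\<forall>y. \<tau> y \<in> closure \<Omega>1"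
    and U: "\<forall>f\<in>cont_funs (closure \<Omega>1). \<forall>y. U f y = w y * f (\<tau> y)"
    and \<tau>c: "continuous_on {y \<in> closure \<Omega>2. w y \<noteq> 0} \<tau>"
    by (elim exE conjE) (rule that)
  obtain \<beta> where \<beta>: "U ` test_funs \<Omega>1 \<subseteq> robin_domain \<Omega>2 \<beta>" using robin by blast
  have Ut: "U f = (\<lambda>y. w y * f (\<tau> y))" if "f \<in> test_funs \<Omega>1" for f
    by (rule ext) (rule spec[OF bspec[OF U test_funs_cont_funs[OF that]]])
  interpret intertwining_composition \<Omega>1 \<Omega>2 w \<tau> \<beta>
  proof
    fix f assume f: "f \<in> test_funs \<Omega>1"
    show "(\<lambda>y. w y * f (\<tau> y)) \<in> robin_domain \<Omega>2 \<beta>" using \<beta> f Ut[OF f] by auto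
    show "has_distr_laplacian \<Omega>2 (\<lambda>y. w y * f (\<tau> y)) (\<lambda>y. w y * laplacian f (\<tau> y))"
      using bspec[OF intertwining f] unfolding Ut[OF f] Ut[OF test_funs_laplacian[OF f]] .
  next
    fix \<omega> assume "open \<omega>" "\<omega> \<subseteq> \<Omega>2" "\<And>f y. f \<in> test_funs \<Omega>1 \<Longrightarrow> y \<in> \<omega> \<Longrightarrow> w y * f (\<tau> y) = 0"
    then show "\<omega> = {}" using spec[OF nondegenerate, of \<omega>] Ut by simp
  qed (use assms w \<tau> \<tau>c in auto)
  from decomposition obtain c and n :: nat and \<omega> :: "nat \<Rightarrow> 'a set" and \<sigma> :: "nat \<Rightarrow> 'a \<Rightarrow> 'a" where
    D: "c \<noteq> 0" "n \<ge> 1"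
    "\<forall>i<n. open (\<omega> i) \<and> connected (\<omega> i) \<and> \<omega> i \<noteq> {} \<and> \<omega> i \<subseteq> \<Omega>2"
    "disjoint_family_on \<omega> {..<n}" "\<forall>i<n. isometric (\<sigma> i)" "\<forall>i<n. \<sigma> i ` \<omega> i = \<Omega>1"
    "\<Omega>2 \<subseteq> closure (\<Union>i<n. \<omega> i)" "\<forall>i<n. \<forall>y\<in>closure (\<omega> i). w y = c \<and> \<tau> y = \<sigma> i y"
    by (elim exE conjE) (rule that)
  have "\<forall>i<n. \<forall>x y. dist (\<sigma> i x) (\<sigma> i y) = dist x y" using D(5) by (simp add: isometric_def)
  moreover have "\<forall>f\<in>cont_funs (closure \<Omega>1). \<forall>i<n. \<forall>y\<in>closure (\<omega> i). U f y = c * f (\<sigma> i y)"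
    using U D(8) by simp
  ultimately show ?thesis using D(1-4,6,7)
    by (intro exI[of _ c] exI[of _ n] exI[of _ \<omega>] exI[of _ \<sigma>] conjI)
qed

end
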